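(* Let $\ell$ be a prime and $q$ an odd prime power with $q\equiv1\pmod\ell$. Let $v_0$ be a finite place of $\mathbb{F}_q(X)$ and denote by $\chi_{v_0}$ the $\ell$-th power residue symbol, which is a Dirichlet character of modulus $v_0$. Let $d$ be the degree of the conductor of the character, and let $L(s,\chi_{v_0})$ be the $L$-function attached to $\chi_{v_0}$. For any $s=\sigma+it$ with $\sigma\ge1/2$, we have as $d\to\infty$ $$\log\left|L(s,\chi_{v_0})\right|\le\left(\frac{\log2}{2}+o(1)\right)\frac{d}{\log_q d}.$$ Hence, for any $\varepsilon>0$, $$L(s,\chi_{v_0})\ll_{q,\varepsilon}\left(q^d\right)^\varepsilon.$$
   Context: The place $v_0$ corresponds to a monic irreducible polynomial $v_0(X)\in\mathbb{F}_q[X]$. The character is $\chi_{v_0}(v)=\left(\frac{v_0}{v}\right)_\ell$ for finite places $v\ne v_0$ (identifying the $\ell$-th roots of unity in $\mathbb{F}_q$ with those in $\mathbb{C}$), and $\chi_{v_0}(v_0)=0$; it is a character of the cyclic degree $\ell$ extension $\mathbb{F}_q(C_{v_0})/\mathbb{F}_q(X)$ where $C_{v_0}:Y^\ell=v_0(X)$, and is extended accordingly to the place at infinity (value $0$ if $\ell\nmid\deg v_0$, i.e. if infinity ramifies, and value $1$ if $\ell\mid\deg v_0$). The $L$-function is $$L(s,\chi_{v_0})=\prod_v\left(1-\chi_{v_0}(v)q^{-s\deg v}\right)^{-1},$$ the product being over all places $v$ of $\mathbb{F}_q(X)$ including infinity (for $\operatorname{Re}(s)>1$, and by continuation in general); it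 is a polynomial in $q^{-s}$ of degree $d-2$. If $g$ is the genus of $C_{v_0}$, then $d-2=2g/(\ell-1)$; the conductor includes the place at infinity when it ramifies. The $o(1)$ tends to $0$ as $d\to\infty$ uniformly in $s$ with $\sigma\ge1/2$ and in $v_0$, with $q$ fixed. *)

theory Defs
  imports
    "HOL-Complex_Analysis.Complex_Analysis"
    "HOL-Computational_Algebra.Computational_Algebra"
    "HOL-Number_Theory.Cong"
    "HOL-Library.Landau_Symbols"
begin

text \<open>
  Throughout, the finite field with \<open>q\<close> elements is a type \<open>'a\<close> of class
  \<^class>\<open>finite_field\<close>, and \<open>q = CARD('a)\<close>.
\<close>

subsection \<open>Places of the rational function field\<close>

definition monic_irreducible :: "'a::finite_field poly \<Rightarrow> bool" where
  "monic_irreducible P \<longleftrightarrow> lead_coeff P = 1 \<and> irreducible P"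

datatype 'p place = Fin 'p | Infty

definition places :: "'a::finite_field poly place set" where
  "places = insert Infty (Fin ` {P. monic_irreducible P})"

primrec place_degree :: "'a::finite_field poly place \<Rightarrow> nat" where
  "place_degree (Fin P) = degree P"
| "place_degree Infty = 1"

subsection \<open>The power residue character\<close>

text \<open>
  For a monic irreducible \<open>P\<close> and \<open>q \<equiv> 1\<close> modulo \<open>l\<close>, the symbol is the constant congruent
  to \<open>f ^ ((q ^ degree P - 1) / l)\<close> modulo \<open>P\<close>; it is an \<open>l\<close>-th root of unity
  if \<open>P\<close> does not divide \<open>f\<close>, and \<open>0\<close> otherwise.
\<close>

definition power_residue :: "nat \<Rightarrow> 'a::finite_field poly \<Rightarrow> 'a poly \<Rightarrow> 'a" where
  "power_residue l f P =
     (THE a. [f ^ ((CARD('a) ^ degree P - 1) div l) = [:a:]] (mod P))"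

definition roots_of_unity_iso :: "nat \<Rightarrow> ('a::finite_field \<Rightarrow> complex) \<Rightarrow> bool" where
  "roots_of_unity_iso l \<iota> \<longleftrightarrow>
     bij_betw \<iota> {z. z ^ l = 1} {w. w ^ l = 1} \<and>
     (\<forall>x y. x ^ l = 1 \<longrightarrow> y ^ l = 1 \<longrightarrow> \<iota> (x * y) = \<iota> x * \<iota> y)"

primrec chi :: "nat \<Rightarrow> ('a::finite_field \<Rightarrow> complex) \<Rightarrow> 'a poly \<Rightarrow> 'a poly place \<Rightarrow> complex" where
  "chi l \<iota> v0 (Fin P) = (if P = v0 then 0 else \<iota> (power_residue l v0 P))"
| "chi l \<iota> v0 Infty = (if l dvd degree v0 then 1 else 0)"

subsection \<open>The conductor\<close>

text \<open>
  The multiplicative extension of a function on places to the (finite part of the) divisor of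
  a nonzero polynomial. The maximum is the multiplicity of \<open>P\<close> in \<open>A\<close>; the
  constant \<^const>\<open>multiplicity\<close> is not available for polynomials over a plain finite field.
\<close>

definition char_poly_ext :: "('a::finite_field poly place \<Rightarrow> complex) \<Rightarrow> 'a poly \<Rightarrow> complex" where
  "char_poly_ext \<psi> A =
     (\<Prod>P | monic_irreducible P \<and> P dvd A. \<psi> (Fin P) ^ Max {n. P ^ n dvd A})"

text \<open>
  An effective divisor is given by its finite part, a monic polynomial \<open>M\<close>, and its
  multiplicity \<open>m\<close> at infinity. It is a modulus of definition of \<open>\<psi>\<close> if its support
  contains all places at which \<open>\<psi>\<close> vanishes, and \<open>\<psi>\<close> is trivial on the divisor of every
  rational function \<open>A / B\<close> that is congruent to \<open>1\<close> modulo \<open>(M, m)\<close>. At infinity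
  \<open>A / B\<close> has order \<open>degree B - degree A\<close> and \<open>A / B - 1\<close> has order
  \<open>degree B - degree (A - B)\<close>.
\<close>

definition is_modulus :: "('a::finite_field poly place \<Rightarrow> complex) \<Rightarrow> 'a poly \<Rightarrow> nat \<Rightarrow> bool" where
  "is_modulus \<psi> M m \<longleftrightarrow>
     lead_coeff M = 1 \<and>
     (\<forall>P. monic_irreducible P \<and> \<psi> (Fin P) = 0 \<longrightarrow> P dvd M) \<and>
     (\<psi> Infty = 0 \<longrightarrow> m > 0) \<and>
     (\<forall>A B. A \<noteq> 0 \<and> B \<noteq> 0 \<and> coprime A M \<and> coprime B M \<and> [A = B] (mod M) \<and>
        (m > 0 \<longrightarrow> A = B \<or> degree (A - B) + m \<le> degree B) \<longrightarrow>
        char_poly_ext \<psi> A / char_poly_ext \<psi> B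
          * \<psi> Infty powi (int (degree B) - int (degree A)) = 1)"

text \<open>
  Moduli of definition are closed under taking minima of the multiplicities, so the conductor,
  the smallest modulus of definition, is the one of least degree.
\<close>

definition conductor_degree :: "('a::finite_field poly place \<Rightarrow> complex) \<Rightarrow> nat" where
  "conductor_degree \<psi> = (LEAST d. \<exists>M m. is_modulus \<psi> M m \<and> d = degree M + m)"

subsection \<open>The L-function\<close>

definition euler_factor :: "('a::finite_field poly place \<Rightarrow> complex) \<Rightarrow> complex \<Rightarrow> 'a poly place \<Rightarrow> complex" where
  "euler_factor \<psi> s v =
     inverse (1 - \<psi> v * of_nat CARD('a) powr (- s * of_nat (place_degree v)))"

text \<open>
  The unique entire function that agrees with the (unordered) Euler product over all places
  for \<open>Re s > 1\<close>. The characters considered here are nontrivial, so it has no poles.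
\<close>

definition L_function :: "('a::finite_field poly place \<Rightarrow> complex) \<Rightarrow> complex \<Rightarrow> complex" where
  "L_function \<psi> = (THE f. f holomorphic_on UNIV \<and>
     (\<forall>s. Re s > 1 \<longrightarrow>
        ((\<lambda>S. \<Prod>v\<in>S. euler_factor \<psi> s v) \<longlongrightarrow> f s) (finite_subsets_at_top places)))"

end

theory Submission
  imports "HOL-Algebra.Algebraic_Closure_Type" Defs "HOL-Real_Asymp.Real_Asymp"
begin

text \<open>
  Reciprocity turns the \<open>l\<close>-th power residue symbol of \<open>v0\<close> into a character of the polynomials
  modulo \<open>v0\<close>, so the \<open>L\<close>-function is a polynomial in \<open>u = q powr - s\<close> of degree at most
  \<open>degree v0\<close>, and this is at most the degree of the conductor. The Riemann hypothesis for it
  (inverse roots of modulus at most \<open>sqrt q\<close>) comes from Stepanov's method in Bombieri's form,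
  carried out inside \<open>F\<^sub>q[X]\<close>: a nonzero polynomial of degree about \<open>q ^ n / l\<close> vanishes at all
  primes of degree dividing \<open>n\<close> with a given residue symbol, and the resulting upper bounds for
  the \<open>l\<close> symbol classes imply lower bounds because the classes add up to \<open>q ^ n\<close>, apart from
  the contribution of \<open>v0\<close>.

  On the disc \<open>\<bar>z\<bar> \<le> 1\<close> the function \<open>ln \<bar>1 - z\<bar>\<close> has a majorant \<open>ln 2 / M - Re (p z)\<close> where \<open>p\<close> is a
  polynomial of degree less than \<open>M\<close> without constant term. Summing over the inverse roots, the
  first term gives \<open>degree v0 * ln 2 / M\<close> and the second one only involves the first \<open>M - 1\<close> power
  sums, which are trivially \<open>O(q ^ n)\<close>. The choice \<open>M = 2 log q d - O(log log d)\<close> concludes.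
\<close>

subsection \<open>Polynomials over a finite field\<close>

text \<open>The power sums need two different bounds. Stepanov's argument only has to give
  \<open>K * sqrt q ^ n\<close> with a constant depending on \<open>v0\<close> and \<open>l\<close>:
  this bound acts through the radius of convergence of the logarithm and keeps the zeros out of the
  disc of radius \<open>1 / sqrt q\<close>. The size estimate uses the trivial bound
  \<open>q ^ n + 1\<close> instead, because the square-root bound would bring in a factor of the
  order of the degree. On the circle of radius \<open>1 / sqrt q\<close> the trivial bound makes the
  first \<open>M\<close> terms cost about \<open>M * sqrt q ^ M\<close>, which is negligible as long
  as \<open>M\<close> stays slightly below \<open>2 log_q d\<close>; this is the origin of the
  factor 1/2 in the theorem.

  The constant \<open>ln 2 / M\<close> is the best possible: averaging over the \<open>M\<close>
  solutions of \<open>z ^ M = -1\<close> kills every polynomial of degree less than \<open>M\<close>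
  without constant term, while the product of \<open>1 - z\<close> over these points is 2.

  Irreducible polynomials are handled through a root in the algebraic closure, which turns
  congruences into equations; the function field of the curve never appears.\<close>

lemma card_finite_field_gt_1: "CARD('a::finite_field) > 1"
proof -
  have "card {0, 1 :: 'a} \<le> CARD('a)"
    by (intro card_mono) auto
  thus ?thesis by simp
qed

text \<open>Stated through coefficients rather than \<open>degree\<close>, so that 0 belongs to it
  even for \<open>n = 0\<close> and closure under addition is immediate.\<close>

definition polys_below :: "nat \<Rightarrow> 'a::finite_field poly set" where
  "polys_below n = {A. \<forall>i\<ge>n. coeff A i = 0}"

lemma polys_below_0: "polys_below 0 = {0}"
  by (auto simp: polys_below_def poly_eq_iff)

lemma polys_below_Suc: "polys_below (Suc n) = (\<lambda>(a, A). pCons a A) ` (UNIV \<times> polys_below n)"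
proof (intro equalityI subsetI)
  fix A :: "'a poly" assume A: "A \<in> polys_below (Suc n)"
  obtain a B where "A = pCons a B" by (cases A) auto
  moreover from this A have "B \<in> polys_below n"
    by (auto simp: polys_below_def coeff_pCons split: nat.splits)
  ultimately show "A \<in> (\<lambda>(a, A). pCons a A) ` (UNIV \<times> polys_below n)" by auto
qed (auto simp: polys_below_def coeff_pCons split: nat.splits)

lemma polys_below_finite_card:
  "finite (polys_below n :: 'a::finite_field poly set) \<and>
   card (polys_below n :: 'a poly set) = CARD('a) ^ n"
proof (induction n)
  case 0
  thus ?case by (simp add: polys_below_0)
next
  case (Suc n)
  have "inj_on (\<lambda>(a, A). pCons a A) (UNIV \<times> (polys_below n :: 'a poly set))"
    by (auto simp: inj_on_def)
  thus ?case
    using Suc by (simp add: polys_below_Suc card_image card_cartesian_product)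
qed

lemmas finite_polys_below [simp] = polys_below_finite_card [THEN conjunct1]
lemmas card_polys_below = polys_below_finite_card [THEN conjunct2]

lemma polys_below_iff: "A \<in> polys_below n \<longleftrightarrow> A = 0 \<or> degree A < n"
proof
  assume *: "A \<in> polys_below n"
  show "A = 0 \<or> degree A < n"
  proof (cases "A = 0")
    case False
    hence "coeff A (degree A) \<noteq> 0" by simp
    with * show ?thesis unfolding polys_below_def by (metis (mono_tags, lifting) mem_Collect_eq not_le)
  qed auto
qed (auto simp: polys_below_def coeff_eq_0)

lemma polys_below_add: "A \<in> polys_below n \<Longrightarrow> B \<in> polys_below n \<Longrightarrow> A + B \<in> polys_below n"
  and polys_below_diff: "A \<in> polys_below n \<Longrightarrow> B \<in> polys_below n \<Longrightarrow> A - B \<in> polys_below n"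
  by (auto simp: polys_below_def)

section \<open>Additivity of Frobenius\<close>

text \<open>The polynomial \<open>(X + 1) ^ q - X ^ q - 1\<close> has degree less than
  \<open>q\<close> but vanishes at all \<open>q\<close> elements of the field, so it is 0. This
  avoids writing \<open>q\<close> as a power of the characteristic.\<close>

lemma of_nat_card_choose_eq_0:
  assumes "0 < k" "k < CARD('a::finite_field)"
  shows "of_nat (CARD('a) choose k) = (0::'a)"
proof -
  let ?q = "CARD('a)"
  define D :: "'a poly" where "D = [:1,1:] ^ ?q - monom 1 ?q - 1"
  have q: "?q > 1" by (rule card_finite_field_gt_1)
  have deg: "degree ([:1,1:] ^ ?q :: 'a poly) = ?q"
    by (simp add: degree_power_eq)
  have "D = 0"
  proof (rule ccontr)
    assume "D \<noteq> 0"
    have "coeff D i = 0" if "i \<ge> ?q" for i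
    proof (cases "i = ?q")
      case True
      have "coeff ([:1,1:] ^ ?q :: 'a poly) ?q = 1"
        using lead_coeff_power[of "[:1,1:] :: 'a poly" ?q] deg by simp
      thus ?thesis using True q by (simp add: D_def)
    next
      case False
      with that have "i > ?q" by simp
      thus ?thesis using deg by (simp add: D_def coeff_eq_0)
    qed
    hence "D \<in> polys_below ?q" by (simp add: polys_below_def)
    with \<open>D \<noteq> 0\<close> have "degree D < ?q" by (simp add: polys_below_iff)
    moreover have "poly D x = 0" for x
      by (simp add: D_def poly_monom finite_field_power_card_eq_same)
    hence "{x. poly D x = 0} = UNIV" by auto
    with card_poly_roots_bound[OF \<open>D \<noteq> 0\<close>] have "?q \<le> degree D" by simp
    ultimately show False by simp
  qed
  hence "coeff ([:1,1:] ^ ?q :: 'a poly) k = coeff (monom 1 ?q + 1) k"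
    by (simp add: D_def algebra_simps)
  also have "\<dots> = 0" using assms by simp
  finally have *: "coeff ([:1,1:] ^ ?q :: 'a poly) k = 0" .
  have "coeff ([:1,1:] ^ ?q :: 'a poly) k = of_nat (?q choose k)"
    using assms by (subst coeff_linear_poly_power) auto
  with * show ?thesis by simp
qed

text \<open>The binomial coefficients are divisible by the characteristic, and this transfers to any
  commutative ring of equal characteristic. It is needed both for the algebraic closure and for the
  polynomial ring itself.\<close>

lemma frobenius_add:
  fixes x y :: "'b::comm_ring_1"
  assumes "CHAR('b) = CHAR('a::finite_field)"
  shows "(x + y) ^ (CARD('a) ^ n) = x ^ (CARD('a) ^ n) + y ^ (CARD('a) ^ n)"
proof (induction n)
  case (Suc n)
  have *: "(u + v) ^ CARD('a) = u ^ CARD('a) + v ^ CARD('a)" for u v :: 'b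
  proof -
    let ?q = "CARD('a)"
    have "(u + v) ^ ?q = (\<Sum>k\<le>?q. of_nat (?q choose k) * u ^ k * v ^ (?q - k))"
      by (rule binomial_ring)
    also have "\<dots> = (\<Sum>k\<in>{0, ?q}. of_nat (?q choose k) * u ^ k * v ^ (?q - k))"
    proof (rule sum.mono_neutral_right)
      show "\<forall>k\<in>{..?q} - {0, ?q}. of_nat (?q choose k) * u ^ k * v ^ (?q - k) = 0"
      proof
        fix k assume "k \<in> {..?q} - {0, ?q}"
        hence "0 < k" "k < ?q" by auto
        hence "CHAR('a) dvd (?q choose k)"
          using of_nat_card_choose_eq_0[of k, where 'a = 'a] of_nat_eq_0_iff_char_dvd by blast
        hence "of_nat (?q choose k) = (0 :: 'b)"
          using assms of_nat_eq_0_iff_char_dvd by metis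
        thus "of_nat (?q choose k) * u ^ k * v ^ (?q - k) = 0" by simp
      qed
    qed auto
    also have "\<dots> = u ^ ?q + v ^ ?q"
      by simp
    finally show ?thesis .
  qed
  show ?case
    by (simp only: power_Suc2 power_mult Suc *)
qed auto

lemma frobenius_sum:
  fixes g :: "'c \<Rightarrow> 'b::comm_ring_1"
  assumes "CHAR('b) = CHAR('a::finite_field)"
  shows "(\<Sum>x\<in>S. g x) ^ (CARD('a) ^ n) = (\<Sum>x\<in>S. g x ^ (CARD('a) ^ n))"
  by (induction S rule: infinite_finite_induct)
     (simp_all add: frobenius_add[OF assms] zero_power)

lemma frobenius_diff:
  fixes x y :: "'b::comm_ring_1"
  assumes "CHAR('b) = CHAR('a::finite_field)"
  shows "(x - y) ^ (CARD('a) ^ n) = x ^ (CARD('a) ^ n) - y ^ (CARD('a) ^ n)"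
  using frobenius_add[OF assms, of "x - y" y n] by simp

subsection \<open>Evaluation in the algebraic closure\<close>

text \<open>At a root \<open>x\<close> of an irreducible \<open>P\<close>, the range of
  \<open>ev x\<close> is a copy of the residue field of \<open>P\<close>.\<close>

definition ev :: "'a::finite_field alg_closure \<Rightarrow> 'a poly \<Rightarrow> 'a alg_closure" where
  "ev x A = poly (map_poly to_ac A) x"

lemma ev_0 [simp]: "ev x 0 = 0"
  by (simp add: ev_def)

lemma ev_pCons [simp]: "ev x (pCons a A) = to_ac a + x * ev x A"
  by (cases "pCons a A = 0") (auto simp: ev_def map_poly_pCons)

lemma ev_1 [simp]: "ev x 1 = 1"
  by (simp add: one_pCons)

lemma ev_add [simp]: "ev x (A + B) = ev x A + ev x B"
proof (induction A arbitrary: B)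
  case (pCons a A)
  obtain b C where B: "B = pCons b C" by (cases B)
  show ?case
    unfolding B add_pCons ev_pCons pCons.IH by (simp add: algebra_simps)
qed auto

lemma ev_minus [simp]: "ev x (- A) = - ev x A"
  by (induction A) auto

lemma ev_diff [simp]: "ev x (A - B) = ev x A - ev x B"
  using ev_add[of x A "- B"] by simp

lemma ev_smult [simp]: "ev x (smult c A) = to_ac c * ev x A"
  by (induction A) (auto simp: algebra_simps)

lemma ev_mult [simp]: "ev x (A * B) = ev x A * ev x B"
  by (induction A) (auto simp: algebra_simps)

lemma ev_power [simp]: "ev x (A ^ n) = ev x A ^ n"
  by (induction n) auto

lemma ev_sum: "ev x (\<Sum>i\<in>S. g i) = (\<Sum>i\<in>S. ev x (g i))"
  by (induction S rule: infinite_finite_induct) auto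

lemma ev_monom [simp]: "ev x (monom c n) = to_ac c * x ^ n"
  by (induction n) (auto simp: monom_Suc monom_0)

lemma ev_frobenius: "ev x A ^ (CARD('a) ^ n) = ev (x ^ (CARD('a) ^ n)) A"
  for A :: "'a::finite_field poly"
proof (induction A)
  case (pCons a A)
  have "to_ac a ^ (CARD('a) ^ n) = to_ac a"
    by (metis finite_field_power_card_power_eq_same to_ac_power)
  thus ?case
    by (simp add: pCons frobenius_add[where 'a = 'a] power_mult_distrib)
qed (simp add: zero_power)

section \<open>Roots of irreducible polynomials and residue fields\<close>

lemma monic_irreducibleD:
  assumes "monic_irreducible P"
  shows "irreducible P" "prime_elem P" "lead_coeff P = 1" "P \<noteq> 0" "degree P > 0" "\<not> P dvd 1"
proof -
  show *: "irreducible P" "lead_coeff P = 1" using assms by (auto simp: monic_irreducible_def)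
  show "prime_elem P" using * by (simp add: field_poly_irreducible_imp_prime)
  show "P \<noteq> 0" using * by auto
  show "\<not> P dvd 1" using * by (simp add: irreducible_def)
  thus "degree P > 0"
    using \<open>P \<noteq> 0\<close> by (metis gr0I is_unit_iff_degree)
qed

lemma monic_dvd_monic_irreducible:
  fixes A B :: "'a::finite_field poly"
  assumes "A dvd B" "lead_coeff A = 1" "monic_irreducible B" "\<not> A dvd 1"
  shows "A = B"
proof -
  from assms obtain C where C: "B = A * C" by (auto elim: dvdE)
  hence "C dvd 1" using assms by (auto simp: irreducible_def monic_irreducible_def)
  then obtain c where c: "C = [:c:]" by (auto simp: is_unit_poly_iff)
  have "lead_coeff B = lead_coeff A * lead_coeff C" by (simp add: C lead_coeff_mult)
  hence "c = 1" using assms c by (simp add: monic_irreducible_def)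
  thus ?thesis using C c by simp
qed

lemma exists_root_ev:
  assumes "degree A > 0"
  shows "\<exists>x. ev x A = 0"
  unfolding ev_def using assms
  by (intro alg_closed_imp_poly_has_root) (simp add: degree_map_poly)

lemma ev_eq_0_iff_dvd:
  assumes P: "monic_irreducible P" and x: "ev x P = 0"
  shows "ev x A = 0 \<longleftrightarrow> P dvd A"
proof
  assume A: "ev x A = 0"
  \<comment> \<open>A polynomial \<open>G\<close> of least degree vanishing at \<open>x\<close>
    divides every polynomial vanishing at \<open>x\<close>; it divides \<open>P\<close> and is not a
    unit, so it is associated to \<open>P\<close>.\<close>
  define S where "S = {B. B \<noteq> 0 \<and> ev x B = 0}"
  have "P \<in> S" using monic_irreducibleD[OF P] x by (auto simp: S_def)
  then obtain G where G: "G \<in> S" "\<And>B. B \<in> S \<Longrightarrow> degree G \<le> degree B"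
    using arg_min_nat_lemma[of "\<lambda>B. B \<in> S" P degree] by metis
  have dvd: "G dvd B" if "ev x B = 0" for B
  proof -
    have "ev x (B mod G) = ev x (B - B div G * G)"
      by (simp add: minus_div_mult_eq_mod)
    also have "\<dots> = 0" using that G(1) by (simp add: S_def)
    finally have "B mod G = 0"
      using G degree_mod_less[of G B] by (force simp: S_def)
    thus ?thesis by (simp add: mod_eq_0_iff_dvd)
  qed
  from dvd[OF x] obtain H where H: "P = G * H" by (auto elim: dvdE)
  have "\<not> G dvd 1"
  proof
    assume "G dvd 1"
    then obtain H' where "1 = G * H'" by (auto elim: dvdE)
    hence "ev x 1 = ev x G * ev x H'" by (metis ev_mult)
    thus False using G(1) by (simp add: S_def)
  qed
  hence "H dvd 1" using monic_irreducibleD(1)[OF P] H by (auto simp: irreducible_def)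
  hence "P dvd G" using H by (metis dvd_mult_unit_iff dvd_refl mult.commute)
  thus "P dvd A" using dvd[OF A] by (rule dvd_trans)
next
  assume "P dvd A"
  thus "ev x A = 0" using x by (auto elim!: dvdE)
qed

lemma ev_inj_on_polys_below:
  assumes P: "monic_irreducible P" and x: "ev x P = 0"
  shows "inj_on (ev x) (polys_below (degree P))"
proof (rule inj_onI)
  fix A B assume AB: "A \<in> polys_below (degree P)" "B \<in> polys_below (degree P)" "ev x A = ev x B"
  hence "P dvd A - B" using ev_eq_0_iff_dvd[OF P x, of "A - B"] by simp
  hence dvd: "P dvd A - B" .
  have "A - B = 0 \<or> degree (A - B) < degree P"
    using polys_below_diff[OF AB(1,2)] by (simp add: polys_below_iff)
  with dvd show "A = B"
    using dvd_imp_degree_le[of P "A - B"] by (cases "A - B = 0") auto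
qed

lemma ev_mod:
  assumes "ev x P = 0"
  shows "ev x (A mod P) = ev x A"
proof -
  have "ev x A = ev x (A div P * P + A mod P)" by simp
  also have "\<dots> = ev x (A mod P)" unfolding ev_add ev_mult assms by simp
  finally show ?thesis by simp
qed

lemma mod_in_polys_below: "degree P > 0 \<Longrightarrow> A mod P \<in> polys_below (degree P)"
  by (cases "P = 0") (use degree_mod_less[of P A] in \<open>auto simp: polys_below_iff\<close>)

lemma range_ev:
  assumes P: "monic_irreducible P" and x: "ev x P = 0"
  shows "range (ev x) = ev x ` polys_below (degree P)"
proof -
  have "ev x A \<in> ev x ` polys_below (degree P)" for A
    by (rule image_eqI[where x = "A mod P"])
       (use ev_mod[OF x, of A] mod_in_polys_below[of P A] monic_irreducibleD(5)[OF P] in auto)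
  thus ?thesis by auto
qed

lemma card_range_ev:
  fixes P :: "'a::finite_field poly"
  assumes P: "monic_irreducible P" and x: "ev x P = 0"
  shows "card (range (ev x)) = CARD('a) ^ degree P" "finite (range (ev x))"
  unfolding range_ev[OF assms] using ev_inj_on_polys_below[OF assms]
  by (simp_all add: card_image card_polys_below)

text \<open>Multiplication by \<open>ev x A\<close> permutes the finite set of nonzero values of
  \<open>ev x\<close>; comparing the products over this set gives the claim.\<close>

lemma fermat_ev:
  fixes P :: "'a::finite_field poly"
  assumes P: "monic_irreducible P" and x: "ev x P = 0" and A: "ev x A \<noteq> 0"
  shows "ev x A ^ (CARD('a) ^ degree P - 1) = 1"
proof -
  define V where "V = range (ev x) - {0}"
  have fin: "finite V" and card: "card V = CARD('a) ^ degree P - 1"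
  proof -
    have "0 \<in> range (ev x)" by (metis ev_0 rangeI)
    thus "finite V" "card V = CARD('a) ^ degree P - 1"
      using card_range_ev[OF P x] by (simp_all add: V_def)
  qed
  let ?a = "ev x A"
  have sub: "(\<lambda>v. ?a * v) ` V \<subseteq> V"
  proof (rule image_subsetI)
    fix v assume "v \<in> V"
    then obtain B where "v = ev x B" "v \<noteq> 0" by (auto simp: V_def)
    thus "?a * v \<in> V" using A by (auto simp: V_def intro: range_eqI[of _ _ "A * B"])
  qed
  have inj: "inj_on (\<lambda>v. ?a * v) V" using A by (auto simp: inj_on_def)
  have "(\<lambda>v. ?a * v) ` V = V"
    using sub inj fin by (simp add: endo_inj_surj)
  hence "\<Prod>V = (\<Prod>v\<in>V. ?a * v)"
    using prod.reindex[OF inj, of "\<lambda>v. v"] by simp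
  also have "\<dots> = ?a ^ card V * \<Prod>V" by (simp add: prod.distrib)
  finally have "\<Prod>V * (?a ^ card V - 1) = 0" by (simp add: algebra_simps)
  moreover have "\<Prod>V \<noteq> 0" using fin by (auto simp: V_def)
  ultimately show ?thesis using card by simp
qed

lemma ev_power_card:
  fixes P :: "'a::finite_field poly"
  assumes P: "monic_irreducible P" and x: "ev x P = 0" and dvd: "degree P dvd n"
  shows "ev x A ^ (CARD('a) ^ n) = ev x A"
proof -
  have *: "ev x A ^ (CARD('a) ^ degree P) = ev x A" for A
  proof (cases "ev x A = 0")
    case False
    have "Suc (CARD('a) ^ degree P - 1) = CARD('a) ^ degree P" by simp
    thus ?thesis
      using fermat_ev[OF P x False] by (metis power_Suc mult_1_right)
  qed (simp add: zero_power)
  from dvd obtain k where n: "n = degree P * k" by (auto elim: dvdE)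
  have "ev x A ^ ((CARD('a) ^ degree P) ^ k) = ev x A"
    by (induction k) (simp_all add: power_mult *)
  thus ?thesis by (simp add: n power_mult)
qed

lemma dvd_monom_card_minus_X:
  fixes P :: "'a::finite_field poly"
  assumes P: "monic_irreducible P" and dvd: "degree P dvd n"
  shows "P dvd monom 1 (CARD('a) ^ n) - monom 1 1"
proof -
  obtain x where x: "ev x P = 0"
    using exists_root_ev[of P] monic_irreducibleD(5)[OF P] by auto
  have "ev x (monom 1 1) ^ (CARD('a) ^ n) = ev x (monom 1 1)"
    by (rule ev_power_card[OF P x dvd])
  thus ?thesis using ev_eq_0_iff_dvd[OF P x, of "monom 1 (CARD('a) ^ n) - monom 1 1"] by simp
qed

lemma ev_eq_iff_cong:
  assumes P: "monic_irreducible P" and x: "ev x P = 0"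
  shows "ev x A = ev x B \<longleftrightarrow> [A = B] (mod P)"
  using ev_eq_0_iff_dvd[OF P x, of "A - B"] by (simp add: cong_iff_dvd_diff)

text \<open>A smaller power of Frobenius cannot fix \<open>x\<close>, since it would fix all
  \<open>q\<close>-to-the-\<open>degree P\<close> elements of the field generated by \<open>x\<close>.\<close>

lemma frobenius_conjugates_distinct:
  fixes P :: "'a::finite_field poly"
  assumes P: "monic_irreducible P" and x: "ev x P = 0" and k: "0 < k" "k < degree P"
  shows "x ^ (CARD('a) ^ k) \<noteq> x"
proof
  assume *: "x ^ (CARD('a) ^ k) = x"
  define D :: "'a alg_closure poly" where "D = monom 1 (CARD('a) ^ k) - monom 1 1"
  have q: "CARD('a) > 1" by (rule card_finite_field_gt_1)
  have q1: "CARD('a) ^ k > 1" using one_less_power[OF q k(1)] .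
  have "coeff D (CARD('a) ^ k) = 1" using q1 by (simp add: D_def)
  hence "D \<noteq> 0" by auto
  have deg: "degree D \<le> CARD('a) ^ k"
    unfolding D_def using q1
    by (intro degree_diff_le) (simp_all add: degree_monom_eq)
  have "range (ev x) \<subseteq> {y. poly D y = 0}"
    by (auto simp: D_def poly_monom ev_frobenius *)
  hence "card (range (ev x)) \<le> card {y. poly D y = 0}"
    by (intro card_mono poly_roots_finite \<open>D \<noteq> 0\<close>)
  also have "\<dots> \<le> CARD('a) ^ k"
    using card_poly_roots_bound[OF \<open>D \<noteq> 0\<close>] deg by simp
  finally have "CARD('a) ^ degree P \<le> CARD('a) ^ k"
    using card_range_ev(1)[OF P x] by simp
  from power_le_imp_le_exp[OF q this] k show False by simp
qed

text \<open>Both sides are monic of degree \<open>degree P\<close>, so their difference has smaller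
  degree, yet it vanishes at the \<open>degree P\<close> distinct conjugates of \<open>x\<close>.
  This factorisation is what makes reciprocity a symmetric double product.\<close>

lemma map_poly_to_ac_eq_prod:
  fixes P :: "'a::finite_field poly"
  assumes P: "monic_irreducible P" and x: "ev x P = 0"
  shows "map_poly to_ac P = (\<Prod>j<degree P. [:- (x ^ (CARD('a) ^ j)), 1:])"
proof -
  let ?q = "CARD('a)" and ?d = "degree P"
  have inj: "inj_on (\<lambda>j. x ^ (?q ^ j)) {..<?d}"
  proof -
    have "x ^ (?q ^ i) \<noteq> x ^ (?q ^ j)" if "i < j" "j < ?d" for i j
    proof
      assume "x ^ (?q ^ i) = x ^ (?q ^ j)"
      \<comment> \<open>A coincidence between two conjugates is pulled back through the injective
        map \<open>y ^ (q ^ i)\<close> to a coincidence with \<open>x\<close> itself.\<close>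
      also have "x ^ (?q ^ j) = (x ^ (?q ^ (j - i))) ^ (?q ^ i)"
        using that by (simp flip: power_mult power_add)
      finally have "(x - x ^ (?q ^ (j - i))) ^ (?q ^ i) = 0"
        by (simp add: frobenius_diff[where 'a = 'a])
      hence "x ^ (?q ^ (j - i)) = x" by simp
      thus False using frobenius_conjugates_distinct[OF P x, of "j - i"] that by simp
    qed
    thus ?thesis
      unfolding inj_on_def by (metis lessThan_iff linorder_neqE_nat)
  qed
  define D where "D = map_poly to_ac P - (\<Prod>j<?d. [:- (x ^ (?q ^ j)), 1:])"
  have root: "poly D (x ^ (?q ^ j)) = 0" if "j < ?d" for j
  proof -
    have "poly (map_poly to_ac P) (x ^ (?q ^ j)) = ev x P ^ (?q ^ j)"
      unfolding ev_frobenius by (simp add: ev_def)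
    also have "\<dots> = 0" using x by (simp add: zero_power)
    finally show ?thesis using that by (auto simp: D_def poly_prod)
  qed
  have deg1: "degree (\<Prod>j<?d. [:- (x ^ (?q ^ j)), 1:]) = ?d"
    by (subst degree_prod_eq_sum_degree) auto
  have lead1: "lead_coeff (\<Prod>j<?d. [:- (x ^ (?q ^ j)), 1:]) = 1"
    by (simp add: lead_coeff_prod)
  have "D = 0"
  proof (rule ccontr)
    assume "D \<noteq> 0"
    have "coeff D i = 0" if "i \<ge> ?d" for i
    proof (cases "i = ?d")
      case True
      thus ?thesis using lead1 deg1 monic_irreducibleD(3)[OF P]
        by (simp add: D_def coeff_map_poly)
    next
      case False
      thus ?thesis using that deg1 by (simp add: D_def coeff_map_poly coeff_eq_0)
    qed
    hence "degree D < ?d" using \<open>D \<noteq> 0\<close>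
      by (metis leading_coeff_neq_0 linorder_le_less_linear)
    moreover have "card ((\<lambda>j. x ^ (?q ^ j)) ` {..<?d}) \<le> card {y. poly D y = 0}"
      using root by (intro card_mono poly_roots_finite \<open>D \<noteq> 0\<close>) auto
    hence "?d \<le> degree D"
      using card_poly_roots_bound[OF \<open>D \<noteq> 0\<close>] by (simp add: card_image[OF inj])
    ultimately show False by simp
  qed
  thus ?thesis by (simp add: D_def)
qed

text \<open>\<open>Y ^ q - Y\<close> has at most \<open>q\<close> roots and the base field already
  supplies \<open>q\<close> of them. Used to recognise values of the residue symbol as
  constants.\<close>

lemma range_to_ac_eq: "range (to_ac :: 'a::finite_field \<Rightarrow> _) = {y. y ^ CARD('a) = y}"
proof -
  define D :: "'a alg_closure poly" where "D = monom 1 CARD('a) - monom 1 1"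
  have q: "CARD('a) > 1" by (rule card_finite_field_gt_1)
  have "coeff D CARD('a) = 1" using q by (simp add: D_def)
  hence D0: "D \<noteq> 0" by auto
  have deg: "degree D \<le> CARD('a)"
    unfolding D_def using q by (intro degree_diff_le) (simp_all add: degree_monom_eq)
  have eq: "{y. y ^ CARD('a) = y} = {y. poly D y = 0}"
    by (auto simp: D_def poly_monom)
  have sub: "range to_ac \<subseteq> {y :: 'a alg_closure. y ^ CARD('a) = y}"
    by (auto simp: finite_field_power_card_eq_same simp flip: to_ac_power)
  have "card (range (to_ac :: 'a \<Rightarrow> _)) = CARD('a)"
    by (intro card_image inj_to_ac)
  moreover have "card {y :: 'a alg_closure. y ^ CARD('a) = y} \<le> CARD('a)"
    unfolding eq using card_poly_roots_bound[OF D0] deg by simp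
  moreover have "finite {y :: 'a alg_closure. y ^ CARD('a) = y}"
    unfolding eq by (rule poly_roots_finite[OF D0])
  ultimately show ?thesis using sub by (intro card_seteq) auto
qed

lemma nat_geometric_sum:
  fixes x :: nat
  assumes "x \<ge> 1"
  shows "(\<Sum>j<d. x ^ j) * (x - 1) = x ^ d - 1"
proof (induction d)
  case (Suc d)
  have "(\<Sum>j<Suc d. x ^ j) * (x - 1) = (x ^ d - 1) + x ^ d * (x - 1)"
    by (simp only: sum.lessThan_Suc add_mult_distrib Suc)
  also have "\<dots> = x ^ Suc d - 1"
    using assms by (simp add: algebra_simps)
  finally show ?case .
qed simp

section \<open>The setting: \<open>f\<close> is the place \<open>v0\<close>\<close>

locale power_residue_character =
  fixes l :: nat and \<iota> :: "'a::finite_field \<Rightarrow> complex" and f :: "'a poly"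
  assumes prime_l: "prime l" and q_cong: "[CARD('a) = 1] (mod l)"
    and iota: "roots_of_unity_iso l \<iota>" and f: "monic_irreducible f"
    and odd_q: "odd CARD('a)"
begin

abbreviation "m \<equiv> degree f"

lemma q_gt_1: "CARD('a) > 1" by (rule card_finite_field_gt_1)

lemma l_ge_2: "l \<ge> 2" using prime_l by (rule prime_ge_2_nat)

lemma q_power_cong: "[CARD('a) ^ n = 1] (mod l)"
  using cong_pow[OF q_cong, of n] by simp

lemma l_dvd_q_power: "l dvd CARD('a) ^ n - 1"
  using q_power_cong[of n] q_gt_1 by (simp add: cong_altdef_nat)

lemma l_dvd_q: "l dvd CARD('a) - 1"
  using l_dvd_q_power[of 1] by simp

lemma m_pos: "m > 0" using f by (rule monic_irreducibleD)

lemma iota_mult: "x ^ l = 1 \<Longrightarrow> y ^ l = 1 \<Longrightarrow> \<iota> (x * y) = \<iota> x * \<iota> y"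
  using iota by (auto simp: roots_of_unity_iso_def)

lemma iota_root: "x ^ l = 1 \<Longrightarrow> \<iota> x ^ l = 1"
  using iota by (auto simp: roots_of_unity_iso_def bij_betw_def)

lemma iota_neq_0: "x ^ l = 1 \<Longrightarrow> \<iota> x \<noteq> 0"
  using iota_root[of x] l_ge_2 by (auto simp: zero_power)

lemma iota_norm: "x ^ l = 1 \<Longrightarrow> norm (\<iota> x) = 1"
  using iota_root[of x] l_ge_2 power_eq_1_iff by fastforce

lemma iota_1: "\<iota> 1 = 1"
  using iota_mult[of 1 1] iota_neq_0[of 1] by simp

lemma iota_power: "x ^ l = 1 \<Longrightarrow> \<iota> (x ^ k) = \<iota> x ^ k"
proof (induction k)
  case (Suc k)
  have "(x ^ k) ^ l = 1" using Suc.prems by (metis power_mult mult.commute power_one)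
  thus ?case using Suc by (simp add: iota_mult)
qed (simp add: iota_1)

lemma iota_eq_1_iff: "x ^ l = 1 \<Longrightarrow> \<iota> x = 1 \<longleftrightarrow> x = 1"
  using iota iota_1 unfolding roots_of_unity_iso_def bij_betw_def inj_on_def
  by (metis (mono_tags, lifting) mem_Collect_eq power_one)

subsection \<open>The power residue symbol and reciprocity\<close>

text \<open>Justifies the definite description in \<open>power_residue\<close>. By Fermat the value
  \<open>y\<close> satisfies \<open>y ^ l = 1\<close>; as \<open>l\<close> divides
  \<open>q - 1\<close>, also \<open>y ^ q = y\<close>, so \<open>y\<close> comes from a unique
  constant.\<close>

lemma power_residue:
  fixes P A :: "'a poly"
  assumes P: "monic_irreducible P" and x: "ev x P = 0" and A: "\<not> P dvd A"
  shows "to_ac (power_residue l A P) = ev x A ^ ((CARD('a) ^ degree P - 1) div l)"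
    and "power_residue l A P ^ l = 1"
proof -
  let ?K = "(CARD('a) ^ degree P - 1) div l"
  define y where "y = ev x A ^ ?K"
  have "ev x A \<noteq> 0" using A ev_eq_0_iff_dvd[OF P x] by simp
  have "y ^ l = ev x A ^ (?K * l)" by (simp add: y_def power_mult)
  also have "?K * l = CARD('a) ^ degree P - 1" by (rule dvd_div_mult_self) (rule l_dvd_q_power)
  also have "ev x A ^ \<dots> = 1" by (rule fermat_ev) fact+
  finally have yl: "y ^ l = 1" .
  from l_dvd_q obtain j where j: "CARD('a) - 1 = l * j" by (auto elim: dvdE)
  have "y ^ (CARD('a) - 1) = 1" unfolding j power_mult yl by simp
  hence "y ^ Suc (CARD('a) - 1) = y" by (simp only: power_Suc mult_1_right)
  moreover have "Suc (CARD('a) - 1) = CARD('a)" using q_gt_1 by simp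
  ultimately have "y ^ CARD('a) = y" by (simp only:)
  hence "y \<in> range to_ac" unfolding range_to_ac_eq by (rule CollectI)
  then obtain a where a: "y = to_ac a" by auto
  have "power_residue l A P = a"
    unfolding power_residue_def
  proof (rule the_equality)
    show "[A ^ ?K = [:a:]] (mod P)"
      using a by (simp add: y_def flip: ev_eq_iff_cong[OF P x])
    show "b = a" if "[A ^ ?K = [:b:]] (mod P)" for b
      using a that by (simp add: y_def flip: ev_eq_iff_cong[OF P x])
  qed
  thus "to_ac (power_residue l A P) = ev x A ^ ?K"
    using a by (simp add: y_def)
  have "to_ac (a ^ l) = to_ac 1" using a yl by simp
  hence "a ^ l = 1" by (simp only: to_ac_eq_iff)
  with \<open>power_residue l A P = a\<close> show "power_residue l A P ^ l = 1" by simp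
qed

text \<open>Raising to the sum of the \<open>q ^ j\<close> is the norm down to the base field, so
  the residue symbol is the norm raised to the power \<open>(q - 1) / l\<close>.\<close>

lemma q_power_geometric:
  "(CARD('a) ^ d - 1) div l = (\<Sum>j<d. CARD('a) ^ j) * ((CARD('a) - 1) div l)"
proof -
  have "CARD('a) ^ d - 1 = (\<Sum>j<d. CARD('a) ^ j) * (CARD('a) - 1)"
    using q_gt_1 by (simp only: nat_geometric_sum less_imp_le)
  thus ?thesis using l_dvd_q by (simp add: div_mult_swap)
qed

lemma ev_norm:
  fixes P :: "'a poly"
  assumes P: "monic_irreducible P" and x: "ev x P = 0"
  shows "ev y P = (\<Prod>j<degree P. y - x ^ (CARD('a) ^ j))"
  unfolding ev_def map_poly_to_ac_eq_prod[OF assms] by (simp add: poly_prod)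

text \<open>The sign of the reciprocity law per unit of \<open>degree P\<close>.\<close>

definition eps :: 'a where "eps = (- 1) ^ (m * ((CARD('a) - 1) div l))"

text \<open>Here \<open>q\<close> odd enters: \<open>q - 1\<close> is even.\<close>

lemma eps_root: "eps ^ l = 1"
proof -
  have "eps ^ l = (- 1) ^ (m * ((CARD('a) - 1) div l * l))"
    by (simp add: eps_def power_mult mult.assoc)
  also have "(CARD('a) - 1) div l * l = CARD('a) - 1" using l_dvd_q by simp
  also have "(- 1 :: 'a) ^ (m * (CARD('a) - 1)) = 1" using odd_q by simp
  finally show ?thesis .
qed

text \<open>Both norms, of \<open>ev y f\<close> and of \<open>ev x P\<close>, are the double
  product of the differences between conjugates of \<open>x\<close> and of \<open>y\<close>, i.e. a
  resultant. Exchanging the roles flips \<open>m * degree P\<close> signs, and raising to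
  \<open>(q - 1) / l\<close> turns these into \<open>eps ^ degree P\<close>.\<close>

lemma reciprocity:
  assumes P: "monic_irreducible P" and "P \<noteq> f"
  shows "power_residue l f P = eps ^ degree P * power_residue l P f" "\<not> P dvd f" "\<not> f dvd P"
proof -
  show nPf: "\<not> P dvd f" "\<not> f dvd P"
    using monic_dvd_monic_irreducible[of P f] monic_dvd_monic_irreducible[of f P]
      monic_irreducibleD(3,6)[OF P] monic_irreducibleD(3,6)[OF f] P f assms(2) by auto
  obtain x where x: "ev x f = 0" using exists_root_ev[of f] m_pos by auto
  obtain y where y: "ev y P = 0"
    using exists_root_ev[of P] monic_irreducibleD(5)[OF P] by auto
  let ?e = "(CARD('a) - 1) div l" and ?d = "degree P"
  define N where "N = (\<Prod>j<?d. \<Prod>i<m. y ^ (CARD('a) ^ j) - x ^ (CARD('a) ^ i))"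
  have "ev y f ^ (\<Sum>j<?d. CARD('a) ^ j) = (\<Prod>j<?d. ev y f ^ (CARD('a) ^ j))"
    by (simp add: power_sum)
  also have "\<dots> = N"
    unfolding ev_frobenius by (simp add: N_def ev_norm[OF f x])
  finally have 1: "ev y f ^ (\<Sum>j<?d. CARD('a) ^ j) = N" .
  have "ev x P ^ (\<Sum>i<m. CARD('a) ^ i) = (\<Prod>i<m. ev x P ^ (CARD('a) ^ i))"
    by (simp add: power_sum)
  also have "\<dots> = (\<Prod>i<m. \<Prod>j<?d. x ^ (CARD('a) ^ i) - y ^ (CARD('a) ^ j))"
    unfolding ev_frobenius by (simp add: ev_norm[OF P y])
  also have "\<dots> = (\<Prod>j<?d. \<Prod>i<m. (- 1) * (y ^ (CARD('a) ^ j) - x ^ (CARD('a) ^ i)))"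
    by (subst prod.swap) simp
  also have "\<dots> = (- 1) ^ (m * ?d) * N"
    unfolding N_def prod.distrib by (simp add: power_mult)
  finally have 2: "ev x P ^ (\<Sum>i<m. CARD('a) ^ i) = (- 1) ^ (m * ?d) * N" .
  have "(- 1) ^ (m * ?d) * ev x P ^ (\<Sum>i<m. CARD('a) ^ i) = N"
    unfolding 2 by (simp flip: power_mult_distrib mult.assoc)
  hence N: "N = (- 1) ^ (m * ?d) * ev x P ^ (\<Sum>i<m. CARD('a) ^ i)" ..
  have "to_ac (power_residue l f P) = N ^ ?e"
    using power_residue(1)[OF P y nPf(1)] by (simp only: q_power_geometric power_mult 1)
  also have "\<dots> = ((- 1) ^ (m * ?d)) ^ ?e * to_ac (power_residue l P f)"
    using power_residue(1)[OF f x nPf(2)]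
    by (simp only: q_power_geometric power_mult N power_mult_distrib)
  also have "((- 1) ^ (m * ?d)) ^ ?e = to_ac (eps ^ ?d)"
    by (simp add: eps_def flip: power_mult) (simp add: mult_ac)
  finally show "power_residue l f P = eps ^ degree P * power_residue l P f"
    unfolding to_ac_mult[symmetric] to_ac_eq_iff .
qed

subsection \<open>The character on polynomials\<close>

text \<open>The side of the reciprocity law that depends only on the class of \<open>A\<close>
  modulo \<open>f\<close> and on its degree. It is completely multiplicative on all polynomials, and
  agrees with \<open>chi\<close> at monic irreducibles.\<close>

definition xi :: "'a poly \<Rightarrow> complex" where
  "xi A = (if f dvd A then 0 else \<iota> (eps ^ degree A * power_residue l A f))"

definition root :: "'a alg_closure" where "root = (SOME x. ev x f = 0)"

lemma ev_root_f: "ev root f = 0"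
  unfolding root_def using exists_root_ev[OF m_pos] by (rule someI_ex)

lemma to_ac_residue:
  "\<not> f dvd A \<Longrightarrow> to_ac (power_residue l A f) = ev root A ^ ((CARD('a) ^ m - 1) div l)"
  by (rule power_residue(1)[OF f ev_root_f])

lemma residue_root: "\<not> f dvd A \<Longrightarrow> power_residue l A f ^ l = 1"
  by (rule power_residue(2)[OF f ev_root_f])

lemma f_dvd_mult_iff: "f dvd A * B \<longleftrightarrow> f dvd A \<or> f dvd B"
  by (rule prime_elem_dvd_mult_iff[OF monic_irreducibleD(2)[OF f]])

lemma residue_mult:
  assumes "\<not> f dvd A" "\<not> f dvd B"
  shows "power_residue l (A * B) f = power_residue l A f * power_residue l B f"
proof -
  have "to_ac (power_residue l (A * B) f) = to_ac (power_residue l A f * power_residue l B f)"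
    using assms by (simp add: to_ac_residue f_dvd_mult_iff power_mult_distrib)
  thus ?thesis by (simp only: to_ac_eq_iff)
qed

lemma residue_cong:
  assumes "[A = B] (mod f)"
  shows "power_residue l A f = power_residue l B f"
  unfolding power_residue_def using cong_pow[OF assms] cong_trans cong_sym by metis

lemma eps_power_root: "(eps ^ n) ^ l = 1"
  by (metis eps_root mult.commute power_mult power_one)

lemma xi_eq: "\<not> f dvd A \<Longrightarrow> xi A = \<iota> (eps ^ degree A) * \<iota> (power_residue l A f)"
  by (simp add: xi_def iota_mult eps_power_root residue_root)

lemma xi_0: "f dvd A \<Longrightarrow> xi A = 0"
  by (simp add: xi_def)

lemma xi_mult: "xi (A * B) = xi A * xi B"
proof (cases "f dvd A \<or> f dvd B")
  case True
  thus ?thesis by (auto simp: xi_0)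
next
  case False
  hence "A \<noteq> 0" "B \<noteq> 0" by auto
  thus ?thesis using False
    by (simp add: xi_eq f_dvd_mult_iff degree_mult_eq power_add residue_mult iota_mult
        eps_power_root residue_root)
qed

lemma residue_1: "power_residue l 1 f = 1"
proof -
  have "to_ac (power_residue l 1 f) = to_ac 1"
    using monic_irreducibleD(6)[OF f] by (simp add: to_ac_residue)
  thus ?thesis by simp
qed

lemma xi_1: "xi 1 = 1"
  using monic_irreducibleD(6)[OF f] by (simp add: xi_eq residue_1 iota_1)

lemma xi_norm_le: "norm (xi A) \<le> 1"
  by (cases "f dvd A") (simp_all add: xi_0 xi_eq norm_mult iota_norm eps_power_root residue_root)

lemma xi_eq_0_iff: "xi A = 0 \<longleftrightarrow> f dvd A"
  by (cases "f dvd A") (simp_all add: xi_0 xi_eq iota_neq_0 eps_power_root residue_root)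

lemma xi_cong: "[A = B] (mod f) \<Longrightarrow> degree A = degree B \<Longrightarrow> xi A = xi B"
  using residue_cong[of A B] cong_dvd_iff[of A B f] by (simp add: xi_def)

lemma chi_eq_xi:
  assumes "monic_irreducible P"
  shows "chi l \<iota> f (Fin P) = xi P"
proof (cases "P = f")
  case False
  thus ?thesis using reciprocity[OF assms False] by (simp add: xi_def)
qed (simp add: xi_0)

text \<open>Otherwise all \<open>q ^ m - 1\<close> nonzero residues modulo \<open>f\<close> would be
  roots of \<open>Y ^ k - 1\<close> with \<open>k = (q ^ m - 1) / l\<close>, which is too small
  since \<open>l \<ge> 2\<close>.\<close>

lemma exists_nonresidue: "\<exists>B. \<not> f dvd B \<and> power_residue l B f \<noteq> 1"
proof (rule ccontr)
  assume "\<not> ?thesis"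
  hence *: "\<And>B. \<not> f dvd B \<Longrightarrow> power_residue l B f = 1" by auto
  let ?K = "(CARD('a) ^ m - 1) div l"
  have q2: "CARD('a) ^ m \<ge> 2"
    using one_less_power[OF q_gt_1 m_pos] by linarith
  obtain k where k: "CARD('a) ^ m - 1 = l * k" using l_dvd_q_power[of m] by (auto elim: dvdE)
  have K: "?K = k" using k l_ge_2 by simp
  have "k > 0" using k q2 by (cases k) auto
  have "k * 2 \<le> k * l" using l_ge_2 by simp
  hence K_less: "k < CARD('a) ^ m - 1" using k \<open>k > 0\<close> by (simp add: mult.commute)
  define D :: "'a alg_closure poly" where "D = monom 1 k - 1"
  have "coeff D k = 1" using \<open>k > 0\<close> by (simp add: D_def)
  hence D0: "D \<noteq> 0" by auto
  have deg: "degree D \<le> k"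
    unfolding D_def by (intro degree_diff_le) (simp_all add: degree_monom_eq)
  have "range (ev root) - {0} \<subseteq> {y. poly D y = 0}"
  proof safe
    fix A :: "'a poly" assume "ev root A \<noteq> 0"
    hence "\<not> f dvd A" using ev_eq_0_iff_dvd[OF f ev_root_f] by simp
    from to_ac_residue[OF this, unfolded K *[OF this]] have "ev root A ^ k = 1" by simp
    thus "poly D (ev root A) = 0" by (simp add: D_def poly_monom)
  qed
  hence "card (range (ev root) - {0}) \<le> card {y. poly D y = 0}"
    by (intro card_mono poly_roots_finite D0)
  also have "\<dots> \<le> k" using card_poly_roots_bound[OF D0] deg by simp
  finally have "card (range (ev root) - {0}) \<le> k" .
  moreover have "0 \<in> range (ev root)" by (metis ev_0 rangeI)
  hence "card (range (ev root) - {0}) = CARD('a) ^ m - 1"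
    using card_range_ev[OF f ev_root_f] by simp
  ultimately show False using K_less by simp
qed

end

section \<open>Character sums over monic polynomials\<close>

definition monics :: "nat \<Rightarrow> 'a::finite_field poly set" where
  "monics n = {A. lead_coeff A = 1 \<and> degree A = n}"

lemma monics_eq: "monics n = (\<lambda>A. monom 1 n + A) ` polys_below n"
proof (intro equalityI subsetI)
  fix A :: "'a poly" assume A: "A \<in> monics n"
  have "A - monom 1 n \<in> polys_below n"
    using A by (auto simp: monics_def polys_below_def coeff_eq_0)
  thus "A \<in> (\<lambda>A. monom 1 n + A) ` polys_below n"
    by (rule rev_image_eqI) simp
next
  fix A :: "'a poly" assume "A \<in> (\<lambda>A. monom 1 n + A) ` polys_below n"
  then obtain B where B: "B \<in> polys_below n" "A = monom 1 n + B" by auto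
  have "coeff A n = 1" "\<And>i. i > n \<Longrightarrow> coeff A i = 0" using B by (auto simp: polys_below_def)
  hence "degree A = n" by (metis degree_le le_antisym le_degree zero_neq_one)
  with \<open>coeff A n = 1\<close> show "A \<in> monics n" by (simp add: monics_def)
qed

lemma finite_monics [simp]: "finite (monics n)"
  by (simp add: monics_eq)

lemma card_monics: "card (monics n :: 'a::finite_field poly set) = CARD('a) ^ n"
  unfolding monics_eq by (subst card_image) (auto simp: card_polys_below)

lemma monics_0: "monics 0 = {1}"
  by (simp add: monics_eq polys_below_0)

lemma monics_add_below: "A \<in> monics n \<Longrightarrow> k \<le> n \<Longrightarrow> B \<in> polys_below k \<Longrightarrow> A + B \<in> monics n"
  unfolding monics_eq using polys_below_add
  by (auto simp: add.assoc polys_below_def intro!: imageI)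

lemma monics_mult: "A \<in> monics i \<Longrightarrow> B \<in> monics j \<Longrightarrow> A * B \<in> monics (i + j)"
  by (auto simp: monics_def lead_coeff_mult degree_mult_eq)
     (metis degree_mult_eq leading_coeff_0_iff zero_neq_one)

context power_residue_character
begin

text \<open>Orthogonality: replacing the remainder of \<open>A\<close> modulo \<open>f\<close> by
  that of \<open>A * B\<close> permutes \<open>S\<close> and multiplies each term by the symbol of
  \<open>B\<close>, which is not 1. Only the remainder is changed, so conditions on the higher
  coefficients survive; this lets one argument serve both for monic polynomials and for full residue
  systems.\<close>

lemma twisted_sum_eq_0:
  assumes "finite S" and B: "\<not> f dvd B" "power_residue l B f \<noteq> 1"
    and closed: "\<And>A. A \<in> S \<Longrightarrow> A - A mod f + (A * B) mod f \<in> S"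
  shows "(\<Sum>A\<in>S. if f dvd A then 0 else \<iota> (power_residue l A f)) = 0"
proof -
  define g where "g A = (if f dvd A then 0 else \<iota> (power_residue l A f))" for A
  define \<phi> where "\<phi> A = A - A mod f + (A * B) mod f" for A
  have cong: "[\<phi> A = A * B] (mod f)" for A
    unfolding \<phi>_def by (simp add: cong_def mod_add_eq minus_mod_eq_div_mult mod_mult_self4)
  have inj: "inj_on \<phi> S"
  proof (rule inj_onI)
    fix A C assume "\<phi> A = \<phi> C"
    hence "[A * B = C * B] (mod f)" by (metis cong cong_sym cong_trans)
    hence AB: "(A * B) mod f = (C * B) mod f" by (simp add: cong_def)
    have "f dvd (A - C) * B" using \<open>[A * B = C * B] (mod f)\<close>
      by (simp add: cong_iff_dvd_diff left_diff_distrib)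
    hence "A mod f = C mod f" using B(1) by (simp add: f_dvd_mult_iff mod_eq_dvd_iff)
    with AB \<open>\<phi> A = \<phi> C\<close> show "A = C" by (simp add: \<phi>_def)
  qed
  have "\<phi> ` S = S" using inj closed \<open>finite S\<close> by (intro endo_inj_surj) (auto simp: \<phi>_def)
  hence "(\<Sum>A\<in>S. g A) = (\<Sum>A\<in>S. g (\<phi> A))" using sum.reindex[OF inj, of g] by simp
  also have "g (\<phi> A) = g A * \<iota> (power_residue l B f)" for A
    using residue_cong[OF cong[of A]] cong_dvd_iff[OF cong[of A]] B
    by (auto simp: g_def f_dvd_mult_iff residue_mult iota_mult residue_root)
  hence "(\<Sum>A\<in>S. g (\<phi> A)) = (\<Sum>A\<in>S. g A) * \<iota> (power_residue l B f)"
    by (simp add: sum_distrib_right)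
  finally have "(\<Sum>A\<in>S. g A) * (1 - \<iota> (power_residue l B f)) = 0"
    by (simp add: algebra_simps)
  moreover have "\<iota> (power_residue l B f) \<noteq> 1"
    using B by (simp add: iota_eq_1_iff residue_root)
  ultimately show ?thesis by (simp add: g_def)
qed

text \<open>For \<open>n \<ge> m\<close> a change of the remainder modulo \<open>f\<close> keeps a
  polynomial monic of degree \<open>n\<close>. This is why the \<open>L\<close>-series is a
  polynomial.\<close>

lemma sum_xi_monics_eq_0:
  assumes "n \<ge> m"
  shows "(\<Sum>A\<in>monics n. xi A) = 0"
proof -
  obtain B where B: "\<not> f dvd B" "power_residue l B f \<noteq> 1" using exists_nonresidue by auto
  have "(\<Sum>A\<in>monics n. if f dvd A then 0 else \<iota> (power_residue l A f)) = 0"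
  proof (rule twisted_sum_eq_0[OF _ B])
    fix A :: "'a poly" assume A: "A \<in> monics n"
    have "(A * B) mod f - A mod f \<in> polys_below m"
      using mod_in_polys_below[OF m_pos] by (intro polys_below_diff)
    from monics_add_below[OF A assms this]
    show "A - A mod f + (A * B) mod f \<in> monics n" by (simp add: algebra_simps)
  qed auto
  moreover have "(\<Sum>A\<in>monics n. xi A) =
     (\<Sum>A\<in>monics n. \<iota> (eps ^ n) * (if f dvd A then 0 else \<iota> (power_residue l A f)))"
    by (intro sum.cong) (auto simp: xi_eq xi_0 monics_def)
  ultimately show ?thesis by (simp flip: sum_distrib_left)
qed

text \<open>Since \<open>q\<close> is 1 modulo \<open>l\<close>, the sum of the \<open>q ^ j\<close>
  for \<open>j < m\<close> is congruent to \<open>m\<close>, hence divisible by \<open>l\<close>;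
  the exponent of the symbol is then a multiple of \<open>q - 1\<close>.\<close>

lemma residue_const:
  assumes "l dvd m" "c \<noteq> 0"
  shows "power_residue l [:c:] f = 1"
proof -
  have "\<not> f dvd [:c:]" using m_pos assms dvd_imp_degree_le[of f "[:c:]"] by auto
  from to_ac_residue[OF this]
  have *: "to_ac (power_residue l [:c:] f) = to_ac (c ^ ((CARD('a) ^ m - 1) div l))" by simp
  obtain k where k: "m = l * k" using assms by (auto elim: dvdE)
  have "[(\<Sum>j<m. CARD('a) ^ j) = (\<Sum>j<m. 1)] (mod l)"
    by (intro cong_sum q_power_cong)
  hence "l dvd (\<Sum>j<m. CARD('a) ^ j)" using assms(1) cong_dvd_iff by fastforce
  then obtain i where i: "(\<Sum>j<m. CARD('a) ^ j) = l * i" by (auto elim: dvdE)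
  have "(CARD('a) ^ m - 1) div l = (l * i) * ((CARD('a) - 1) div l)" by (simp only: q_power_geometric i)
  also have "\<dots> = i * (CARD('a) - 1)" using l_dvd_q by (simp add: mult_ac)
  finally have "c ^ ((CARD('a) ^ m - 1) div l) = (c ^ (CARD('a) - 1)) ^ i"
    by (simp only: mult.commute[of i] power_mult)
  also have "c * c ^ (CARD('a) - 1) = c ^ CARD('a)" using q_gt_1 by (simp flip: power_Suc)
  hence "c ^ (CARD('a) - 1) = 1" using assms by (simp add: finite_field_power_card_eq_same)
  finally show ?thesis using * by simp
qed

lemma eps_eq_1: "l dvd m \<Longrightarrow> eps = 1"
proof -
  assume "l dvd m"
  then obtain k where k: "m = l * k" by (auto elim: dvdE)
  have "m * ((CARD('a) - 1) div l) = k * (CARD('a) - 1)" using l_dvd_q by (simp add: k mult_ac)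
  thus ?thesis using odd_q by (simp add: eps_def)
qed

text \<open>If \<open>l\<close> divides \<open>m\<close>, the finite part of the
  \<open>L\<close>-function vanishes at \<open>u = 1\<close>, which cancels the pole of the Euler
  factor at infinity. Constants then have trivial character, so the sum is
  \<open>1 / (q - 1)\<close> times the sum over all nonzero residues modulo \<open>f\<close>, and
  that one is 0 by orthogonality.\<close>

lemma sum_xi_all_monics_eq_0:
  assumes "l dvd m"
  shows "(\<Sum>n<m. \<Sum>A\<in>monics n. xi A) = 0"
proof -
  obtain B where B: "\<not> f dvd B" "power_residue l B f \<noteq> 1" using exists_nonresidue by auto
  have xi: "xi A = (if f dvd A then 0 else \<iota> (power_residue l A f))" for A
    by (simp add: xi_def eps_eq_1 assms)
  have below: "(\<Sum>A\<in>polys_below m. xi A) = 0"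
    unfolding xi
  proof (rule twisted_sum_eq_0[OF _ B])
    fix A :: "'a poly" assume A: "A \<in> polys_below m"
    thus "A - A mod f + (A * B) mod f \<in> polys_below m"
      using mod_in_polys_below[OF m_pos] by (intro polys_below_add polys_below_diff) auto
  qed auto
  have smult: "xi (smult c A) = xi A" if "c \<noteq> 0" for c :: 'a and A
  proof -
    have "xi (smult c A) = xi ([:c:] * A)" by simp
    also have "\<dots> = xi [:c:] * xi A" by (rule xi_mult)
    also have "\<not> f dvd [:c:]" using m_pos that dvd_imp_degree_le[of f "[:c:]"] by auto
    hence "xi [:c:] = 1" using residue_const[OF assms that] by (simp add: xi_eq iota_1)
    finally show ?thesis by simp
  qed
  define S where "S = (\<Union>n<m. monics n :: 'a poly set)"
  have fin: "finite S" by (simp add: S_def)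
  have "bij_betw (\<lambda>(c, A). smult c A) ((- {0}) \<times> S) (polys_below m - {0})"
  proof (rule bij_betwI[where g = "\<lambda>A. (lead_coeff A, smult (inverse (lead_coeff A)) A)"])
    show "(\<lambda>(c, A). smult c A) \<in> (- {0}) \<times> S \<rightarrow> polys_below m - {0}"
      by (auto simp: S_def monics_def polys_below_iff)
    show "(\<lambda>A. (lead_coeff A, smult (inverse (lead_coeff A)) A)) \<in> polys_below m - {0} \<rightarrow> (- {0}) \<times> S"
      by (auto simp: S_def monics_def polys_below_iff)
  qed (auto simp: S_def monics_def)
  hence "(\<Sum>A\<in>polys_below m - {0}. xi A) = (\<Sum>(c, A)\<in>(- {0}) \<times> S. xi (smult c A))"
    by (subst sum.reindex_bij_betw[symmetric]) (auto simp: case_prod_unfold)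
  also have "\<dots> = (\<Sum>(c, A)\<in>(- {0 :: 'a}) \<times> S. xi A)"
    by (intro sum.cong) (auto intro: smult)
  also have "\<dots> = of_nat (card (- {0 :: 'a})) * (\<Sum>A\<in>S. xi A)"
    by (subst sum.cartesian_product[symmetric]) simp
  also have "(\<Sum>A\<in>S. xi A) = (\<Sum>n<m. \<Sum>A\<in>monics n. xi A)"
    unfolding S_def by (intro sum.UNION_disjoint) (simp, simp, auto simp: monics_def)
  finally have "of_nat (card (- {0 :: 'a})) * (\<Sum>n<m. \<Sum>A\<in>monics n. xi A) = (\<Sum>A\<in>polys_below m - {0}. xi A)" ..
  also have "\<dots> = (\<Sum>A\<in>polys_below m. xi A)"
    by (intro sum.mono_neutral_left) (auto simp: xi_0)
  finally show ?thesis
    using below q_gt_1 by (simp add: Compl_eq_Diff_UNIV)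
qed

end

subsection \<open>Factorisation into monic irreducibles\<close>

lemma prime_elem_power_dvd_cancel:
  fixes P R B :: "'b::{idom, algebraic_semidom}"
  assumes P: "prime_elem P" and R: "\<not> P dvd R" and dvd: "P ^ n dvd R * B"
  shows "P ^ n dvd B"
  using dvd
proof (induction n arbitrary: B)
  case (Suc n)
  have "P dvd R * B" using Suc.prems by (metis dvd_trans dvd_power_same dvd_triv_left power_Suc)
  hence "P dvd B" using prime_elem_dvd_mult_iff[OF P] R by blast
  then obtain C where C: "B = P * C" by (auto elim: dvdE)
  have "P * P ^ n dvd P * (R * C)" using Suc.prems by (simp add: C mult_ac)
  hence "P ^ n dvd R * C" using P by (simp add: prime_elem_def)
  from Suc.IH[OF this] show ?case by (simp add: C mult_dvd_mono)
qed auto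

text \<open>The exponent that occurs in \<open>char_poly_ext\<close>.\<close>

definition val :: "'a::finite_field poly \<Rightarrow> 'a poly \<Rightarrow> nat" where
  "val P A = Max {n. P ^ n dvd A}"

lemma power_dvd_degree_le:
  fixes P A :: "'a::finite_field poly"
  assumes "P ^ n dvd A" "A \<noteq> 0" "P \<noteq> 0"
  shows "n * degree P \<le> degree A"
  using dvd_imp_degree_le[OF assms(1,2)] assms(3) by (simp add: degree_power_eq)

lemma le_val_iff:
  assumes P: "monic_irreducible P" and A: "A \<noteq> 0"
  shows "n \<le> val P A \<longleftrightarrow> P ^ n dvd A"
proof -
  have P': "P \<noteq> 0" "degree P > 0" using monic_irreducibleD[OF P] by auto
  have "n \<le> degree A" if "P ^ n dvd A" for n
    using power_dvd_degree_le[OF that A P'(1)] P'(2)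
    by (metis Suc_leI le_trans mult.right_neutral mult_le_mono2 One_nat_def)
  hence fin: "finite {n. P ^ n dvd A}"
    by (intro finite_subset[OF _ finite_atMost[of "degree A"]]) auto
  have ne: "{n. P ^ n dvd A} \<noteq> {}" by (auto intro: exI[of _ 0])
  have "P ^ val P A dvd A" using Max_in[OF fin ne] by (simp add: val_def)
  thus ?thesis
    using Max_ge[OF fin] unfolding val_def
    by (metis dvd_trans le_imp_power_dvd mem_Collect_eq)
qed

lemma val_eqI:
  assumes "monic_irreducible P" "A \<noteq> 0" "\<And>n. P ^ n dvd A \<longleftrightarrow> n \<le> k"
  shows "val P A = k"
proof -
  have *: "n \<le> val P A \<longleftrightarrow> n \<le> k" for n
    using le_val_iff[OF assms(1,2), of n] assms(3)[of n] by simp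
  show ?thesis using *[of k] *[of "val P A"] by simp
qed

lemma val_pos_iff:
  assumes "monic_irreducible P" "A \<noteq> 0"
  shows "val P A > 0 \<longleftrightarrow> P dvd A"
  using le_val_iff[OF assms, of 1] by (simp add: Suc_le_eq)

lemma val_mult_same:
  assumes P: "monic_irreducible P" and A: "A \<noteq> 0"
  shows "val P (P * A) = Suc (val P A)"
proof (rule val_eqI[OF P])
  fix n show "P ^ n dvd P * A \<longleftrightarrow> n \<le> Suc (val P A)"
  proof (cases n)
    case (Suc k)
    have "P ^ n dvd P * A \<longleftrightarrow> P ^ k dvd A"
      using monic_irreducibleD(4)[OF P] by (simp add: Suc)
    thus ?thesis using le_val_iff[OF P A, of k] Suc by simp
  qed simp
qed (use A monic_irreducibleD[OF P] in auto)

lemma val_mult_other: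
  assumes P: "monic_irreducible P" and R: "monic_irreducible R" "R \<noteq> P" and A: "A \<noteq> 0"
  shows "val P (R * A) = val P A"
proof (rule val_eqI[OF P])
  have *: "\<not> P dvd R"
    using monic_dvd_monic_irreducible[of P R] monic_irreducibleD[OF P] R by auto
  fix n show "P ^ n dvd R * A \<longleftrightarrow> n \<le> val P A"
    unfolding le_val_iff[OF P A]
    using prime_elem_power_dvd_cancel[OF monic_irreducibleD(2)[OF P] *, of n A] dvd_mult[of "P ^ n" A R]
    by blast
qed (use A monic_irreducibleD[OF R(1)] in auto)

text \<open>A monic divisor of least positive degree is irreducible.\<close>

lemma exists_monic_irreducible_dvd:
  assumes "degree (A :: 'a::finite_field poly) > 0"
  shows "\<exists>P. monic_irreducible P \<and> P dvd A"
proof -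
  define S where "S = {B. lead_coeff B = 1 \<and> degree B > 0 \<and> B dvd A}"
  have norm: "\<exists>C. lead_coeff C = 1 \<and> degree C = degree B \<and> C dvd B" if "B \<noteq> 0" for B :: "'a poly"
    using that by (intro exI[of _ "smult (inverse (lead_coeff B)) B"]) (auto simp: smult_dvd_iff)
  have "A \<noteq> 0" using assms by auto
  with norm[of A] obtain B where "lead_coeff B = 1" "degree B = degree A" "B dvd A" by blast
  hence "B \<in> S" using assms by (simp add: S_def)
  then obtain P where P: "P \<in> S" "\<And>B. B \<in> S \<Longrightarrow> degree P \<le> degree B"
    using arg_min_nat_lemma[of "\<lambda>B. B \<in> S" B degree] by metis
  have P0: "P \<noteq> 0" using P by (auto simp: S_def)
  have "irreducible P"
  proof (rule irreducibleI)
    show "\<not> P dvd 1" using P P0 by (auto simp: S_def is_unit_iff_degree)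
    fix B C assume BC: "P = B * C"
    hence nz: "B \<noteq> 0" "C \<noteq> 0" using P0 by auto
    hence deg: "degree P = degree B + degree C" by (simp add: BC degree_mult_eq)
    have "degree B = 0 \<or> degree B \<ge> degree P"
    proof (cases "degree B = 0")
      case False
      from norm[OF nz(1)] obtain D where D: "lead_coeff D = 1" "degree D = degree B" "D dvd B" by auto
      have "D dvd A" using D P(1) BC unfolding S_def
        by (metis (mono_tags, lifting) dvd_trans dvd_triv_left mem_Collect_eq)
      hence "D \<in> S" using D False by (auto simp: S_def)
      with P(2)[OF this] D show ?thesis by simp
    qed simp
    thus "B dvd 1 \<or> C dvd 1" using deg nz by (auto simp: is_unit_iff_degree)
  qed (fact P0)
  thus ?thesis using P by (auto simp: S_def monic_irreducible_def)
qed

text \<open>Takes the place of unique factorisation: identities for valuations and multiplicative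
  functions are checked one prime factor at a time.\<close>

lemma monic_induct [consumes 1, case_names one mult]:
  assumes "lead_coeff (A :: 'a::finite_field poly) = 1" and "Q 1"
    and "\<And>P B. monic_irreducible P \<Longrightarrow> lead_coeff B = 1 \<Longrightarrow> Q B \<Longrightarrow> Q (P * B)"
  shows "Q A"
  using assms(1)
proof (induction "degree A" arbitrary: A rule: less_induct)
  case less
  show ?case
  proof (cases "degree A = 0")
    case True
    then obtain c where "A = [:c:]" by (auto elim: degree_eq_zeroE)
    with less.prems have "A = 1" by (simp add: one_pCons)
    thus ?thesis using assms by simp
  next
    case False
    then obtain P where P: "monic_irreducible P" "P dvd A" using exists_monic_irreducible_dvd[of A] by auto
    then obtain B where B: "A = P * B" by (auto elim: dvdE)
    have "B \<noteq> 0" using B less.prems by auto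
    hence "degree A = degree P + degree B"
      using B monic_irreducibleD[OF P(1)] by (simp add: degree_mult_eq)
    moreover have "lead_coeff B = 1"
      using less.prems monic_irreducibleD[OF P(1)] by (simp add: B lead_coeff_mult)
    ultimately show ?thesis
      using less.hyps[of B] P monic_irreducibleD(5)[OF P(1)] B assms(3) by simp
  qed
qed

lemma finite_monic_irreducible_degree_le [simp]: "finite {P. monic_irreducible P \<and> degree P \<le> n}"
proof (rule finite_subset)
  show "{P. monic_irreducible P \<and> degree P \<le> n} \<subseteq> (\<Union>i\<le>n. monics i)"
    by (auto simp: monics_def monic_irreducible_def)
qed simp

lemma finite_monic_irreducible_dvd [simp]:
  "A \<noteq> 0 \<Longrightarrow> finite {P. monic_irreducible P \<and> P dvd A}"
  by (rule finite_subset[OF _ finite_monic_irreducible_degree_le[of "degree A"]])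
     (auto intro: dvd_imp_degree_le)

lemma degree_eq_sum_val:
  assumes "lead_coeff (A :: 'a::finite_field poly) = 1"
  shows "(\<Sum>P | monic_irreducible P \<and> P dvd A. val P A * degree P) = degree A"
  using assms
proof (induction A rule: monic_induct)
  case one
  have "{P :: 'a poly. monic_irreducible P \<and> P dvd 1} = {}" using monic_irreducibleD(6) by auto
  thus ?case by (simp only: sum.empty degree_1)
next
  case (mult R B)
  let ?D = "{P. monic_irreducible P \<and> P dvd R * B}"
  have B0: "B \<noteq> 0" using mult by auto
  have R0: "R \<noteq> 0" using mult monic_irreducibleD(4) by auto
  have fin: "finite ?D" using B0 R0 by simp
  have R: "R \<in> ?D" using mult by auto
  have "(\<Sum>P\<in>?D. val P (R * B) * degree P) =
        (\<Sum>P\<in>?D. val P B * degree P + (if P = R then degree R else 0))"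
    using mult B0 by (intro sum.cong) (auto simp: val_mult_same val_mult_other)
  also have "\<dots> = (\<Sum>P\<in>?D. val P B * degree P) + degree R"
    using fin R by (simp add: sum.distrib)
  also have "(\<Sum>P\<in>?D. val P B * degree P) = (\<Sum>P | monic_irreducible P \<and> P dvd B. val P B * degree P)"
    using fin B0 val_pos_iff by (intro sum.mono_neutral_right) auto
  also have "\<dots> = degree B" by (rule mult.IH)
  finally show ?case using B0 R0 by (simp add: degree_mult_eq)
qed

subsection \<open>Prime sums\<close>

text \<open>The irreducibles whose roots lie in the field with \<open>q ^ n\<close>
  elements.\<close>

definition irr_dvd :: "nat \<Rightarrow> 'a::finite_field poly set" where
  "irr_dvd n = {P. monic_irreducible P \<and> degree P dvd n}"

definition monic_sum :: "('a::finite_field poly \<Rightarrow> complex) \<Rightarrow> nat \<Rightarrow> complex" where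
  "monic_sum \<psi> n = (\<Sum>A\<in>monics n. \<psi> A)"

text \<open>The sum of the von Mangoldt function times \<open>\<psi>\<close> over the monic
  polynomials of degree \<open>n\<close>, for completely multiplicative \<open>\<psi>\<close>; in
  other words, the coefficient of \<open>u ^ n\<close> in \<open>u L' / L\<close>.\<close>

definition prime_sum :: "('a::finite_field poly \<Rightarrow> complex) \<Rightarrow> nat \<Rightarrow> complex" where
  "prime_sum \<psi> n = (\<Sum>P\<in>irr_dvd n. of_nat (degree P) * \<psi> P ^ (n div degree P))"

lemma finite_irr_dvd [simp]: "n > 0 \<Longrightarrow> finite (irr_dvd n)"
  by (rule finite_subset[OF _ finite_monic_irreducible_degree_le[of n]])
     (auto simp: irr_dvd_def dest: dvd_imp_le)

text \<open>The degree of \<open>A\<close> is the sum of \<open>degree P\<close> over all prime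
  powers \<open>P ^ k\<close> dividing \<open>A\<close>. Weighting by \<open>\<psi>\<close>, summing
  over the monic \<open>A\<close> of degree \<open>n\<close> and grouping the prime powers by their
  degree \<open>k * degree P\<close> gives the coefficient form of
  \<open>u L' = L * (u L' / L)\<close>.\<close>

lemma von_mangoldt_identity:
  fixes \<psi> :: "'a::finite_field poly \<Rightarrow> complex"
  assumes one: "\<psi> 1 = 1" and mult: "\<And>A B. \<psi> (A * B) = \<psi> A * \<psi> B"
  shows "of_nat n * monic_sum \<psi> n = (\<Sum>k=1..n. prime_sum \<psi> k * monic_sum \<psi> (n - k))"
proof -
  have pow: "\<psi> (A ^ k) = \<psi> A ^ k" for A k by (induction k) (auto simp: one mult)
  define T where "T = {(P :: 'a poly, k). monic_irreducible P \<and> k \<ge> 1 \<and> k * degree P \<le> n}"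
  have "T \<subseteq> {P. monic_irreducible P \<and> degree P \<le> n} \<times> {..n}"
  proof safe
    fix P :: "'a poly" and k assume *: "(P, k) \<in> T"
    hence "degree P \<ge> 1" "k \<ge> 1" "k * degree P \<le> n" "monic_irreducible P"
      using monic_irreducibleD(5)[of P] by (auto simp: T_def Suc_le_eq)
    moreover from this have "degree P \<le> n" "k \<le> n"
      using mult_le_mono1[of 1 k "degree P"] mult_le_mono2[of 1 "degree P" k] by linarith+
    ultimately show "monic_irreducible P" "degree P \<le> n" "k \<le> n" by auto
  qed
  hence finT: "finite T" by (rule finite_subset) simp
  have deg: "of_nat n = (\<Sum>(P, k)\<in>T. if P ^ k dvd A then of_nat (degree P) else (0 :: complex))"
    if A: "A \<in> monics n" for A
  proof -
    have A': "lead_coeff A = 1" "degree A = n" "A \<noteq> 0" using A by (auto simp: monics_def)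
    have "of_nat n = (\<Sum>P | monic_irreducible P \<and> P dvd A. \<Sum>k\<in>{1..val P A}. of_nat (degree P) :: complex)"
      using degree_eq_sum_val[OF A'(1)] A' by (simp flip: of_nat_mult of_nat_sum)
    also have "\<dots> = (\<Sum>(P, k)\<in>(SIGMA P:{P. monic_irreducible P \<and> P dvd A}. {1..val P A}). of_nat (degree P))"
      using A' by (subst sum.Sigma) auto
    also have "(SIGMA P:{P. monic_irreducible P \<and> P dvd A}. {1..val P A}) = {x\<in>T. fst x ^ snd x dvd A}"
    proof -
      have *: "monic_irreducible P \<and> P dvd A \<and> 1 \<le> k \<and> k \<le> val P A \<longleftrightarrow>
            monic_irreducible P \<and> 1 \<le> k \<and> k * degree P \<le> n \<and> P ^ k dvd A" for P k
      proof (cases "monic_irreducible P")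
        case True
        have "P dvd A \<and> k * degree P \<le> n" if "P ^ k dvd A" "k \<ge> 1"
        proof
          show "P dvd A" using that by (metis dvd_power dvd_trans One_nat_def Suc_le_lessD)
          show "k * degree P \<le> n"
            using power_dvd_degree_le[OF that(1)] A' monic_irreducibleD[OF True] by simp
        qed
        thus ?thesis using le_val_iff[OF True A'(3)] by blast
      qed auto
      show ?thesis
      proof (rule Set.set_eqI)
        fix x :: "'a poly \<times> nat"
        show "x \<in> (SIGMA P:{P. monic_irreducible P \<and> P dvd A}. {1..val P A}) \<longleftrightarrow>
              x \<in> {x\<in>T. fst x ^ snd x dvd A}"
          using *[of "fst x" "snd x"] by (cases x) (simp add: T_def)
      qed
    qed
    also have "(\<Sum>(P, k)\<in>{x\<in>T. fst x ^ snd x dvd A}. of_nat (degree P)) =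
               (\<Sum>(P, k)\<in>T. if P ^ k dvd A then of_nat (degree P) else (0 :: complex))"
      using finT by (subst sum.inter_filter) (auto intro!: sum.cong)
    finally show ?thesis .
  qed
  have inner: "(\<Sum>A\<in>monics n. if P ^ k dvd A then \<psi> A else 0) = \<psi> P ^ k * monic_sum \<psi> (n - k * degree P)"
    if "(P, k) \<in> T" for P k
  proof -
    have P: "monic_irreducible P" and le: "k * degree P \<le> n" using that by (auto simp: T_def)
    have Pk: "P ^ k \<in> monics (k * degree P)" "P ^ k \<noteq> 0"
      using monic_irreducibleD[OF P] lead_coeff_power[of P k] by (auto simp: monics_def lead_coeff_power degree_power_eq)
    have lead: "lead_coeff (P ^ k) = 1" using monic_irreducibleD(3)[OF P] by (simp only: lead_coeff_power power_one)
    have "(\<Sum>A\<in>monics n. if P ^ k dvd A then \<psi> A else 0) = (\<Sum>A | A \<in> monics n \<and> P ^ k dvd A. \<psi> A)"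
      by (rule sum.inter_filter[symmetric]) simp
    also have "{A. A \<in> monics n \<and> P ^ k dvd A} = (\<lambda>B. P ^ k * B) ` monics (n - k * degree P)"
    proof (intro equalityI subsetI)
      fix A assume A: "A \<in> {A. A \<in> monics n \<and> P ^ k dvd A}"
      then obtain B where B: "A = P ^ k * B" by (auto elim: dvdE)
      have "B \<noteq> 0" using A B by (auto simp: monics_def)
      hence "degree A = k * degree P + degree B" using B Pk by (simp add: degree_mult_eq monics_def)
      moreover have "lead_coeff A = lead_coeff (P ^ k) * lead_coeff B" by (simp only: B lead_coeff_mult)
      hence "lead_coeff A = lead_coeff B" unfolding lead by simp
      ultimately have "B \<in> monics (n - k * degree P)" using A by (auto simp: monics_def)
      thus "A \<in> (\<lambda>B. P ^ k * B) ` monics (n - k * degree P)" using B by auto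
    next
      fix A assume "A \<in> (\<lambda>B. P ^ k * B) ` monics (n - k * degree P)"
      thus "A \<in> {A. A \<in> monics n \<and> P ^ k dvd A}" using monics_mult[OF Pk(1)] le by force
    qed
    also have "(\<Sum>A\<in>\<dots>. \<psi> A) = (\<Sum>B\<in>monics (n - k * degree P). \<psi> (P ^ k * B))"
      using Pk(2) by (subst sum.reindex) (auto simp: inj_on_def)
    also have "\<dots> = \<psi> P ^ k * monic_sum \<psi> (n - k * degree P)"
      by (simp add: mult pow monic_sum_def sum_distrib_left)
    finally show ?thesis .
  qed
  have "of_nat n * monic_sum \<psi> n =
        (\<Sum>A\<in>monics n. \<Sum>(P, k)\<in>T. of_nat (degree P) * (if P ^ k dvd A then \<psi> A else 0))"
    unfolding monic_sum_def sum_distrib_left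
    by (intro sum.cong refl, subst deg) (auto simp: sum_distrib_right case_prod_unfold intro!: sum.cong)
  also have "\<dots> = (\<Sum>(P, k)\<in>T. of_nat (degree P) * (\<Sum>A\<in>monics n. if P ^ k dvd A then \<psi> A else 0))"
    by (subst sum.swap) (simp add: sum_distrib_left case_prod_unfold)
  also have "\<dots> = (\<Sum>(P, k)\<in>T. of_nat (degree P) * (\<psi> P ^ k * monic_sum \<psi> (n - k * degree P)))"
    by (intro sum.cong refl) (auto simp: inner)
  also have "\<dots> = (\<Sum>(j, P)\<in>(SIGMA j:{1..n}. irr_dvd j).
      of_nat (degree P) * (\<psi> P ^ (j div degree P) * monic_sum \<psi> (n - j)))"
  proof (rule sum.reindex_bij_witness[of _ "\<lambda>(j, P). (P, j div degree P)" "\<lambda>(P, k). (k * degree P, P)"])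
    fix x assume x: "x \<in> T"
    obtain P k where Pk: "x = (P, k)" by (cases x)
    have "degree P > 0" using x monic_irreducibleD(5)[of P] by (auto simp: T_def Pk)
    thus "(case case x of (P, k) \<Rightarrow> (k * degree P, P) of (j, P) \<Rightarrow> (P, j div degree P)) = x"
      "(case x of (P, k) \<Rightarrow> (k * degree P, P)) \<in> (SIGMA j:{1..n}. irr_dvd j)"
      "(case case x of (P, k) \<Rightarrow> (k * degree P, P) of (j, P) \<Rightarrow>
         of_nat (degree P) * (\<psi> P ^ (j div degree P) * monic_sum \<psi> (n - j))) =
       (case x of (P, k) \<Rightarrow> of_nat (degree P) * (\<psi> P ^ k * monic_sum \<psi> (n - k * degree P)))"
      using x by (auto simp: Pk T_def irr_dvd_def Suc_le_eq)
  next
    fix x :: "nat \<times> 'a poly" assume x: "x \<in> (SIGMA j:{1..n}. irr_dvd j)"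
    obtain j P where Pk: "x = (j, P :: 'a poly)" by (cases x)
    have P: "monic_irreducible P" "degree P dvd j" "1 \<le> j" "j \<le> n"
      using x by (auto simp: Pk irr_dvd_def)
    have "degree P > 0" using monic_irreducibleD(5)[OF P(1)] .
    hence "j div degree P \<ge> 1" using P dvd_imp_le[of "degree P" j] by (simp add: Suc_le_eq div_greater_zero_iff)
    with P show "(case case x of (j, P) \<Rightarrow> (P, j div degree P) of (P, k) \<Rightarrow> (k * degree P, P)) = x"
      "(case x of (j, P) \<Rightarrow> (P, j div degree P)) \<in> T"
      by (auto simp: Pk T_def)
  qed
  also have "\<dots> = (\<Sum>j=1..n. \<Sum>P\<in>irr_dvd j. of_nat (degree P) * (\<psi> P ^ (j div degree P) * monic_sum \<psi> (n - j)))"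
    by (subst sum.Sigma) auto
  also have "\<dots> = (\<Sum>k=1..n. prime_sum \<psi> k * monic_sum \<psi> (n - k))"
    by (simp add: prime_sum_def sum_distrib_right mult.assoc)
  finally show ?thesis .
qed

text \<open>For the constant function 1 the identity is a recursion in which each index
  \<open>k < n\<close> contributes \<open>q ^ k * q ^ (n - k)\<close>; of the total
  \<open>n * q ^ n\<close> exactly one \<open>q ^ n\<close> is left for the index
  \<open>n\<close>.\<close>

lemma sum_degree_irr_dvd:
  assumes "n > 0"
  shows "(\<Sum>P\<in>irr_dvd n. degree (P :: 'a::finite_field poly)) = CARD('a) ^ n"
proof -
  define \<psi> where "\<psi> = (\<lambda>_ :: 'a poly. 1 :: complex)"
  have m: "monic_sum \<psi> n = of_nat (CARD('a) ^ n)" for n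
    by (simp add: monic_sum_def \<psi>_def card_monics)
  have "n > 0 \<Longrightarrow> prime_sum \<psi> n = of_nat (CARD('a) ^ n)"
  proof (induction n rule: less_induct)
    case (less n)
    have "of_nat n * monic_sum \<psi> n = (\<Sum>k=1..n. prime_sum \<psi> k * monic_sum \<psi> (n - k))"
      by (rule von_mangoldt_identity) (auto simp: \<psi>_def)
    also have "{1..n} = insert n {1..<n}" using less.prems by auto
    also have "(\<Sum>k\<in>\<dots>. prime_sum \<psi> k * monic_sum \<psi> (n - k)) =
        prime_sum \<psi> n + (\<Sum>k=1..<n. prime_sum \<psi> k * monic_sum \<psi> (n - k))"
      by (simp add: m)
    also have "(\<Sum>k=1..<n. prime_sum \<psi> k * monic_sum \<psi> (n - k)) = (\<Sum>k=1..<n. of_nat (CARD('a) ^ n))"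
      by (intro sum.cong) (auto simp: less.IH m simp flip: of_nat_mult power_add)
    also have "\<dots> = (of_nat n - 1) * of_nat (CARD('a) ^ n)"
      using less.prems by (simp add: of_nat_diff)
    finally show ?case by (simp add: m algebra_simps)
  qed
  from this[OF assms] show ?thesis
    unfolding prime_sum_def \<psi>_def by (simp flip: of_nat_sum of_nat_power)
qed

subsection \<open>Counting places with a prescribed residue symbol\<close>

text \<open>The ring homomorphism from polynomials in \<open>Y\<close> over \<open>F_q[X]\<close> to
  \<open>F_q[X]\<close> that applies the \<open>k\<close>-th iterate of Frobenius to the
  coefficients and sends \<open>Y\<close> to \<open>X\<close>. Stepanov's auxiliary polynomials are
  built from such values.\<close>

definition twist :: "nat \<Rightarrow> 'a::finite_field poly poly \<Rightarrow> 'a poly" where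
  "twist k C = poly (map_poly (\<lambda>c. c ^ (CARD('a) ^ k)) C) [:0, 1:]"

lemma twist_0 [simp]: "twist k 0 = 0"
  by (simp add: twist_def)

lemma twist_pCons [simp]:
  "twist k (pCons c C) = c ^ (CARD('a) ^ k) + [:0, 1:] * twist k C"
  for c :: "'a::finite_field poly"
  unfolding twist_def by (subst map_poly_pCons) (auto simp: zero_power)

lemma twist_add: "twist k (C + D) = twist k C + twist k D"
  for C :: "'a::finite_field poly poly"
proof (induction C arbitrary: D)
  case (pCons c C)
  obtain d D' where D: "D = pCons d D'" by (cases D)
  show ?case
    unfolding D add_pCons twist_pCons pCons.IH frobenius_add[where 'a = 'a, OF semiring_char_poly]
    by (simp add: algebra_simps)
qed auto

lemma twist_smult: "twist k (smult c C) = c ^ (CARD('a) ^ k) * twist k C"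
  for c :: "'a::finite_field poly"
  by (induction C) (auto simp: power_mult_distrib algebra_simps)

lemma twist_mult: "twist k (C * D) = twist k C * twist k D"
  for C :: "'a::finite_field poly poly"
proof (induction C)
  case (pCons c C)
  have "twist k (pCons c C * D) = twist k (smult c D + pCons 0 (C * D))" by simp
  also have "\<dots> = twist k (pCons c C) * twist k D"
    by (simp only: twist_add twist_smult twist_pCons pCons.IH)
       (simp add: zero_power algebra_simps)
  finally show ?case .
qed auto

lemma twist_sum: "twist k (\<Sum>i\<in>S. g i) = (\<Sum>i\<in>S. twist k (g i))"
  by (induction S rule: infinite_finite_induct) (auto simp: twist_add)

lemma twist_monom: "twist k (monom c n) = c ^ (CARD('a) ^ k) * [:0, 1:] ^ n"
  for c :: "'a::finite_field poly"
  by (induction n) (auto simp: monom_Suc monom_0 zero_power algebra_simps)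

section \<open>Independence of Frobenius twists modulo powers of \<open>f\<close>\<close>

context power_residue_character
begin

text \<open>The polynomial has derivative 1, whereas the derivative of a multiple of
  \<open>f ^ 2\<close> is divisible by \<open>f\<close>.\<close>

lemma f_power2_not_dvd:
  assumes "N > 0"
  shows "\<not> f ^ 2 dvd [:0, 1:] - monom 1 (CARD('a) ^ N)"
proof
  assume "f ^ 2 dvd [:0, 1:] - monom 1 (CARD('a) ^ N)"
  then obtain h where h: "[:0, 1:] - monom 1 (CARD('a) ^ N) = f ^ 2 * h" by (auto elim: dvdE)
  have "of_nat (CARD('a) choose 1) = (0 :: 'a)"
    by (rule of_nat_card_choose_eq_0) (use q_gt_1 in auto)
  hence "of_nat CARD('a) = (0 :: 'a)" by simp
  hence "of_nat (CARD('a) ^ N) = (0 :: 'a)" using assms by (simp add: zero_power)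
  hence "pderiv (monom 1 (CARD('a) ^ N)) = (0 :: 'a poly)"
    unfolding pderiv_monom by simp
  hence "pderiv (f ^ 2 * h) = 1"
    by (simp add: pderiv_diff pderiv_pCons one_pCons flip: h)
  moreover have "pderiv (f ^ 2 * h) = f * (f * pderiv h + 2 * h * pderiv f)"
    by (simp add: pderiv_mult power2_eq_square algebra_simps)
  ultimately have "f dvd 1" by (metis dvd_triv_left)
  thus False using monic_irreducibleD(6)[OF f] by simp
qed

lemma prime_f: "prime_elem f" by (rule monic_irreducibleD(2)[OF f])

text \<open>The powers \<open>X ^ a\<close>, \<open>a < K\<close>, are independent modulo \<open>f ^ K\<close> over the image of
  Frobenius: \<open>X\<close> differs from a Frobenius power \<open>V ^ (q ^ k)\<close> by an element of \<open>f\<close>-adic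
  valuation exactly one, so a relation can be expanded in powers of that difference.\<close>

lemma f_power_dvd_twist:
  assumes "k > 0" "K \<le> CARD('a) ^ k" "f ^ K dvd twist k C" "degree C < K"
  shows "[:f:] dvd C"
  using assms(2-)
proof (induction K arbitrary: C)
  case (Suc K)
  \<comment> \<open>The exponent is chosen so that \<open>V ^ (q ^ k)\<close> is
    \<open>X ^ (q ^ (m * k))\<close>, which is congruent to \<open>X\<close> modulo \<open>f\<close>
    because \<open>m\<close> divides \<open>m * k\<close>. The twist of the linear factor
    \<open>Y - V\<close> is then \<open>D\<close>, divisible by \<open>f\<close> exactly
    once.\<close>
  define V :: "'a poly" where "V = monom 1 (CARD('a) ^ (m * k - k))"
  have mk: "m * k = (m * k - k) + k" using m_pos by simp
  have V: "V ^ (CARD('a) ^ k) = monom 1 (CARD('a) ^ (m * k))"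
    by (subst mk, simp only: V_def monom_power power_add) simp
  define C1 where "C1 = synthetic_div C V"
  define \<rho> where "\<rho> = poly C V"
  define D where "D = [:0, 1:] - V ^ (CARD('a) ^ k)"
  have C: "C = [:- V, 1:] * C1 + [:\<rho>:]"
    unfolding C1_def \<rho>_def by (rule synthetic_div_correct'[symmetric])
  have "twist k [:- V, 1:] = D"
    using frobenius_diff[where 'a = 'a, OF semiring_char_poly, of 0 V k]
    by (simp add: D_def zero_power)
  hence tw: "twist k C = D * twist k C1 + \<rho> ^ (CARD('a) ^ k)"
    by (subst C) (simp only: twist_add twist_mult twist_pCons twist_0 mult_zero_right add_0_right)
  have fD: "f dvd D"
  proof -
    have "f dvd - (monom 1 (CARD('a) ^ (m * k)) - monom 1 1)"
      by (subst dvd_minus_iff) (rule dvd_monom_card_minus_X[OF f], simp)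
    thus ?thesis by (simp add: D_def V monom_Suc monom_0)
  qed
  have nfD: "\<not> f ^ 2 dvd D"
    unfolding D_def V by (rule f_power2_not_dvd) (use m_pos assms(1) in simp)
  have "f dvd twist k C" using Suc.prems(2) by (metis dvd_trans dvd_triv_left power_Suc)
  hence "f dvd \<rho> ^ (CARD('a) ^ k)" using fD by (simp add: tw dvd_add_right_iff)
  hence f\<rho>: "f dvd \<rho>" using prime_f prime_elem_dvd_power by blast
  \<comment> \<open>Frobenius amplifies \<open>f dvd \<rho>\<close> to divisibility by
    \<open>f ^ (q ^ k)\<close>, so the remainder term drops out modulo \<open>f ^ Suc K\<close>.
    Cancelling the single factor \<open>f\<close> of \<open>D\<close> leaves the same problem for
    the quotient, with \<open>K\<close> and the degree both lowered by one.\<close>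
  have "f ^ Suc K dvd f ^ (CARD('a) ^ k)" using Suc.prems(1) by (rule le_imp_power_dvd)
  also have "\<dots> dvd \<rho> ^ (CARD('a) ^ k)" using f\<rho> by (rule dvd_power_same)
  finally have "f ^ Suc K dvd D * twist k C1"
    using Suc.prems(2) by (simp add: tw dvd_add_left_iff)
  moreover obtain g where g: "D = f * g" using fD by (auto elim: dvdE)
  moreover have "\<not> f dvd g"
    using nfD g by (auto simp: power2_eq_square)
  ultimately have "f ^ K dvd twist k C1"
    using prime_elem_power_dvd_cancel[OF prime_f, of g K "twist k C1"] prime_elem_not_zeroI[OF prime_f]
    by (simp add: mult.assoc)
  have "[:f:] dvd C1"
  proof (cases "degree C = 0")
    case True
    hence "C1 = 0" unfolding C1_def by (simp only: synthetic_div_eq_0_iff)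
    thus ?thesis by simp
  next
    case False
    show ?thesis
      by (rule Suc.IH) (use Suc.prems False \<open>f ^ K dvd twist k C1\<close> in \<open>auto simp: C1_def degree_synthetic_div\<close>)
  qed
  thus ?case
    by (subst C) (intro dvd_add dvd_mult, auto simp: f\<rho>)
qed auto

text \<open>Modulo \<open>f ^ (\<kappa> * Suc i)\<close> only the \<open>i\<close>-th term survives:
  later ones carry a large explicit power of \<open>f\<close>, and earlier ones are divisible by
  \<open>f ^ (q ^ k)\<close> since by induction their \<open>C j\<close> is divisible by
  \<open>f\<close>.\<close>

lemma twist_independent_step:
  assumes k: "k > 0" and le: "l * \<kappa> \<le> CARD('a) ^ k"
    and deg: "\<And>i. i < l \<Longrightarrow> degree (C i) < \<kappa>"
    and sum: "(\<Sum>i<l. f ^ (\<kappa> * i) * twist k (C i)) = 0" and "i < l"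
  shows "[:f:] dvd C i"
  using \<open>i < l\<close>
proof (induction i rule: less_induct)
  case (less i)
  have Si: "\<kappa> * Suc i \<le> CARD('a) ^ k"
  proof -
    have "\<kappa> * Suc i \<le> \<kappa> * l" using less.prems by (intro mult_le_mono2) simp
    thus ?thesis using le by (simp add: mult.commute)
  qed
  have other: "f ^ (\<kappa> * Suc i) dvd f ^ (\<kappa> * j) * twist k (C j)" if j: "j < l" "j \<noteq> i" for j
  proof (cases "j < i")
    case True
    have "[:f:] dvd C j" using less.IH[OF True] j by simp
    then obtain D where "C j = smult f D" by (auto elim: dvdE)
    hence "f ^ (CARD('a) ^ k) dvd twist k (C j)" by (simp add: twist_smult)
    thus ?thesis using le_imp_power_dvd[OF Si, of f] by (meson dvd_mult dvd_trans)
  next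
    case False
    hence "\<kappa> * Suc i \<le> \<kappa> * j" using j by (intro mult_le_mono2) simp
    thus ?thesis using le_imp_power_dvd by (intro dvd_mult2) blast
  qed
  have "(\<Sum>j<l. f ^ (\<kappa> * j) * twist k (C j)) =
        f ^ (\<kappa> * i) * twist k (C i) + (\<Sum>j\<in>{..<l} - {i}. f ^ (\<kappa> * j) * twist k (C j))"
    using less.prems by (intro sum.remove) auto
  hence "f ^ (\<kappa> * i) * twist k (C i) = - (\<Sum>j\<in>{..<l} - {i}. f ^ (\<kappa> * j) * twist k (C j))"
    using sum by (simp add: eq_neg_iff_add_eq_0)
  also have "f ^ (\<kappa> * Suc i) dvd \<dots>"
    unfolding dvd_minus_iff by (intro dvd_sum other) auto
  finally have "f ^ (\<kappa> * i) * f ^ \<kappa> dvd f ^ (\<kappa> * i) * twist k (C i)"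
    by (simp add: power_add mult.commute)
  hence "f ^ \<kappa> dvd twist k (C i)" using prime_elem_not_zeroI[OF prime_f] by simp
  moreover have "\<kappa> \<le> CARD('a) ^ k" using Si by (simp add: le_trans[OF le_add1])
  ultimately show ?case using deg[OF less.prems] k by (intro f_power_dvd_twist[of k \<kappa>])
qed

text \<open>Infinite descent: dividing every \<open>C i\<close> by \<open>f\<close> takes a factor
  \<open>f ^ (q ^ k)\<close> out of the relation and leaves one of the same shape. The coefficients
  are thus divisible by all powers of \<open>f\<close>.\<close>

lemma twist_independent:
  assumes k: "k > 0" and le: "l * \<kappa> \<le> CARD('a) ^ k"
    and deg: "\<And>i. i < l \<Longrightarrow> degree (C i) < \<kappa>"
    and sum: "(\<Sum>i<l. f ^ (\<kappa> * i) * twist k (C i)) = 0" and i: "i < l"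
  shows "C i = 0"
proof -
  have f0: "f \<noteq> 0" using prime_elem_not_zeroI[OF prime_f] .
  have *: "[:f ^ e:] dvd C i" if "\<And>i. i < l \<Longrightarrow> degree (C i) < \<kappa>"
     "(\<Sum>i<l. f ^ (\<kappa> * i) * twist k (C i)) = 0" "i < l" for e C i
    using that
  proof (induction e arbitrary: C i)
    case (Suc e)
    have "\<exists>D. C j = smult f D" if "j < l" for j
    proof -
      from twist_independent_step[OF k le Suc.prems(1,2) that] obtain D where "C j = [:f:] * D"
        by (auto elim: dvdE)
      thus ?thesis by (intro exI[of _ D]) simp
    qed
    then obtain D where D: "\<And>j. j < l \<Longrightarrow> C j = smult f (D j)" by metis
    have "f ^ (CARD('a) ^ k) * (\<Sum>i<l. f ^ (\<kappa> * i) * twist k (D i)) = (\<Sum>i<l. f ^ (\<kappa> * i) * twist k (C i))"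
      by (simp add: D twist_smult sum_distrib_left mult_ac)
    hence "(\<Sum>i<l. f ^ (\<kappa> * i) * twist k (D i)) = 0" using Suc.prems(2) f0 by simp
    moreover have "degree (D j) < \<kappa>" if "j < l" for j using Suc.prems(1)[OF that] D[OF that] f0 by simp
    ultimately have "[:f ^ e:] dvd D i" using Suc.prems(3) by (intro Suc.IH)
    then obtain D' where "D i = [:f ^ e:] * D'" by (auto elim: dvdE)
    hence "C i = [:f ^ Suc e:] * D'" using D[OF Suc.prems(3)] by (simp add: mult_ac)
    thus ?case by (metis dvd_triv_left)
  qed (simp add: pCons_one)
  show ?thesis
  proof (rule poly_eqI)
    fix j
    have dvd: "f ^ Suc (degree (coeff (C i) j)) dvd coeff (C i) j"
      using *[OF deg sum i] by (simp only: const_poly_dvd_iff)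
    have "coeff (C i) j = 0"
    proof (rule ccontr)
      assume "coeff (C i) j \<noteq> 0"
      hence "Suc (degree (coeff (C i) j)) * m \<le> degree (coeff (C i) j)"
        by (rule power_dvd_degree_le[OF dvd _ f0])
      moreover have "Suc (degree (coeff (C i) j)) * 1 \<le> Suc (degree (coeff (C i) j)) * m"
        using m_pos by (intro mult_le_mono2) simp
      ultimately show False by simp
    qed
    thus "coeff (C i) j = coeff 0 j" by simp
  qed
qed

end

lemma prime_elem_dvd_prod:
  assumes "prime_elem p" "finite A" "p dvd \<Prod>A"
  shows "\<exists>x\<in>A. p dvd x"
  using assms(2,3)
proof (induction A rule: finite_induct)
  case empty
  thus ?case using prime_elem_not_unit[OF assms(1)] by simp
next
  case (insert x A)
  thus ?case using prime_elem_dvd_mult_iff[OF assms(1), of x "\<Prod>A"] by auto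
qed

text \<open>Distinct monic irreducibles are coprime, so their product divides \<open>S\<close>. This
  turns vanishing of the auxiliary polynomial into a count of primes.\<close>

lemma sum_degree_le_degree:
  fixes S :: "'a::finite_field poly"
  assumes "finite F" "\<And>P. P \<in> F \<Longrightarrow> monic_irreducible P \<and> P dvd S" "S \<noteq> 0"
  shows "(\<Sum>P\<in>F. degree P) \<le> degree S"
proof -
  have "\<Prod>F dvd S" using assms(1,2)
  proof (induction F rule: finite_induct)
    case (insert P F)
    then obtain W where W: "S = \<Prod>F * W" by (auto elim: dvdE)
    have P: "monic_irreducible P" "P dvd S" using insert.prems by auto
    have "\<not> P dvd \<Prod>F"
    proof
      assume "P dvd \<Prod>F"
      then obtain R where "R \<in> F" "P dvd R"
        using prime_elem_dvd_prod[OF monic_irreducibleD(2)[OF P(1)] insert.hyps(1)] by auto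
      moreover have "monic_irreducible R" using insert.prems \<open>R \<in> F\<close> by auto
      ultimately have "P = R"
        using monic_dvd_monic_irreducible[of P R] monic_irreducibleD[OF P(1)] by auto
      thus False using insert.hyps \<open>R \<in> F\<close> by simp
    qed
    hence "P dvd W" using P W prime_elem_dvd_mult_iff[OF monic_irreducibleD(2)[OF P(1)]] by auto
    thus ?case using insert.hyps by (simp add: W mult.commute mult_dvd_mono)
  qed simp
  moreover have "degree (\<Prod>F) = (\<Sum>P\<in>F. degree P)"
    using assms(2) monic_irreducibleD(4) by (intro degree_prod_eq_sum_degree) auto
  ultimately show ?thesis using dvd_imp_degree_le[of "\<Prod>F" S] assms(3) by simp
qed

lemma polys_below_mult:
  assumes "A \<in> polys_below (Suc i)" "B \<in> polys_below (Suc j)"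
  shows "A * B \<in> polys_below (Suc (i + j))"
  using assms degree_mult_le[of A B] by (auto simp: polys_below_iff)

lemma polys_below_sum: "(\<And>x. x \<in> S \<Longrightarrow> g x \<in> polys_below n) \<Longrightarrow> (\<Sum>x\<in>S. g x) \<in> polys_below n"
  by (induction S rule: infinite_finite_induct) (auto intro!: polys_below_add simp: polys_below_iff[of 0])

lemma polys_below_SucI: "degree A \<le> n \<Longrightarrow> A \<in> polys_below (Suc n)"
  by (auto simp: polys_below_iff)

section \<open>The auxiliary polynomial and upper bounds for residue classes\<close>

context power_residue_character
begin

text \<open>The exponent uses \<open>n\<close> instead of \<open>degree P\<close>, so that the
  condition at a root \<open>y\<close> of \<open>P\<close> reads \<open>ev y f ^ K = a\<close> with
  one and the same \<open>K\<close> for all \<open>P\<close> in \<open>irr_dvd n\<close>.\<close>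

definition residue_class :: "nat \<Rightarrow> 'a \<Rightarrow> 'a poly set" where
  "residue_class n a =
     {P\<in>irr_dvd n. P \<noteq> f \<and> [f ^ ((CARD('a) ^ n - 1) div l) = [:a:]] (mod P)}"

lemma l_mult_div: "l * ((CARD('a) ^ n - 1) div l) = CARD('a) ^ n - 1"
  by (rule dvd_mult_div_cancel) (rule l_dvd_q_power)

text \<open>The polynomial \<open>\<Sum> f ^ (\<kappa> i) * d (i, a) ^ (q ^ k') * X ^ a\<close> vanishes at all roots of the
  polynomials in the residue class as soon as the \<open>d (i, a)\<close> satisfy few linear equations;
  raising it to the power \<open>q ^ k\<close> and reducing exponents shows which ones.\<close>

lemma exists_vanishing_coefficients:
  assumes kk: "k \<le> k'" "k' > 1"
  defines "r \<equiv> CARD('a) ^ k" and "r' \<equiv> CARD('a) ^ k'"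
  defines "\<kappa> \<equiv> (r' - 1) div l" and "\<kappa>' \<equiv> (r - 1) div l"
  defines "c \<equiv> \<kappa>' + (2 * m + 2)"
  shows "\<exists>d. (\<forall>x\<in>{..<l} \<times> {..<\<kappa>}. d x \<in> polys_below c) \<and>
     (\<exists>x\<in>{..<l} \<times> {..<\<kappa>}. d x \<noteq> 0) \<and>
     (\<Sum>(i, j)\<in>{..<l} \<times> {..<\<kappa>}. smult (a ^ i) (f ^ (\<kappa>' * (l - 1 - i)) * monom 1 (j * r) * d (i, j))) = 0"
proof -
  define I where "I = {..<l} \<times> {..<\<kappa>}"
  define V where "V = PiE I (\<lambda>_. polys_below c :: 'a poly set)"
  define T where "T = (\<lambda>d. \<Sum>(i, j)\<in>I. smult (a ^ i) (f ^ (\<kappa>' * (l - 1 - i)) * monom 1 (j * r) * d (i, j)))"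
  define N where "N = \<kappa>' * (l - 1) * m + (\<kappa> - 1) * r + c"
  have r': "l * \<kappa> = r' - 1" "l * \<kappa>' = r - 1"
    unfolding \<kappa>_def \<kappa>'_def r_def r'_def by (rule l_mult_div)+
  have rr: "r \<le> r'" unfolding r_def r'_def using kk q_gt_1 by (intro power_increasing) auto
  have q3: "CARD('a) \<ge> 3" using q_gt_1 odd_q by (cases "CARD('a) = 2") auto
  have "3 ^ 2 \<le> CARD('a) ^ 2" using q3 by (intro power_mono) auto
  also have "\<dots> \<le> r'" unfolding r'_def using kk q_gt_1 by (intro power_increasing) auto
  finally have r9: "r' \<ge> 9" by simp
  have r1: "r \<ge> 1" unfolding r_def using q_gt_1 by simp
  have l: "l \<ge> 2" by (rule l_ge_2)
  have \<kappa>0: "\<kappa> > 0" using r'(1) r9 by (cases \<kappa>) auto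
  have finI: "finite I" by (simp add: I_def)
  \<comment> \<open>Here \<open>l * \<kappa> * c\<close> is the number of free coefficients and
    \<open>N\<close> the number of conditions. As \<open>l * \<kappa>' = r - 1\<close>, both contain
    \<open>\<kappa> * r\<close> up to smaller terms; the \<open>2 * m + 2\<close> in
    \<open>c\<close> adds \<open>(2 * m + 2) * (r' - 1)\<close> unknowns, enough to cover the
    \<open>m * r\<close> coming from the powers of \<open>f\<close>.\<close>
  have N_less: "N < l * \<kappa> * c"
  proof -
    have 1: "\<kappa>' * (l - 1) * m + \<kappa>' \<le> m * r"
    proof -
      have "\<kappa>' * 1 \<le> \<kappa>' * m" using m_pos by (intro mult_le_mono2) simp
      hence "\<kappa>' * (l - 1) * m + \<kappa>' \<le> \<kappa>' * (l - 1) * m + \<kappa>' * m" by simp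
      also have "\<dots> = (\<kappa>' * (l - 1) + \<kappa>') * m" by (simp add: algebra_simps)
      also have "\<kappa>' * (l - 1) + \<kappa>' = \<kappa>' * l" using l by (cases l) auto
      also have "\<kappa>' * l * m \<le> r * m" using r'(2) by (intro mult_le_mono1) (simp add: mult.commute)
      finally show ?thesis by (simp add: mult.commute)
    qed
    have 2: "l * \<kappa> * c = \<kappa> * (l * \<kappa>') + (l * \<kappa>) * (2 * m + 2)"
      by (simp add: c_def algebra_simps)
    have 3: "\<kappa> * (l * \<kappa>') + \<kappa> = \<kappa> * r" unfolding r'(2) using r1 by (cases r) auto
    have 4: "(\<kappa> - 1) * r + r = \<kappa> * r" using \<kappa>0 by (cases \<kappa>) auto
    have 5: "\<kappa> \<le> r'" using r'(1) l mult_le_mono1[of 1 l \<kappa>] by linarith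
    have 6: "(2 * m + 2) * (r' - 1) = (2 * m + 1) * (r' - 1) + (r' - 1)" by simp
    have "m * r \<le> m * r'" by (rule mult_le_mono2[OF rr])
    moreover have "(2 * m + 2) + m * r' + r' < r + (2 * m + 2) * (r' - 1)"
    proof -
      obtain s where s: "r' = s + 9" using r9 by (metis le_add_diff_inverse2)
      show ?thesis using r1 by (simp add: s algebra_simps)
    qed
    ultimately have "m * r + (2 * m + 2) + \<kappa> < r + (2 * m + 2) * (r' - 1)"
      using 5 by linarith
    hence "m * r + (\<kappa> - 1) * r + (2 * m + 2) < \<kappa> * (l * \<kappa>') + (2 * m + 2) * (r' - 1)"
      using 3 4 by linarith
    hence "N < \<kappa> * (l * \<kappa>') + (2 * m + 2) * (r' - 1)"
      using 1 unfolding N_def c_def by linarith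
    thus ?thesis unfolding 2 unfolding r'(1) mult.commute[of "r' - 1"] .
  qed
  have T: "T d \<in> polys_below N" if "d \<in> V" for d
    unfolding T_def
  proof (intro polys_below_sum, clarify)
    fix i j assume ij: "(i, j) \<in> I"
    have d: "d (i, j) \<in> polys_below (Suc (c - 1))"
      using that ij by (auto simp: V_def c_def)
    have "f ^ (\<kappa>' * (l - 1 - i)) \<in> polys_below (Suc (\<kappa>' * (l - 1) * m))"
    proof (rule polys_below_SucI)
      have "degree (f ^ (\<kappa>' * (l - 1 - i))) \<le> degree f * (\<kappa>' * (l - 1 - i))"
        by (rule degree_power_le)
      also have "\<dots> \<le> degree f * (\<kappa>' * (l - 1))" by (intro mult_le_mono2) simp
      finally show "degree (f ^ (\<kappa>' * (l - 1 - i))) \<le> \<kappa>' * (l - 1) * m" by (simp add: mult_ac)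
    qed
    moreover have "monom (1 :: 'a) (j * r) \<in> polys_below (Suc ((\<kappa> - 1) * r))"
    proof (rule polys_below_SucI)
      have "j \<le> \<kappa> - 1" using ij by (auto simp: I_def)
      hence "j * r \<le> (\<kappa> - 1) * r" by (rule mult_le_mono1)
      thus "degree (monom (1 :: 'a) (j * r)) \<le> (\<kappa> - 1) * r"
        by (rule le_trans[OF degree_monom_le])
    qed
    ultimately have "f ^ (\<kappa>' * (l - 1 - i)) * monom 1 (j * r) * d (i, j)
        \<in> polys_below (Suc (\<kappa>' * (l - 1) * m + (\<kappa> - 1) * r + (c - 1)))"
      using d by (intro polys_below_mult)
    also have "Suc (\<kappa>' * (l - 1) * m + (\<kappa> - 1) * r + (c - 1)) = N" by (simp add: N_def c_def)
    finally show "smult (a ^ i) (f ^ (\<kappa>' * (l - 1 - i)) * monom 1 (j * r) * d (i, j)) \<in> polys_below N"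
      by (auto simp: polys_below_def)
  qed
  \<comment> \<open>Counting replaces linear algebra: \<open>T\<close> is additive, so two families
    with the same image differ by a nonzero solution.\<close>
  have "card V = (CARD('a) ^ c) ^ (l * \<kappa>)"
    using finI by (simp add: V_def card_PiE card_polys_below I_def)
  also have "\<dots> = CARD('a) ^ (l * \<kappa> * c)" by (simp add: mult.commute flip: power_mult)
  also have "\<dots> > CARD('a) ^ N" using N_less q_gt_1 by (intro power_strict_increasing) auto
  finally have "card (polys_below N :: 'a poly set) < card V" by (simp add: card_polys_below)
  moreover have "card (T ` V) \<le> card (polys_below N :: 'a poly set)"
    using T by (intro card_mono) auto
  ultimately have "\<not> inj_on T V" by (intro pigeonhole) simp
  then obtain d1 d2 where d: "d1 \<in> V" "d2 \<in> V" "T d1 = T d2" "d1 \<noteq> d2" by (auto simp: inj_on_def)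
  define d where "d = (\<lambda>x. d1 x - d2 x)"
  have "\<forall>x\<in>I. d x \<in> polys_below c" using d by (auto simp: d_def V_def intro!: polys_below_diff)
  moreover have "\<exists>x\<in>I. d x \<noteq> 0"
  proof (rule ccontr)
    assume "\<not> (\<exists>x\<in>I. d x \<noteq> 0)"
    hence "d1 = d2" using d(1,2) unfolding V_def by (intro PiE_ext) (auto simp: d_def)
    with d(4) show False by simp
  qed
  moreover have "T d = T d1 - T d2"
    unfolding T_def d_def sum_subtractf[symmetric]
    by (intro sum.cong) (auto simp: right_diff_distrib smult_diff_right)
  ultimately show ?thesis using d(3) unfolding T_def I_def by auto
qed

text \<open>With \<open>q ^ n = r * r'\<close>, the coefficients of the auxiliary polynomial
  \<open>S\<close> are \<open>r'\<close>-th powers. This makes \<open>S\<close> nonzero by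
  \<open>twist_independent\<close>, and lets \<open>S ^ r\<close> collapse at points of the field
  with \<open>q ^ n\<close> elements to the expression that the choice of \<open>d\<close>
  annihilates. Hence every \<open>P\<close> in the class divides \<open>S\<close>, whose degree is
  dominated by \<open>\<kappa>' * r'\<close>, at most \<open>q ^ n / l\<close>; everything else is
  of order \<open>r'\<close>.\<close>

lemma sum_degree_residue_class_le:
  assumes n: "n \<ge> 3"
  shows "l * (\<Sum>P\<in>residue_class n a. degree P) \<le>
           CARD('a) ^ n + l * (3 * m + 3) * CARD('a) ^ (n - n div 2)"
proof -
  define k where "k = n div 2"
  define k' where "k' = n - n div 2"
  have kk: "k \<le> k'" "k' > 1" "k + k' = n" using n by (auto simp: k_def k'_def)
  define r where "r = CARD('a) ^ k"
  define r' where "r' = CARD('a) ^ k'"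
  define \<kappa> where "\<kappa> = (r' - 1) div l"
  define \<kappa>' where "\<kappa>' = (r - 1) div l"
  define c where "c = \<kappa>' + (2 * m + 2)"
  define K where "K = (CARD('a) ^ n - 1) div l"
  have lk: "l * \<kappa> = r' - 1" "l * \<kappa>' = r - 1" "l * K = CARD('a) ^ n - 1"
    unfolding \<kappa>_def \<kappa>'_def r_def r'_def K_def by (rule l_mult_div)+
  have rr: "r * r' = CARD('a) ^ n" unfolding r_def r'_def by (simp add: kk flip: power_add)
  have r1: "r \<ge> 1" "r' \<ge> 1" unfolding r_def r'_def using q_gt_1 by simp_all
  have l: "l \<ge> 2" by (rule l_ge_2)
  \<comment> \<open>This splitting makes \<open>t ^ (\<kappa> * i * r)\<close> equal to
    \<open>a ^ i\<close> divided by the much lower power \<open>t ^ (\<kappa>' * i)\<close>.\<close>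
  have K: "K = \<kappa> * r + \<kappa>'"
  proof -
    have "l * (\<kappa> * r + \<kappa>') = (r' - 1) * r + (r - 1)" by (simp add: distrib_left lk flip: mult.assoc)
    also have "\<dots> = r * r' - 1" using r1 by (cases r'; cases r) (auto simp: algebra_simps)
    also have "\<dots> = l * K" by (simp only: rr lk)
    finally show ?thesis using l by simp
  qed
  obtain d where d': "\<forall>x\<in>{..<l} \<times> {..<\<kappa>}. d x \<in> polys_below c"
    "\<exists>x\<in>{..<l} \<times> {..<\<kappa>}. d x \<noteq> 0"
    "(\<Sum>(i, j)\<in>{..<l} \<times> {..<\<kappa>}. smult (a ^ i) (f ^ (\<kappa>' * (l - 1 - i)) * monom 1 (j * r) * d (i, j))) = 0"
    using exists_vanishing_coefficients[OF kk(1,2), of a]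
    unfolding r_def[symmetric] r'_def[symmetric] \<kappa>_def[symmetric] \<kappa>'_def[symmetric] c_def[symmetric]
    by blast
  have d: "\<And>i j. i < l \<Longrightarrow> j < \<kappa> \<Longrightarrow> d (i, j) \<in> polys_below c"
    "\<exists>x\<in>{..<l} \<times> {..<\<kappa>}. d x \<noteq> 0"
    "(\<Sum>(i, j)\<in>{..<l} \<times> {..<\<kappa>}. smult (a ^ i) (f ^ (\<kappa>' * (l - 1 - i)) * monom 1 (j * r) * d (i, j))) = 0"
    using d' by blast+
  define C where "C i = (\<Sum>j<\<kappa>. monom (d (i, j)) j)" for i
  define S where "S = (\<Sum>i<l. f ^ (\<kappa> * i) * twist k' (C i))"
  have \<kappa>0: "\<kappa> > 0" using d(2) by (cases "\<kappa> = 0") auto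
  have coeff_C: "coeff (C i) j = (if j < \<kappa> then d (i, j) else 0)" for i j
    by (simp add: C_def coeff_sum)
  have degC: "degree (C i) < \<kappa>" for i
    by (rule le_less_trans[OF degree_le[of "\<kappa> - 1"]]) (use \<kappa>0 in \<open>auto simp: coeff_C\<close>)
  have S0: "S \<noteq> 0"
  proof
    assume "S = 0"
    from d(2) obtain i j where ij: "i < l" "j < \<kappa>" "d (i, j) \<noteq> 0" by auto
    have "C i = 0"
    proof (rule twist_independent[OF _ _ degC _ ij(1)])
      show "k' > 0" using kk by simp
      show "l * \<kappa> \<le> CARD('a) ^ k'" by (simp add: lk r'_def)
      show "(\<Sum>i<l. f ^ (\<kappa> * i) * twist k' (C i)) = 0" using \<open>S = 0\<close> by (simp add: S_def)
    qed
    with coeff_C[of i j] ij show False by simp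
  qed
  have S_eq: "S = (\<Sum>i<l. \<Sum>j<\<kappa>. f ^ (\<kappa> * i) * (d (i, j) ^ r' * [:0, 1:] ^ j))"
    by (simp add: S_def C_def twist_sum twist_monom r'_def sum_distrib_left)
  have degS: "degree S \<le> \<kappa> * (l - 1) * m + (c - 1) * r' + \<kappa>"
    unfolding S_eq
  proof (intro degree_sum_le finite_lessThan)
    fix i j assume ij: "i \<in> {..<l}" "j \<in> {..<\<kappa>}"
    have "degree (d (i, j)) \<le> c - 1" using d(1)[of i j] ij by (auto simp: polys_below_iff c_def)
    hence 1: "degree (d (i, j) ^ r') \<le> (c - 1) * r'"
      using degree_power_le[of "d (i, j)" r'] by (meson mult_le_mono1 order_trans)
    have "degree f * (\<kappa> * i) \<le> degree f * (\<kappa> * (l - 1))"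
      using ij by (intro mult_le_mono2) auto
    hence 2: "degree (f ^ (\<kappa> * i)) \<le> \<kappa> * (l - 1) * m"
      using degree_power_le[of f "\<kappa> * i"] mult.commute[of m "\<kappa> * (l - 1)"] by linarith
    have 3: "degree ([:0, 1 :: 'a:] ^ j) \<le> \<kappa>"
      using degree_power_le[of "[:0, 1 :: 'a:]" j] ij by simp
    show "degree (f ^ (\<kappa> * i) * (d (i, j) ^ r' * [:0, 1:] ^ j)) \<le> \<kappa> * (l - 1) * m + (c - 1) * r' + \<kappa>"
      using degree_mult_le[of "f ^ (\<kappa> * i)" "d (i, j) ^ r' * [:0, 1:] ^ j"]
        degree_mult_le[of "d (i, j) ^ r'" "[:0, 1:] ^ j"] 1 2 3 by linarith
  qed
  have "P dvd S" if P: "P \<in> residue_class n a" for P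
  proof -
    have P': "monic_irreducible P" "degree P dvd n" "P \<noteq> f" "[f ^ K = [:a:]] (mod P)"
      using P by (auto simp: residue_class_def irr_dvd_def K_def)
    obtain y where y: "ev y P = 0"
      using exists_root_ev[of P] monic_irreducibleD(5)[OF P'(1)] by auto
    define t where "t = ev y f"
    have t0: "t \<noteq> 0" using reciprocity(2)[OF P'(1,3)] ev_eq_0_iff_dvd[OF P'(1) y] by (simp add: t_def)
    have tK: "t ^ K = to_ac a"
      using P'(4) ev_eq_iff_cong[OF P'(1) y, of "f ^ K" "[:a:]"] by (simp add: t_def)
    have dn: "ev y D ^ (r' * r) = ev y D" for D
      using ev_power_card[OF P'(1) y P'(2), of D] rr by (simp add: mult.commute)
    have pr: "(\<Sum>x\<in>Y. g x) ^ r = (\<Sum>x\<in>Y. g x ^ r)" for Y :: "nat set" and g :: "nat \<Rightarrow> 'a alg_closure"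
      unfolding r_def by (rule frobenius_sum) simp
    \<comment> \<open>The nonzero factor \<open>t ^ (\<kappa>' * (l - 1))\<close> clears the
      denominators \<open>t ^ (\<kappa>' * i)\<close> for all \<open>i < l\<close>.\<close>
    have "t ^ (\<kappa>' * (l - 1)) * ev y S ^ r =
        (\<Sum>i<l. \<Sum>j<\<kappa>. t ^ (\<kappa>' * (l - 1)) * (t ^ (\<kappa> * i * r) * (ev y (d (i, j)) * y ^ (j * r))))"
      by (simp add: S_eq ev_sum pr power_mult_distrib t_def sum_distrib_left dn flip: power_mult)
    also have "\<dots> = (\<Sum>i<l. \<Sum>j<\<kappa>. to_ac a ^ i * (t ^ (\<kappa>' * (l - 1 - i)) * y ^ (j * r) * ev y (d (i, j))))"
    proof (intro sum.cong refl)
      fix i j assume "i \<in> {..<l}"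
      hence "\<kappa>' * (l - 1) = \<kappa>' * i + \<kappa>' * (l - 1 - i)" by (simp flip: distrib_left)
      hence "\<kappa>' * (l - 1) + \<kappa> * i * r = K * i + \<kappa>' * (l - 1 - i)" by (simp add: K algebra_simps)
      hence "t ^ (\<kappa>' * (l - 1) + \<kappa> * i * r) = t ^ (K * i + \<kappa>' * (l - 1 - i))" by (rule arg_cong)
      hence *: "t ^ (\<kappa>' * (l - 1)) * t ^ (\<kappa> * i * r) = to_ac a ^ i * t ^ (\<kappa>' * (l - 1 - i))"
        by (simp only: power_add power_mult[of t K i] tK)
      have "t ^ (\<kappa>' * (l - 1)) * (t ^ (\<kappa> * i * r) * (ev y (d (i, j)) * y ^ (j * r))) =
         (t ^ (\<kappa>' * (l - 1)) * t ^ (\<kappa> * i * r)) * (ev y (d (i, j)) * y ^ (j * r))"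
        by (simp only: mult.assoc)
      also have "\<dots> = to_ac a ^ i * (t ^ (\<kappa>' * (l - 1 - i)) * y ^ (j * r) * ev y (d (i, j)))"
        unfolding * by (simp only: mult_ac)
      finally show "t ^ (\<kappa>' * (l - 1)) * (t ^ (\<kappa> * i * r) * (ev y (d (i, j)) * y ^ (j * r))) =
            to_ac a ^ i * (t ^ (\<kappa>' * (l - 1 - i)) * y ^ (j * r) * ev y (d (i, j)))" .
    qed
    also have "\<dots> = ev y (\<Sum>(i, j)\<in>{..<l} \<times> {..<\<kappa>}. smult (a ^ i) (f ^ (\<kappa>' * (l - 1 - i)) * monom 1 (j * r) * d (i, j)))"
      by (subst sum.cartesian_product[symmetric]) (simp add: ev_sum t_def)
    also have "\<dots> = 0" by (simp only: d(3) ev_0)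
    finally have "ev y S = 0" using t0 by simp
    thus "P dvd S" using ev_eq_0_iff_dvd[OF P'(1) y] by simp
  qed
  hence "(\<Sum>P\<in>residue_class n a. degree P) \<le> degree S"
    using S0 n by (intro sum_degree_le_degree) (auto simp: residue_class_def irr_dvd_def intro: finite_subset[OF _ finite_irr_dvd[of n]])
  also note degS
  finally have "l * (\<Sum>P\<in>residue_class n a. degree P) \<le> l * (\<kappa> * (l - 1) * m + (c - 1) * r' + \<kappa>)"
    by (rule mult_le_mono2)
  also have "\<dots> = (l * \<kappa>) * ((l - 1) * m) + (l * \<kappa>') * r' + l * (2 * m + 1) * r' + l * \<kappa>"
  proof -
    have c1: "c - 1 = \<kappa>' + (2 * m + 1)" by (simp add: c_def)
    show ?thesis unfolding c1 by (simp only: distrib_left distrib_right mult_ac add_ac)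
  qed
  also have "\<dots> \<le> r' * (l * m) + CARD('a) ^ n + l * (2 * m + 1) * r' + l * r'"
  proof -
    have "(l * \<kappa>) * ((l - 1) * m) \<le> r' * (l * m)" by (intro mult_le_mono) (simp_all add: lk)
    moreover have "(l * \<kappa>') * r' \<le> CARD('a) ^ n" unfolding rr[symmetric] by (intro mult_le_mono1) (simp add: lk)
    moreover have "l * \<kappa> \<le> l * r'" using lk(1) l mult_le_mono1[of 1 l r'] by linarith
    ultimately show ?thesis by linarith
  qed
  also have "\<dots> \<le> CARD('a) ^ n + l * (3 * m + 3) * r'"
    by (simp add: algebra_simps)
  finally show ?thesis by (simp add: r'_def k'_def)
qed

end

section \<open>From class counts to square-root cancellation\<close>

context power_residue_character
begin

text \<open>With \<open>e = n / degree P\<close>, the exponent for \<open>n\<close> is the one for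
  \<open>degree P\<close> times a geometric sum of \<open>e\<close> terms, each congruent to 1
  modulo \<open>l\<close>; so passing to \<open>n\<close> raises the symbol to the power
  \<open>e\<close>, as required by \<open>prime_sum\<close>.\<close>

lemma power_residue_extension:
  assumes P: "P \<in> irr_dvd n" "P \<noteq> f" and n: "n > 0"
  defines "s \<equiv> power_residue l f P"
  shows "xi P ^ (n div degree P) = \<iota> (s ^ (n div degree P))"
    and "(s ^ (n div degree P)) ^ l = 1"
    and "P \<in> residue_class n a \<longleftrightarrow> a = s ^ (n div degree P)"
proof -
  have P': "monic_irreducible P" "degree P dvd n" using P by (auto simp: irr_dvd_def)
  obtain y where y: "ev y P = 0"
    using exists_root_ev[of P] monic_irreducibleD(5)[OF P'(1)] by auto
  let ?d = "degree P"
  let ?e = "n div ?d"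
  have nd: "n = ?d * ?e" using P'(2) by simp
  have ndvd: "\<not> P dvd f" by (rule reciprocity(2)[OF P'(1) P(2)])
  note s = power_residue[OF P'(1) y ndvd, folded s_def]
  show sl: "(s ^ ?e) ^ l = 1"
    using s(2) by (metis mult.commute power_mult power_one)
  have "xi P = \<iota> s" using chi_eq_xi[OF P'(1), symmetric] P(2) by (simp add: s_def)
  thus "xi P ^ ?e = \<iota> (s ^ ?e)" using s(2) by (simp add: iota_power)
  have "(CARD('a) ^ n - 1) div l = ((CARD('a) ^ ?d - 1) div l) * (\<Sum>j<?e. (CARD('a) ^ ?d) ^ j)"
  proof -
    have "CARD('a) ^ n = (CARD('a) ^ ?d) ^ ?e" by (subst nd) (simp only: power_mult)
    hence "CARD('a) ^ n - 1 = (\<Sum>j<?e. (CARD('a) ^ ?d) ^ j) * (CARD('a) ^ ?d - 1)"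
      using nat_geometric_sum[of "CARD('a) ^ ?d" ?e] q_gt_1 by (simp only: one_le_power less_imp_le)
    thus ?thesis
      using dvd_div_mult[OF l_dvd_q_power[of ?d], of "\<Sum>j<?e. (CARD('a) ^ ?d) ^ j"]
      by (simp only: mult.commute)
  qed
  hence "ev y f ^ ((CARD('a) ^ n - 1) div l) = to_ac s ^ (\<Sum>j<?e. (CARD('a) ^ ?d) ^ j)"
    by (simp only: power_mult s(1))
  also have "\<dots> = to_ac s ^ ?e"
  proof -
    have "[(\<Sum>j<?e. (CARD('a) ^ ?d) ^ j) = (\<Sum>j<?e. 1)] (mod l)"
      by (intro cong_sum) (simp only: q_power_cong flip: power_mult)
    hence c: "(\<Sum>j<?e. (CARD('a) ^ ?d) ^ j) mod l = ?e mod l" by (simp add: cong_def)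
    have "to_ac s ^ l = 1" using s(2) by (simp flip: to_ac_power)
    hence *: "to_ac s ^ k = to_ac s ^ (k mod l)" for k
      by (subst (1) mult_div_mod_eq[of l k, symmetric]) (simp only: power_add power_mult power_one mult_1)
    show ?thesis by (subst (1 2) *) (simp only: c)
  qed
  finally have ev: "ev y f ^ ((CARD('a) ^ n - 1) div l) = to_ac (s ^ ?e)" by simp
  have "P \<in> residue_class n a \<longleftrightarrow> to_ac (s ^ ?e) = to_ac a"
    using P ev_eq_iff_cong[OF P'(1) y, of "f ^ ((CARD('a) ^ n - 1) div l)" "[:a:]"] ev
    by (simp add: residue_class_def)
  thus "P \<in> residue_class n a \<longleftrightarrow> a = s ^ ?e" by (simp only: to_ac_eq_iff) auto
qed

definition unity_roots :: "'a set" where "unity_roots = {a. a ^ l = 1}"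

lemma card_unity_roots: "card unity_roots = l"
proof -
  have "card unity_roots = card {w :: complex. w ^ l = 1}"
    using iota unfolding roots_of_unity_iso_def unity_roots_def by (auto dest: bij_betw_same_card)
  thus ?thesis using card_roots_unity_eq[of l] l_ge_2 by simp
qed

lemma sum_iota: "(\<Sum>a\<in>unity_roots. \<iota> a) = 0"
proof -
  have "(\<Sum>a\<in>unity_roots. \<iota> a) = (\<Sum>w | w ^ l = 1. w :: complex)"
    using iota unfolding roots_of_unity_iso_def unity_roots_def
    by (intro sum.reindex_bij_betw) auto
  thus ?thesis using sum_roots_unity[of l] l_ge_2 by simp
qed

definition class_count :: "nat \<Rightarrow> 'a \<Rightarrow> nat" where
  "class_count n a = (\<Sum>P\<in>residue_class n a. degree P)"

lemma irr_dvd_eq_Union: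
  assumes "n > 0"
  shows "irr_dvd n - {f} = (\<Union>a\<in>unity_roots. residue_class n a)"
proof (intro equalityI subsetI)
  fix P assume "P \<in> irr_dvd n - {f}"
  with power_residue_extension[of P n] assms show "P \<in> (\<Union>a\<in>unity_roots. residue_class n a)"
    by (auto simp: unity_roots_def)
qed (auto simp: residue_class_def)

lemma residue_class_disjoint:
  assumes "n > 0" "a \<noteq> b"
  shows "residue_class n a \<inter> residue_class n b = {}"
proof -
  have False if "P \<in> residue_class n a" "P \<in> residue_class n b" for P
  proof -
    have "P \<in> irr_dvd n" "P \<noteq> f" using that by (auto simp: residue_class_def)
    from power_residue_extension(3)[OF this assms(1)] that assms(2) show False by metis
  qed
  thus ?thesis by auto
qed

lemma finite_residue_class: "n > 0 \<Longrightarrow> finite (residue_class n a)"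
  by (rule finite_subset[OF _ finite_irr_dvd[of n]]) (auto simp: residue_class_def)

lemma prime_sum_xi_eq:
  assumes n: "n > 0"
  shows "prime_sum xi n = (\<Sum>a\<in>unity_roots. \<iota> a * of_nat (class_count n a))"
proof -
  have "prime_sum xi n = (\<Sum>P\<in>irr_dvd n - {f}. of_nat (degree P) * xi P ^ (n div degree P))"
    unfolding prime_sum_def
  proof (rule sum.mono_neutral_right)
    show "\<forall>P\<in>irr_dvd n - (irr_dvd n - {f}). of_nat (degree P) * xi P ^ (n div degree P) = 0"
    proof
      fix P assume P: "P \<in> irr_dvd n - (irr_dvd n - {f})"
      hence "P = f" "m dvd n" by (auto simp: irr_dvd_def)
      hence "n div degree P > 0" using n m_pos by (auto simp: div_greater_zero_iff dvd_imp_le)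
      thus "of_nat (degree P) * xi P ^ (n div degree P) = 0"
        using \<open>P = f\<close> by (simp add: xi_0 zero_power)
    qed
  qed (use n in auto)
  also have "\<dots> = (\<Sum>a\<in>unity_roots. \<Sum>P\<in>residue_class n a. of_nat (degree P) * xi P ^ (n div degree P))"
    unfolding irr_dvd_eq_Union[OF n]
    by (intro sum.UNION_disjoint) (use finite_residue_class[OF n] residue_class_disjoint[OF n] in auto)
  also have "\<dots> = (\<Sum>a\<in>unity_roots. \<Sum>P\<in>residue_class n a. of_nat (degree P) * \<iota> a)"
  proof (intro sum.cong refl)
    fix a P assume P: "P \<in> residue_class n a"
    hence P': "P \<in> irr_dvd n" "P \<noteq> f" by (auto simp: residue_class_def)
    show "of_nat (degree P) * xi P ^ (n div degree P) = of_nat (degree P) * \<iota> a"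
      using power_residue_extension(1)[OF P' n] power_residue_extension(3)[OF P' n, of a] P by simp
  qed
  also have "\<dots> = (\<Sum>a\<in>unity_roots. \<iota> a * of_nat (class_count n a))"
    by (simp add: class_count_def sum_distrib_left mult.commute)
  finally show ?thesis .
qed

text \<open>The classes exhaust \<open>irr_dvd n\<close> except possibly for \<open>f\<close>, whose
  degree is \<open>m\<close>.\<close>

lemma sum_class_count_ge:
  assumes n: "n > 0"
  shows "(\<Sum>a\<in>unity_roots. class_count n a) + m \<ge> CARD('a) ^ n"
proof -
  have *: "(\<Sum>a\<in>unity_roots. class_count n a) = (\<Sum>P\<in>irr_dvd n - {f}. degree P)"
    unfolding irr_dvd_eq_Union[OF n] class_count_def
    by (rule sum.UNION_disjoint[symmetric])
       (use finite_residue_class[OF n] residue_class_disjoint[OF n] in auto)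
  have "(\<Sum>P\<in>irr_dvd n. degree (P :: 'a poly)) \<le> (\<Sum>P\<in>irr_dvd n - {f}. degree P) + m"
  proof (cases "f \<in> irr_dvd n")
    case True
    thus ?thesis using n by (subst sum.remove[of _ f]) auto
  qed simp
  thus "(\<Sum>a\<in>unity_roots. class_count n a) + m \<ge> CARD('a) ^ n"
    using sum_degree_irr_dvd[OF n, where 'a = 'a] * by simp
qed

lemma norm_prime_sum_le:
  assumes "n > 0"
  shows "norm (prime_sum xi n) \<le> real CARD('a) ^ n"
proof -
  have "norm (prime_sum xi n) \<le> (\<Sum>P\<in>irr_dvd n. real (degree (P :: 'a poly)))"
    unfolding prime_sum_def
    by (rule sum_norm_le) (simp add: norm_mult norm_power mult_left_le power_le_one xi_norm_le)
  also have "\<dots> = real CARD('a) ^ n"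
    using sum_degree_irr_dvd[OF assms, where 'a = 'a] by (simp flip: of_nat_sum of_nat_power)
  finally show ?thesis .
qed

text \<open>Let \<open>c a\<close> be the deviation of a class count from its mean. Each
  \<open>c a\<close> is at most \<open>E\<close> and their sum is at least \<open>-m\<close>, so
  each one is also at least \<open>-m - (l - 1) * E\<close>.\<close>

lemma norm_prime_sum_bound_aux:
  assumes n: "n \<ge> 3"
  shows "norm (prime_sum xi n) \<le> real (l * (m + l * (l * (3 * m + 3)))) * real CARD('a) ^ (n - n div 2)"
proof -
  define E where "E = real (l * (3 * m + 3)) * real CARD('a) ^ (n - n div 2)"
  define Q where "Q = real CARD('a) ^ n"
  define c where "c a = real (class_count n a) - Q / real l" for a
  have n0: "n > 0" using n by simp
  have l: "real l > 0" "l \<ge> 1" using l_ge_2 by auto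
  have fin: "finite unity_roots" by simp
  have E0: "E \<ge> 0" by (simp add: E_def)
  have upper: "c a \<le> E" for a
  proof -
    have "real (l * class_count n a) \<le> real (CARD('a) ^ n + l * (3 * m + 3) * CARD('a) ^ (n - n div 2))"
      unfolding class_count_def of_nat_le_iff by (rule sum_degree_residue_class_le[OF n])
    hence "real l * real (class_count n a) \<le> Q + E" by (simp add: Q_def E_def)
    hence "real (class_count n a) \<le> (Q + E) / real l" using l by (simp add: field_simps)
    hence "c a \<le> E / real l" by (simp add: c_def add_divide_distrib)
    also have "\<dots> \<le> E / 1" using E0 l by (intro divide_left_mono) auto
    finally show ?thesis by simp
  qed
  have sum_c: "(\<Sum>a\<in>unity_roots. c a) \<ge> - real m"
  proof -
    have "(\<Sum>a\<in>unity_roots. c a) = real (\<Sum>a\<in>unity_roots. class_count n a) - Q"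
      using l by (simp add: c_def sum_subtractf card_unity_roots)
    moreover have "real (CARD('a) ^ n) \<le> real ((\<Sum>a\<in>unity_roots. class_count n a) + m)"
      unfolding of_nat_le_iff by (rule sum_class_count_ge[OF n0])
    ultimately show ?thesis by (simp add: Q_def)
  qed
  have abs_c: "\<bar>c a\<bar> \<le> real m + real l * E" if a: "a \<in> unity_roots" for a
  proof -
    have "(\<Sum>b\<in>unity_roots - {a}. c b) \<le> (\<Sum>b\<in>unity_roots - {a}. E)" by (intro sum_mono upper)
    also have "\<dots> = (real l - 1) * E" using a fin l by (simp add: card_unity_roots of_nat_diff)
    finally have "c a \<ge> - real m - (real l - 1) * E"
      using sum_c sum.remove[OF fin a, of c] by linarith
    moreover have "(real l - 1) * E \<le> real l * E" "1 * E \<le> real l * E" using E0 l by (intro mult_right_mono; simp)+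
    ultimately show ?thesis using upper[of a] by linarith
  qed
  \<comment> \<open>The mean \<open>Q / l\<close> disappears because the roots of unity sum to
    0.\<close>
  have "prime_sum xi n = (\<Sum>a\<in>unity_roots. \<iota> a * of_real (c a)) + (\<Sum>a\<in>unity_roots. \<iota> a) * of_real (Q / real l)"
    unfolding prime_sum_xi_eq[OF n0] sum_distrib_right sum.distrib[symmetric]
    by (intro sum.cong) (auto simp: c_def ring_distribs)
  also have "\<dots> = (\<Sum>a\<in>unity_roots. \<iota> a * of_real (c a))" by (simp add: sum_iota)
  also have "norm \<dots> \<le> (\<Sum>a\<in>unity_roots. real m + real l * E)"
    by (rule sum_norm_le) (auto simp: norm_mult abs_c unity_roots_def iota_norm)
  also have "\<dots> = real l * (real m + real l * E)" by (simp add: card_unity_roots)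
  also have "\<dots> \<le> real l * (real m * real CARD('a) ^ (n - n div 2) + real l * E)"
    using one_le_power[of "real CARD('a)" "n - n div 2"] q_gt_1 by (intro mult_left_mono add_mono) (auto simp: mult_le_cancel_left1)
  also have "\<dots> = real (l * (m + l * (l * (3 * m + 3)))) * real CARD('a) ^ (n - n div 2)"
    by (simp add: E_def algebra_simps)
  finally show ?thesis .
qed

text \<open>Rounding \<open>n / 2\<close> up costs at most one factor \<open>sqrt q\<close>; the
  indices \<open>n < 3\<close>, outside the reach of Stepanov's argument, are absorbed by the
  summand \<open>q ^ 2\<close> of the constant.\<close>

lemma prime_sum_bound: "\<exists>K\<ge>0. \<forall>n>0. norm (prime_sum xi n) \<le> K * sqrt (real CARD('a)) ^ n"
proof -
  let ?s = "sqrt (real CARD('a))"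
  define K0 where "K0 = real (l * (m + l * (l * (3 * m + 3))))"
  have s1: "?s \<ge> 1" using q_gt_1 by simp
  have "norm (prime_sum xi n) \<le> (K0 * ?s + real CARD('a) ^ 2) * ?s ^ n" if "n > 0" for n
  proof (cases "n \<ge> 3")
    case True
    have "real CARD('a) ^ (n - n div 2) = ?s ^ (2 * (n - n div 2))"
      by (simp add: power_mult)
    also have "\<dots> \<le> ?s ^ Suc n" using s1 by (intro power_increasing) auto
    finally have "K0 * real CARD('a) ^ (n - n div 2) \<le> K0 * ?s ^ Suc n"
      by (intro mult_left_mono) (simp_all add: K0_def)
    hence "norm (prime_sum xi n) \<le> K0 * ?s * ?s ^ n"
      using norm_prime_sum_bound_aux[OF True] by (simp add: K0_def)
    also have "\<dots> \<le> (K0 * ?s + real CARD('a) ^ 2) * ?s ^ n"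
      by (intro mult_right_mono) auto
    finally show ?thesis .
  next
    case False
    have "norm (prime_sum xi n) \<le> real CARD('a) ^ n" by (rule norm_prime_sum_le[OF that])
    also have "\<dots> \<le> real CARD('a) ^ 2" using False q_gt_1 by (intro power_increasing) auto
    also have "\<dots> \<le> (K0 * ?s + real CARD('a) ^ 2) * ?s ^ n"
    proof -
      have "real CARD('a) ^ 2 * 1 \<le> (K0 * ?s + real CARD('a) ^ 2) * ?s ^ n"
        using s1 by (intro mult_mono one_le_power) (auto simp: K0_def)
      thus ?thesis by simp
    qed
    finally show ?thesis .
  qed
  moreover have "K0 * ?s + real CARD('a) ^ 2 \<ge> 0" by (simp add: K0_def)
  ultimately show ?thesis by blast
qed

end

subsection \<open>An extremal majorant of the logarithm\<close>

text \<open>Obtained by writing \<open>ln \<bar>1 - z\<bar>\<close> as minus the integral of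
  \<open>Re (z / (1 - t z))\<close> over \<open>t\<close> from 0 to 1 and minorising the integrand
  for each \<open>t\<close> by a trigonometric polynomial of degree less than \<open>M\<close> that
  touches it where \<open>z ^ M = -1\<close>.\<close>

definition majorant_coeff :: "nat \<Rightarrow> nat \<Rightarrow> real" where
  "majorant_coeff M n =
     integral {0..1} (\<lambda>t. (t ^ (n - 1) - t ^ (2 * M - n - 1)) / (1 + t ^ M) ^ 2)"

lemma majorant_coeff_bounds:
  assumes "0 < n" "n < M"
  shows "0 \<le> majorant_coeff M n" "majorant_coeff M n \<le> 1"
proof -
  let ?g = "\<lambda>t :: real. (t ^ (n - 1) - t ^ (2 * M - n - 1)) / (1 + t ^ M) ^ 2"
  have pos: "1 + t ^ M \<noteq> 0" if "t \<in> {0..1}" for t :: real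
  proof -
    have "t ^ M \<ge> 0" using that by simp
    thus ?thesis by linarith
  qed
  have int: "?g integrable_on {0..1}"
    by (intro integrable_continuous_interval continuous_intros) (use pos in auto)
  have g: "0 \<le> ?g t \<and> ?g t \<le> 1" if t: "t \<in> {0..1}" for t
  proof
    have le: "t ^ (2 * M - n - 1) \<le> t ^ (n - 1)" using t assms by (intro power_decreasing) auto
    thus "0 \<le> ?g t" by simp
    have "1 ^ 2 \<le> (1 + t ^ M) ^ 2" using t by (intro power_mono) auto
    moreover have "t ^ (n - 1) - t ^ (2 * M - n - 1) \<le> 1 - 0"
      using t by (intro diff_mono power_le_one) auto
    ultimately show "?g t \<le> 1" using pos[OF t] by (subst divide_le_eq_1_pos) auto
  qed
  show "0 \<le> majorant_coeff M n" unfolding majorant_coeff_def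
    using g by (intro integral_nonneg int) auto
  have "majorant_coeff M n \<le> integral {0..1 :: real} (\<lambda>_. 1)" unfolding majorant_coeff_def
    using g by (intro integral_le int) auto
  thus "majorant_coeff M n \<le> 1" by simp
qed

lemma sum_power_telescope: "(\<Sum>n=1..<M. x ^ n) * (1 - x) = x - x ^ M"
  if "M > 0" for x :: "'b::comm_ring_1"
  using that
proof (induction M rule: nat_induct_non_zero)
  case (Suc M)
  have "(\<Sum>n=1..<Suc M. x ^ n) * (1 - x) = (\<Sum>n=1..<M. x ^ n) * (1 - x) + x ^ M * (1 - x)"
    using Suc.hyps by (simp add: distrib_right)
  thus ?case unfolding Suc.IH by (simp add: algebra_simps)
qed simp

text \<open>With \<open>A = Re z\<close>, the first term is \<open>Re (z / (1 - t z))\<close>; the difference of the two sides is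
  a positive multiple of \<open>\<bar>1 + z ^ M\<bar>\<^sup>2 / \<bar>1 - t z\<bar>\<^sup>2\<close>.\<close>

lemma kernel_minorant:
  fixes z :: complex and t :: real
  assumes z: "norm z = 1" and t: "0 < t" "t < 1" and M: "M > 0"
  shows "(\<Sum>n=1..<M. (t ^ (n - 1) - t ^ (2 * M - n - 1)) / (1 + t ^ M) ^ 2 * Re (z ^ n))
     \<le> (Re z - t) / (1 - 2 * t * Re z + t ^ 2) + t ^ (M - 1) / (1 + t ^ M)"
proof -
  define A B C T where "A = Re z" and "B = Re (z ^ M)" and "C = Re (z ^ (M - 1))" and "T = t ^ M"
  define D where "D = 1 - 2 * t * A + t ^ 2"
  define x where "x = of_real t * z"
  \<comment> \<open>\<open>S\<close> and \<open>U\<close> carry the two parts \<open>t ^ n\<close>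
    and \<open>t ^ (2 * M - n)\<close> of the coefficients. Both are geometric sums, in
    \<open>x\<close> and, after reversal, in \<open>cnj x\<close>, so multiplying by
    \<open>D\<close> telescopes them.\<close>
  define S where "S = (\<Sum>n=1..<M. x ^ n)"
  define U where "U = (\<Sum>n=1..<M. of_real (t ^ (2 * M - n)) * z ^ n)"
  have zz: "z * cnj z = 1" using z by (simp add: complex_norm_square[symmetric])
  have xx: "x * cnj x = of_real (t ^ 2)"
  proof -
    have "x * cnj x = of_real (t ^ 2) * (z * cnj z)" by (simp add: x_def power2_eq_square)
    thus ?thesis by (simp only: zz mult_1_right)
  qed
  have A1: "A \<le> 1" using complex_Re_le_cmod[of z] z by (simp add: A_def)
  have D: "D > 0"
  proof -
    have "D = (1 - t) ^ 2 + 2 * t * (1 - A)" by (simp add: D_def power2_eq_square algebra_simps)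
    moreover have "(1 - t) ^ 2 > 0" using t by simp
    ultimately show ?thesis using t A1 by (simp add: add_pos_nonneg)
  qed
  have Dc: "of_real D = (1 - x) * (1 - cnj x)"
  proof -
    have "(1 - x) * (1 - cnj x) = 1 - (x + cnj x) + x * cnj x" by (simp add: algebra_simps)
    also have "x + cnj x = of_real (2 * t * A)" unfolding complex_add_cnj by (simp add: x_def A_def)
    finally show ?thesis by (simp add: xx D_def)
  qed
  have zM: "z ^ M = z * z ^ (M - 1)" and tM: "T = t * t ^ (M - 1)" using M by (auto simp: T_def power_eq_if)
  have S: "of_real D * S = x - of_real (t ^ 2) - of_real T * z ^ M + of_real (t * T) * z ^ (M - 1)"
  proof -
    have "of_real D * S = (S * (1 - x)) * (1 - cnj x)" by (simp add: Dc mult_ac)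
    also have "\<dots> = (x - x ^ M) * (1 - cnj x)" unfolding S_def sum_power_telescope[OF M] ..
    also have "\<dots> = x - x * cnj x - x ^ M + x ^ (M - 1) * (x * cnj x)"
      using M by (cases M) (simp_all add: algebra_simps)
    also have "x ^ M = of_real T * z ^ M" by (simp add: x_def T_def power_mult_distrib)
    also have "x ^ (M - 1) * (x * cnj x) = of_real (t * T) * z ^ (M - 1)"
      unfolding xx tM by (simp add: x_def power_mult_distrib power2_eq_square)
    finally show ?thesis by (simp add: xx)
  qed
  have U: "of_real D * U = of_real T * (of_real t * z ^ (M - 1) - of_real T - of_real (t ^ 2) * z ^ M + of_real (T * t) * z)"
  proof -
    have "U = (\<Sum>k=1..<M. of_real (t ^ (2 * M - (M - k))) * z ^ (M - k))"
      unfolding U_def by (rule sum.reindex_bij_witness[of _ "\<lambda>k. M - k" "\<lambda>k. M - k"]) auto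
    also have "\<dots> = (\<Sum>k=1..<M. of_real T * z ^ M * cnj x ^ k)"
    proof (intro sum.cong refl)
      fix k assume k: "k \<in> {1..<M}"
      hence 1: "t ^ (2 * M - (M - k)) = T * t ^ k" by (simp add: T_def flip: power_add)
      have "z ^ M * cnj z ^ k = z ^ (M - k) * (z * cnj z) ^ k"
        unfolding power_mult_distrib using k by (simp flip: power_add mult.assoc)
      hence 2: "z ^ (M - k) = z ^ M * cnj z ^ k" by (simp add: zz)
      show "of_real (t ^ (2 * M - (M - k))) * z ^ (M - k) = of_real T * z ^ M * cnj x ^ k"
        unfolding 1 2 by (simp add: x_def power_mult_distrib)
    qed
    finally have Ueq: "U = of_real T * z ^ M * (\<Sum>k=1..<M. cnj x ^ k)" by (simp add: sum_distrib_left)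
    have zMx: "z ^ M * cnj x ^ M = of_real T"
    proof -
      have "z ^ M * cnj x ^ M = of_real T * (z * cnj z) ^ M" by (simp add: x_def T_def power_mult_distrib)
      thus ?thesis by (simp add: zz)
    qed
    have zx: "z ^ M * cnj x = of_real t * z ^ (M - 1)"
    proof -
      have "z ^ M * cnj x = of_real t * z ^ (M - 1) * (z * cnj z)" unfolding zM by (simp add: x_def)
      thus ?thesis by (simp add: zz)
    qed
    have "of_real D * U = of_real T * z ^ M * ((\<Sum>k=1..<M. cnj x ^ k) * (1 - cnj x)) * (1 - x)"
      by (simp add: Dc Ueq mult_ac)
    also have "\<dots> = of_real T * ((z ^ M * cnj x) - z ^ M * cnj x ^ M) * (1 - x)"
      unfolding sum_power_telescope[OF M] by (simp add: algebra_simps)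
    also have "\<dots> = of_real T * (z ^ M * cnj x - of_real T - z ^ M * (x * cnj x) + of_real T * x)"
      unfolding zMx by (simp add: algebra_simps)
    also have "\<dots> = of_real T * (of_real t * z ^ (M - 1) - of_real T - of_real (t ^ 2) * z ^ M + of_real (T * t) * z)"
      unfolding zx xx by (simp add: x_def mult_ac)
    finally show ?thesis .
  qed
  have ReS: "D * Re S = t * A - t ^ 2 - T * B + t * T * C"
    using arg_cong[OF S, of Re] by (simp add: A_def B_def C_def x_def)
  have ReU: "D * Re U = T * (t * C - T - t ^ 2 * B + T * t * A)"
    using arg_cong[OF U, of Re] by (simp add: A_def B_def C_def)
  have T0: "T > 0" using t by (simp add: T_def)
  have B1: "1 + B \<ge> 0"
    using abs_Re_le_cmod[of "z ^ M"] z by (simp add: B_def norm_power)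
  have sum_eq: "t * (\<Sum>n=1..<M. (t ^ (n - 1) - t ^ (2 * M - n - 1)) / (1 + t ^ M) ^ 2 * Re (z ^ n))
      = (Re S - Re U) / (1 + T) ^ 2"
  proof -
    have "Re S - Re U = (\<Sum>n=1..<M. (t ^ n - t ^ (2 * M - n)) * Re (z ^ n))"
    proof -
      have "Re (x ^ n) = t ^ n * Re (z ^ n)" for n
        by (simp add: x_def power_mult_distrib flip: of_real_power)
      thus ?thesis by (simp add: S_def U_def left_diff_distrib sum_subtractf flip: of_real_power)
    qed
    also have "\<dots> = (\<Sum>n=1..<M. t * ((t ^ (n - 1) - t ^ (2 * M - n - 1)) * Re (z ^ n)))"
    proof (intro sum.cong refl)
      fix n assume n: "n \<in> {1..<M}"
      have "t ^ n = t * t ^ (n - 1)" "t ^ (2 * M - n) = t * t ^ (2 * M - n - 1)"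
        using n by (auto simp: power_eq_if)
      thus "(t ^ n - t ^ (2 * M - n)) * Re (z ^ n) = t * ((t ^ (n - 1) - t ^ (2 * M - n - 1)) * Re (z ^ n))"
        by (simp only: left_diff_distrib right_diff_distrib mult.assoc)
    qed
    finally show ?thesis
      by (simp add: T_def sum_distrib_left sum_divide_distrib mult_ac)
  qed
  \<comment> \<open>The decisive inequality: \<open>2 * (1 + B)\<close> is the square of the modulus
    of \<open>1 + z ^ M\<close>, and the rest is an identity.\<close>
  have "2 * T * (1 - t ^ 2) * (1 + B) \<ge> 0" using T0 t B1 by (simp add: power_le_one)
  also have "2 * T * (1 - t ^ 2) * (1 + B) =
     (2 * t * A - 2 * t ^ 2) * (1 + T) ^ 2 + 2 * T * (1 + T) * D - 2 * (D * Re S - D * Re U)"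
    unfolding ReS ReU by (simp add: D_def power2_eq_square algebra_simps)
  finally have "D * (Re S - Re U) \<le> (t * (A - t)) * (1 + T) ^ 2 + T * (1 + T) * D"
    by (simp add: power2_eq_square algebra_simps)
  hence "D * (Re S - Re U) / (D * (1 + T) ^ 2) \<le> ((t * (A - t)) * (1 + T) ^ 2 + T * (1 + T) * D) / (D * (1 + T) ^ 2)"
    using D T0 by (intro divide_right_mono) auto
  also have "D * (Re S - Re U) / (D * (1 + T) ^ 2) = (Re S - Re U) / (1 + T) ^ 2" using D by simp
  also have "((t * (A - t)) * (1 + T) ^ 2 + T * (1 + T) * D) / (D * (1 + T) ^ 2) =
     t * ((A - t) / D) + T / (1 + T)"
    using D T0 by (simp add: add_divide_distrib power2_eq_square)
  also have "\<dots> = t * ((A - t) / D + t ^ (M - 1) / (1 + T))" by (simp add: tM distrib_left)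
  finally have "t * (\<Sum>n=1..<M. (t ^ (n - 1) - t ^ (2 * M - n - 1)) / (1 + t ^ M) ^ 2 * Re (z ^ n))
     \<le> t * ((A - t) / D + t ^ (M - 1) / (1 + T))" by (simp only: sum_eq)
  hence "(\<Sum>n=1..<M. (t ^ (n - 1) - t ^ (2 * M - n - 1)) / (1 + t ^ M) ^ 2 * Re (z ^ n))
     \<le> (A - t) / D + t ^ (M - 1) / (1 + T)" using t by simp
  thus ?thesis by (simp add: A_def D_def T_def)
qed

text \<open>The function \<open>G\<close> below interpolates between \<open>G 0 = 0\<close> and the
  difference of the logarithms of the two sides at \<open>t = 1\<close>;
  \<open>kernel_minorant\<close> says exactly that its derivative is not positive. The point
  \<open>z = 1\<close> is split off because the logarithm is undefined there.\<close>

lemma norm_one_minus_le_circle: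
  fixes z :: complex
  assumes z: "norm z = 1" and M: "M > 0"
  shows "norm (1 - z) \<le> 2 powr (1 / M) * exp (- (\<Sum>n=1..<M. majorant_coeff M n * Re (z ^ n)))"
proof (cases "z = 1")
  case False
  define A where "A = Re z"
  define g where "g n t = (t ^ (n - 1) - t ^ (2 * M - n - 1)) / (1 + t ^ M) ^ 2" for n and t :: real
  define c where "c n t = integral {0..t} (g n)" for n t
  \<comment> \<open>The argument of the first logarithm is the square of the modulus of
    \<open>1 - t z\<close>.\<close>
  define G where "G t = ln (1 - 2 * t * A + t ^ 2) / 2 - ln (1 + t ^ M) / M + (\<Sum>n=1..<M. c n t * Re (z ^ n))" for t
  have "A < 1"
  proof -
    have "A \<noteq> 1"
    proof
      assume "A = 1"
      moreover have "A ^ 2 + Im z ^ 2 = 1" using z by (simp add: A_def cmod_def)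
      ultimately have "z = 1" by (simp add: complex_eq_iff A_def)
      with False show False by simp
    qed
    thus ?thesis using complex_Re_le_cmod[of z] z by (simp add: A_def)
  qed
  have D: "1 - 2 * t * A + t ^ 2 > 0" if "t \<in> {0..1}" for t
  proof -
    have "1 - 2 * t * A + t ^ 2 = (1 - t) ^ 2 + 2 * t * (1 - A)" by (simp add: power2_eq_square algebra_simps)
    moreover have "2 * t * (1 - A) > 0 \<or> (1 - t) ^ 2 > 0"
      using that \<open>A < 1\<close> by (cases "t = 0") auto
    moreover have "2 * t * (1 - A) \<ge> 0" "(1 - t) ^ 2 \<ge> 0" using that \<open>A < 1\<close> by auto
    ultimately show ?thesis by linarith
  qed
  have pos: "1 + t ^ M > 0" if "t \<in> {0..1}" for t :: real
    using that by (simp add: add_pos_nonneg)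
  have contg: "continuous_on {0..1} (g n)" for n
    unfolding g_def by (intro continuous_intros) (use pos in fastforce)
  have contc: "continuous_on {0..1} (c n)" for n
    unfolding c_def by (intro indefinite_integral_continuous_1 integrable_continuous_interval contg)
  have derc: "(c n has_real_derivative g n t) (at t)" if "t \<in> {0<..<1}" for n t
  proof -
    have "(c n has_real_derivative g n t) (at t within {0..1})"
      unfolding c_def by (rule integral_has_real_derivative[OF contg]) (use that in auto)
    thus ?thesis using that at_within_Icc_at[of 0 t 1] by simp
  qed
  have "G 1 \<le> G 0"
  proof (rule DERIV_nonpos_imp_decreasing_open[of 0 1 G])
    show "continuous_on {0..1} G"
      unfolding G_def by (intro continuous_intros contc) (use D pos M in fastforce)+
    fix t :: real assume t: "0 < t" "t < 1"
    let ?y = "(- 2 * A + 2 * t) / (1 - 2 * t * A + t ^ 2) / 2 - (M * t ^ (M - 1)) / (1 + t ^ M) / M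
        + (\<Sum>n=1..<M. g n t * Re (z ^ n))"
    have "((\<lambda>t. 1 - 2 * t * A + t ^ 2) has_real_derivative - 2 * A + 2 * t) (at t)"
      by (auto intro!: derivative_eq_intros)
    from DERIV_cdivide[OF DERIV_chain2[OF DERIV_ln_divide[OF D[of t]] this], of 2]
    have d1: "((\<lambda>t. ln (1 - 2 * t * A + t ^ 2) / 2) has_real_derivative
        (- 2 * A + 2 * t) / (1 - 2 * t * A + t ^ 2) / 2) (at t)"
      using t by (auto elim!: DERIV_cong)
    have "((\<lambda>t. 1 + t ^ M) has_real_derivative M * t ^ (M - 1)) (at t)"
      by (auto intro!: derivative_eq_intros)
    from DERIV_cdivide[OF DERIV_chain2[OF DERIV_ln_divide[OF pos[of t]] this], of M]
    have d2: "((\<lambda>t. ln (1 + t ^ M) / M) has_real_derivative (M * t ^ (M - 1)) / (1 + t ^ M) / M) (at t)"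
      using t by (auto elim!: DERIV_cong)
    have d3: "((\<lambda>t. \<Sum>n=1..<M. c n t * Re (z ^ n)) has_real_derivative (\<Sum>n=1..<M. g n t * Re (z ^ n))) (at t)"
      using t by (intro DERIV_sum DERIV_cmult_right derc) auto
    have "(G has_real_derivative ?y) (at t)"
      unfolding G_def by (rule DERIV_add[OF DERIV_diff[OF d1 d2] d3])
    moreover have "?y \<le> 0"
    proof -
      have "?y = (\<Sum>n=1..<M. g n t * Re (z ^ n)) - ((A - t) / (1 - 2 * t * A + t ^ 2) + t ^ (M - 1) / (1 + t ^ M))"
      proof -
        have e1: "(- 2 * A + 2 * t) / y / 2 = - ((A - t) / y)" for y
          by (cases "y = 0") (simp_all add: field_simps)
        have e2: "(M * y) / y' / M = y / y'" for y y' :: real using M by simp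
        show ?thesis unfolding e1 e2 by simp
      qed
      thus ?thesis using kernel_minorant[OF z t M] by (simp add: g_def A_def)
    qed
    ultimately show "\<exists>y. (G has_real_derivative y) (at t) \<and> y \<le> 0" by blast
  qed simp
  also have "G 0 = 0" using M by (simp add: G_def c_def zero_power)
  finally have "G 1 \<le> 0" .
  moreover have "norm (1 - z) ^ 2 = 1 - 2 * 1 * A + 1 ^ 2"
  proof -
    have "A ^ 2 + Im z ^ 2 = 1" using z by (simp add: A_def cmod_def)
    moreover have "norm (1 - z) ^ 2 = (1 - A) ^ 2 + Im z ^ 2" by (simp add: cmod_power2 A_def)
    ultimately show ?thesis by (simp add: power2_eq_square algebra_simps)
  qed
  ultimately have "ln (norm (1 - z) ^ 2) / 2 \<le> ln 2 / M - (\<Sum>n=1..<M. majorant_coeff M n * Re (z ^ n))"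
    by (simp add: G_def c_def g_def [abs_def] majorant_coeff_def)
  hence "ln (norm (1 - z)) \<le> ln 2 / M - (\<Sum>n=1..<M. majorant_coeff M n * Re (z ^ n))"
    using False by (simp add: ln_realpow)
  hence "norm (1 - z) \<le> exp (ln 2 / M - (\<Sum>n=1..<M. majorant_coeff M n * Re (z ^ n)))"
    using False by (subst (asm) exp_le_cancel_iff[symmetric]) simp
  thus ?thesis by (simp add: exp_diff exp_minus powr_def field_simps)
qed auto

text \<open>The maximum principle for \<open>(1 - z) * exp (p z)\<close> carries the bound from the
  circle into the disc, where the inverse roots of modulus less than \<open>sqrt q\<close> need
  it.\<close>

lemma norm_one_minus_le:
  fixes z :: complex
  assumes z: "norm z \<le> 1" and M: "M > 0"
  shows "norm (1 - z) \<le> 2 powr (1 / M) * exp (- (\<Sum>n=1..<M. majorant_coeff M n * Re (z ^ n)))"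
proof -
  define E where "E = (\<lambda>z :: complex. (1 - z) * exp (\<Sum>n=1..<M. of_real (majorant_coeff M n) * z ^ n))"
  have normE: "norm (E z) = norm (1 - z) * exp (\<Sum>n=1..<M. majorant_coeff M n * Re (z ^ n))" for z :: complex
    by (simp add: E_def norm_mult)
  have "norm (E z) \<le> 2 powr (1 / M)"
  proof (rule maximum_modulus_frontier[where f = E and S = "cball 0 1"])
    show "E holomorphic_on interior (cball 0 1)" "continuous_on (closure (cball 0 1)) E"
      unfolding E_def by (intro holomorphic_intros continuous_intros)+
    show "norm (E w) \<le> 2 powr (1 / M)" if "w \<in> frontier (cball 0 1)" for w
    proof -
      have "norm w = 1" using that by (simp add: frontier_cball)
      from norm_one_minus_le_circle[OF this M] show ?thesis
        unfolding normE by (simp add: exp_minus field_simps)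
    qed
  qed (use z in auto)
  thus ?thesis unfolding normE by (simp add: exp_minus field_simps)
qed

subsection \<open>Polynomials with bounded power sums\<close>

text \<open>Newton's identities in logarithmic form.\<close>

lemma fps_deriv_prod_linear:
  fixes B :: "complex multiset"
  defines "F \<equiv> fps_of_poly (\<Prod>\<beta>\<in>#B. [:1, - \<beta>:])"
  shows "fps_deriv F = - F * Abs_fps (\<lambda>n. \<Sum>\<beta>\<in>#B. \<beta> ^ Suc n)"
  unfolding F_def
proof (induction B)
  case empty
  have "Abs_fps (\<lambda>n. 0 :: complex) = 0" by (simp add: fps_eq_iff)
  thus ?case by simp
next
  case (add \<beta> B)
  let ?F = "fps_of_poly (\<Prod>\<beta>\<in>#B. [:1, - \<beta>:])"
  let ?S = "Abs_fps (\<lambda>n. \<Sum>\<beta>\<in>#B. \<beta> ^ Suc n)"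
  let ?G = "Abs_fps (\<lambda>n. \<beta> ^ Suc n)"
  let ?L = "1 - fps_const \<beta> * fps_X"
  have L: "fps_of_poly [:1, - \<beta>:] = ?L"
    by (rule fps_ext) (auto simp: fps_of_poly_nth coeff_pCons split: nat.splits)
  have G: "?L * ?G = fps_const \<beta>"
    by (rule fps_ext) (auto simp: left_diff_distrib mult.assoc fps_X_mult_nth power_eq_if)
  have S: "Abs_fps (\<lambda>n. \<Sum>\<beta>'\<in>#add_mset \<beta> B. \<beta>' ^ Suc n) = ?G + ?S"
    by (rule fps_ext) simp
  have F: "fps_of_poly (\<Prod>\<beta>\<in>#add_mset \<beta> B. [:1, - \<beta>:]) = ?L * ?F"
    by (simp only: image_mset_add_mset prod_mset.add_mset fps_of_poly_mult L)
  have "fps_deriv (fps_of_poly (\<Prod>\<beta>\<in>#add_mset \<beta> B. [:1, - \<beta>:])) = fps_deriv (?L * ?F)"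
    by (simp only: F)
  also have "\<dots> = - fps_const \<beta> * ?F + ?L * fps_deriv ?F" by simp
  also have "\<dots> = - (?L * ?G) * ?F + ?L * (- ?F * ?S)" unfolding add.IH G ..
  also have "\<dots> = - (?L * ?F) * (?G + ?S)" by (simp add: algebra_simps)
  also have "?L * ?F = fps_of_poly (\<Prod>\<beta>\<in>#add_mset \<beta> B. [:1, - \<beta>:])" by (simp only: F)
  finally show ?case unfolding S .
qed

text \<open>The assumption \<open>log_deriv\<close> says formally that \<open>p\<close> is the
  exponential of the series with coefficients \<open>S n / n\<close>; thus \<open>S n\<close> is
  minus the \<open>n\<close>-th power sum of the inverse roots.\<close>

locale bounded_power_sums =
  fixes p :: "complex poly" and S :: "nat \<Rightarrow> complex" and K \<rho> :: real
  assumes coeff_0: "coeff p 0 = 1"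
    and log_deriv: "fps_deriv (fps_of_poly p) = fps_of_poly p * Abs_fps (\<lambda>n. S (Suc n))"
    and rho: "\<rho> > 0"
    and S_bound: "\<And>n. n > 0 \<Longrightarrow> norm (S n) \<le> K * \<rho> ^ n"
begin

definition log_series :: "complex fps" where
  "log_series = Abs_fps (\<lambda>n. S n / of_nat n)"

lemma deriv_log_series: "fps_deriv log_series = Abs_fps (\<lambda>n. S (Suc n))"
  by (rule fps_ext) (simp add: log_series_def del: of_nat_Suc)

lemma conv_radius_log_series: "fps_conv_radius log_series \<ge> ereal (1 / \<rho>)"
  unfolding fps_conv_radius_def
proof (rule conv_radius_geI_ex)
  fix r :: real assume r: "0 < r" "ereal r < ereal (1 / \<rho>)"
  have "summable (\<lambda>n. fps_nth log_series n * of_real r ^ n)"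
  proof (rule summable_comparison_test)
    show "\<exists>N. \<forall>n\<ge>N. norm (fps_nth log_series n * of_real r ^ n) \<le> K * (\<rho> * r) ^ n"
    proof (intro exI[of _ 1] allI impI)
      fix n :: nat assume n: "n \<ge> 1"
      have "norm (fps_nth log_series n) = norm (S n) / real n" by (simp add: log_series_def norm_divide)
      also have "\<dots> \<le> norm (S n) / 1" using n by (intro divide_left_mono) auto
      also have "\<dots> \<le> K * \<rho> ^ n" using S_bound[of n] n by simp
      finally show "norm (fps_nth log_series n * of_real r ^ n) \<le> K * (\<rho> * r) ^ n"
        using r by (simp add: norm_mult norm_power power_mult_distrib mult_right_mono flip: mult.assoc)
    qed
    have "\<rho> * r < 1" "\<rho> * r > 0" using r rho by (auto simp: field_simps)
    thus "summable (\<lambda>n. K * (\<rho> * r) ^ n)" by (intro summable_mult summable_geometric) auto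
  qed
  thus "\<exists>z. norm z = r \<and> summable (\<lambda>n. fps_nth log_series n * z ^ n)"
    using r by (intro exI[of _ "of_real r"]) auto
qed

text \<open>The quotient of both sides has derivative 0 on the disc. An exponential has no zeros, so
  the growth rate of \<open>S\<close> becomes a zero-free disc for \<open>p\<close>.\<close>

lemma poly_eq_exp:
  assumes "norm u < 1 / \<rho>"
  shows "poly p u = exp (eval_fps log_series u)"
proof -
  define \<phi> where "\<phi> = (\<lambda>z. poly p z * exp (- eval_fps log_series z))"
  have "(\<phi> has_field_derivative 0) (at z within ball 0 (1 / \<rho>))" if z: "z \<in> ball 0 (1 / \<rho>)" for z
  proof -
    have "ereal (norm z) < ereal (1 / \<rho>)" using z by simp
    hence rad: "ereal (norm z) < fps_conv_radius log_series"
      using conv_radius_log_series by (rule less_le_trans)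
    have "poly (pderiv p) z = eval_fps (fps_deriv (fps_of_poly p)) z"
      by (simp add: fps_of_poly_pderiv[symmetric])
    also have "\<dots> = eval_fps (fps_of_poly p * fps_deriv log_series) z"
      by (simp add: log_deriv deriv_log_series)
    also have "\<dots> = poly p z * eval_fps (fps_deriv log_series) z"
      using less_le_trans[OF rad fps_conv_radius_deriv] by (subst eval_fps_mult) auto
    finally have p': "poly (pderiv p) z = poly p z * eval_fps (fps_deriv log_series) z" .
    have "(\<phi> has_field_derivative (poly (pderiv p) z * exp (- eval_fps log_series z) +
       (exp (- eval_fps log_series z) * - eval_fps (fps_deriv log_series) z) * poly p z)) (at z within ball 0 (1 / \<rho>))"
      unfolding \<phi>_def
      by (intro DERIV_mult poly_DERIV[THEN has_field_derivative_at_within]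
          DERIV_chain2[where f = exp] DERIV_exp DERIV_minus has_field_derivative_eval_fps rad)
    thus ?thesis by (simp add: p')
  qed
  then obtain c where c: "\<And>z. z \<in> ball 0 (1 / \<rho>) \<Longrightarrow> \<phi> z = c"
    using has_field_derivative_zero_constant[of "ball 0 (1 / \<rho>)" \<phi>] by auto
  have "c = \<phi> 0" using c[of 0] rho by simp
  also have "\<dots> = 1"
    using coeff_0 by (simp add: \<phi>_def eval_fps_at_0 log_series_def poly_0_coeff_0)
  finally have "poly p u * exp (- eval_fps log_series u) = 1" using c[of u] assms by (simp add: \<phi>_def)
  thus ?thesis by (simp add: exp_minus field_simps)
qed

lemma obtains_inverse_roots:
  obtains B where "p = (\<Prod>\<beta>\<in>#B. [:1, - \<beta>:])" "size B = degree p"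
    "\<And>\<beta>. \<beta> \<in># B \<Longrightarrow> norm \<beta> \<le> \<rho>" "\<And>n. n > 0 \<Longrightarrow> (\<Sum>\<beta>\<in>#B. \<beta> ^ n) = - S n"
proof -
  have p0: "p \<noteq> 0" using coeff_0 by auto
  obtain A where A: "size A = degree p" "p = smult (lead_coeff p) (\<Prod>x\<in>#A. [:-x, 1:])"
    using alg_closed_imp_factorization[OF p0] by blast
  have root: "poly p x = 0" if "x \<in># A" for x
    using that by (subst A(2)) (auto simp: poly_prod_mset)
  have poly0: "poly p 0 = 1" using coeff_0 by (simp add: poly_0_coeff_0)
  have x0: "x \<noteq> 0" if "x \<in># A" for x using root[OF that] poly0 by auto
  have x_ge: "norm x \<ge> 1 / \<rho>" if "x \<in># A" for x
    using poly_eq_exp[of x] root[OF that] by (cases "norm x < 1 / \<rho>") auto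
  define B where "B = image_mset inverse A"
  have prodB: "(\<Prod>x\<in>#A. [:-x, 1:]) = smult (\<Prod>x\<in>#A. - x) (\<Prod>\<beta>\<in>#B. [:1, - \<beta>:])"
    unfolding B_def using x0
  proof (induction A)
    case (add x A)
    have "[:- x, 1:] = smult (- x) [:1, - inverse x:]" using add.prems[of x] by simp
    thus ?case using add
      by (simp only: image_mset_add_mset prod_mset.add_mset mult_smult_left mult_smult_right smult_smult) simp
  qed simp
  have pB: "p = (\<Prod>\<beta>\<in>#B. [:1, - \<beta>:])"
  proof -
    have "p = smult (lead_coeff p * (\<Prod>x\<in>#A. - x)) (\<Prod>\<beta>\<in>#B. [:1, - \<beta>:])"
      by (subst A(2)) (simp add: prodB)
    moreover from arg_cong[OF this, of "\<lambda>p. poly p 0"] have "lead_coeff p * (\<Prod>x\<in>#A. - x) = 1"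
      using poly0 by (simp add: poly_prod_mset)
    ultimately show ?thesis by simp
  qed
  have "Abs_fps (\<lambda>n. S (Suc n)) = - Abs_fps (\<lambda>n. \<Sum>\<beta>\<in>#B. \<beta> ^ Suc n)"
  proof -
    have "fps_of_poly p * Abs_fps (\<lambda>n. S (Suc n)) = fps_of_poly p * (- Abs_fps (\<lambda>n. \<Sum>\<beta>\<in>#B. \<beta> ^ Suc n))"
      using fps_deriv_prod_linear[of B] by (simp add: log_deriv flip: pB)
    moreover have "fps_of_poly p \<noteq> 0" using p0 by simp
    ultimately show ?thesis by (simp only: mult_cancel_left) simp
  qed
  hence sum: "S (Suc n) = - (\<Sum>\<beta>\<in>#B. \<beta> ^ Suc n)" for n
    by (metis (no_types, lifting) fps_nth_Abs_fps fps_neg_nth)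
  show thesis
  proof (rule that[OF pB])
    show "size B = degree p" by (simp add: B_def A(1))
    show "norm \<beta> \<le> \<rho>" if "\<beta> \<in># B" for \<beta>
    proof -
      from that obtain x where x: "x \<in># A" "\<beta> = inverse x" by (auto simp: B_def)
      show ?thesis using x_ge[OF x(1)] x0[OF x(1)] rho by (simp add: x(2) norm_inverse norm_divide field_simps)
    qed
    show "(\<Sum>\<beta>\<in>#B. \<beta> ^ n) = - S n" if "n > 0" for n
      using sum[of "n - 1"] that by simp
  qed
qed

text \<open>The majorant is applied to \<open>z = \<beta> * u\<close> for every inverse root and the
  results are added; the coefficients lie between 0 and 1, so the power sums enter with weight at
  most 1.\<close>

lemma norm_poly_le:
  assumes u: "norm u \<le> 1 / \<rho>" and M: "M > 0"
  shows "norm (poly p u) \<le> exp (real (degree p) * ln 2 / real M + (\<Sum>n=1..<M. norm (S n) * norm u ^ n))"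
proof -
  obtain B where B: "p = (\<Prod>\<beta>\<in>#B. [:1, - \<beta>:])" "size B = degree p"
    "\<And>\<beta>. \<beta> \<in># B \<Longrightarrow> norm \<beta> \<le> \<rho>" "\<And>n. n > 0 \<Longrightarrow> (\<Sum>\<beta>\<in>#B. \<beta> ^ n) = - S n"
    using obtains_inverse_roots by blast
  define C where "C = majorant_coeff M"
  have "poly p u = (\<Prod>\<beta>\<in>#B. 1 - \<beta> * u)"
    by (subst B(1)) (simp add: poly_prod_mset mult.commute)
  also have "norm \<dots> \<le> exp (real (size B) * ln 2 / real M - (\<Sum>n=1..<M. C n * Re (u ^ n * (\<Sum>\<beta>\<in>#B. \<beta> ^ n))))"
    using B(3)
  proof (induction B)
    case (add \<beta> B)
    have "norm (\<beta> * u) \<le> \<rho> * (1 / \<rho>)"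
      unfolding norm_mult using add.prems[of \<beta>] u rho by (intro mult_mono) auto
    hence le1: "norm (\<beta> * u) \<le> 1" using rho by simp
    have "norm (1 - \<beta> * u) \<le> exp (ln 2 / real M - (\<Sum>n=1..<M. C n * Re (u ^ n * \<beta> ^ n)))"
      using norm_one_minus_le[OF le1 M]
      by (simp add: C_def exp_diff exp_minus powr_def power_mult_distrib divide_inverse mult.commute)
    moreover have "norm (\<Prod>\<beta>\<in>#B. 1 - \<beta> * u) \<le>
        exp (real (size B) * ln 2 / real M - (\<Sum>n=1..<M. C n * Re (u ^ n * (\<Sum>\<beta>\<in>#B. \<beta> ^ n))))"
      using add by auto
    ultimately have "norm (1 - \<beta> * u) * norm (\<Prod>\<beta>\<in>#B. 1 - \<beta> * u) \<le>
        exp (ln 2 / real M - (\<Sum>n=1..<M. C n * Re (u ^ n * \<beta> ^ n))) *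
        exp (real (size B) * ln 2 / real M - (\<Sum>n=1..<M. C n * Re (u ^ n * (\<Sum>\<beta>\<in>#B. \<beta> ^ n))))"
      by (intro mult_mono) auto
    also have "\<dots> = exp (real (size (add_mset \<beta> B)) * ln 2 / real M -
        (\<Sum>n=1..<M. C n * Re (u ^ n * (\<Sum>\<beta>\<in>#add_mset \<beta> B. \<beta> ^ n))))"
      unfolding exp_add[symmetric]
      by (simp add: distrib_left sum.distrib add_divide_distrib distrib_right)
    finally show ?case by (simp add: norm_mult)
  qed simp
  also have "\<dots> \<le> exp (real (degree p) * ln 2 / real M + (\<Sum>n=1..<M. norm (S n) * norm u ^ n))"
  proof -
    have "- (C n * Re (u ^ n * (\<Sum>\<beta>\<in>#B. \<beta> ^ n))) \<le> norm (S n) * norm u ^ n" if n: "n \<in> {1..<M}" for n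
    proof -
      have C: "0 \<le> C n" "C n \<le> 1" using majorant_coeff_bounds[of n M] n by (auto simp: C_def)
      have "- (C n * Re (u ^ n * (\<Sum>\<beta>\<in>#B. \<beta> ^ n))) = C n * Re (u ^ n * S n)"
      proof -
        have "(\<Sum>\<beta>\<in>#B. \<beta> ^ n) = - S n" using B(4)[of n] n by simp
        thus ?thesis by (simp only: mult_minus_right uminus_complex.sel minus_minus)
      qed
      also have "\<dots> \<le> C n * norm (u ^ n * S n)" using C by (intro mult_left_mono complex_Re_le_cmod)
      also have "\<dots> \<le> 1 * norm (u ^ n * S n)" using C by (intro mult_right_mono) auto
      finally show ?thesis by (simp add: norm_mult norm_power mult.commute)
    qed
    hence "- (\<Sum>n=1..<M. C n * Re (u ^ n * (\<Sum>\<beta>\<in>#B. \<beta> ^ n))) \<le> (\<Sum>n=1..<M. norm (S n) * norm u ^ n)"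
      unfolding sum_negf[symmetric] by (intro sum_mono) auto
    thus ?thesis by (simp add: B(2))
  qed
  finally show ?thesis .
qed

end

subsection \<open>The Euler product\<close>

context power_residue_character
begin

definition chi_infty :: complex where "chi_infty = (if l dvd m then 1 else 0)"

definition place_sum :: "nat \<Rightarrow> complex" where
  "place_sum n = prime_sum xi n + chi_infty ^ n"

text \<open>If infinity is unramified, its Euler factor \<open>1 / (1 - u)\<close> replaces the
  coefficients by their partial sums.\<close>

definition L_coeff :: "nat \<Rightarrow> complex" where
  "L_coeff n = (if l dvd m then \<Sum>k\<le>n. monic_sum xi k else monic_sum xi n)"

definition L_poly :: "complex poly" where
  "L_poly = (\<Sum>i<m. monom (L_coeff i) i)"

lemma L_coeff_eq_0:
  assumes "n \<ge> m"
  shows "L_coeff n = 0"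
proof (cases "l dvd m")
  case True
  have "(\<Sum>k\<le>n. monic_sum xi k) = (\<Sum>k<m. monic_sum xi k)"
    using assms by (intro sum.mono_neutral_right) (auto simp: monic_sum_def sum_xi_monics_eq_0)
  thus ?thesis using sum_xi_all_monics_eq_0[OF True] True by (simp add: L_coeff_def monic_sum_def)
qed (use assms in \<open>simp add: L_coeff_def monic_sum_def sum_xi_monics_eq_0\<close>)

lemma coeff_L_poly: "coeff L_poly n = L_coeff n"
  using L_coeff_eq_0[of n] by (simp add: L_poly_def coeff_sum)

lemma degree_L_poly: "degree L_poly \<le> m"
  by (rule degree_le) (simp add: coeff_L_poly L_coeff_eq_0)

lemma monic_sum_xi_0: "monic_sum xi 0 = 1"
  by (simp add: monic_sum_def monics_0 xi_1)

lemma log_deriv_monic_sum: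
  "fps_deriv (Abs_fps (monic_sum xi)) = Abs_fps (monic_sum xi) * Abs_fps (\<lambda>n. prime_sum xi (Suc n))"
proof (rule fps_ext)
  fix n
  have "fps_nth (fps_deriv (Abs_fps (monic_sum xi))) n = of_nat (Suc n) * monic_sum xi (Suc n)"
    by (simp del: of_nat_Suc)
  also have "\<dots> = (\<Sum>k=1..Suc n. prime_sum xi k * monic_sum xi (Suc n - k))"
    by (rule von_mangoldt_identity) (auto simp: xi_1 xi_mult)
  also have "\<dots> = (\<Sum>i=0..n. monic_sum xi i * prime_sum xi (Suc (n - i)))"
    by (rule sum.reindex_bij_witness[of _ "\<lambda>i. Suc n - i" "\<lambda>k. Suc n - k"]) (auto simp: Suc_diff_le mult.commute)
  finally show "fps_nth (fps_deriv (Abs_fps (monic_sum xi))) n =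
     fps_nth (Abs_fps (monic_sum xi) * Abs_fps (\<lambda>n. prime_sum xi (Suc n))) n"
    by (simp add: fps_mult_nth)
qed

text \<open>The factor \<open>1 / (1 - u)\<close> is its own logarithmic derivative
  (\<open>G' = G * G\<close>), so infinity adds 1 to every power sum.\<close>

lemma log_deriv_L_poly:
  "fps_deriv (fps_of_poly L_poly) = fps_of_poly L_poly * Abs_fps (\<lambda>n. place_sum (Suc n))"
proof (cases "l dvd m")
  case False
  hence "fps_of_poly L_poly = Abs_fps (monic_sum xi)"
    by (intro fps_ext) (simp add: coeff_L_poly L_coeff_def)
  moreover have "place_sum (Suc n) = prime_sum xi (Suc n)" for n
    using False by (simp add: place_sum_def chi_infty_def)
  ultimately show ?thesis using log_deriv_monic_sum by simp
next
  case True
  define G :: "complex fps" where "G = Abs_fps (\<lambda>_. 1)"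
  let ?A = "Abs_fps (monic_sum xi)"
  let ?S = "Abs_fps (\<lambda>n. prime_sum xi (Suc n))"
  have L: "fps_of_poly L_poly = ?A * G"
    using True by (intro fps_ext) (simp add: coeff_L_poly L_coeff_def G_def fps_mult_nth atMost_atLeast0)
  have G': "fps_deriv G = G * G"
    by (rule fps_ext) (simp add: G_def fps_mult_nth)
  have "fps_deriv (?A * G) = ?A * ?S * G + ?A * (G * G)"
    by (simp add: log_deriv_monic_sum G')
  also have "\<dots> = (?A * G) * (?S + G)" by (simp add: algebra_simps)
  also have "?S + G = Abs_fps (\<lambda>n. place_sum (Suc n))"
    using True by (intro fps_ext) (simp add: G_def place_sum_def chi_infty_def)
  finally show ?thesis by (simp only: L)
qed

lemma norm_chi_infty: "norm chi_infty \<le> 1"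
  by (simp add: chi_infty_def)

lemma norm_place_sum_le:
  assumes "n > 0"
  shows "norm (place_sum n) \<le> real CARD('a) ^ n + 1"
  unfolding place_sum_def
  using norm_triangle_ineq[of "prime_sum xi n" "chi_infty ^ n"] norm_prime_sum_le[OF assms]
    power_le_one[OF norm_ge_zero norm_chi_infty, of n] by (simp add: norm_power)

lemma bounded_power_sums_L_poly:
  obtains K where "bounded_power_sums L_poly place_sum K (sqrt (real CARD('a)))"
proof -
  obtain K where K: "K \<ge> 0" "\<And>n. n > 0 \<Longrightarrow> norm (prime_sum xi n) \<le> K * sqrt (real CARD('a)) ^ n"
    using prime_sum_bound by blast
  have "bounded_power_sums L_poly place_sum (K + 1) (sqrt (real CARD('a)))"
  proof
    show "coeff L_poly 0 = 1" by (simp add: coeff_L_poly L_coeff_def monic_sum_xi_0)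
    show "sqrt (real CARD('a)) > 0" using q_gt_1 by simp
    fix n :: nat assume n: "n > 0"
    have "norm (place_sum n) \<le> norm (prime_sum xi n) + norm (chi_infty ^ n)"
      unfolding place_sum_def by (rule norm_triangle_ineq)
    also have "\<dots> \<le> K * sqrt (real CARD('a)) ^ n + 1"
      using K(2)[OF n] power_le_one[OF norm_ge_zero norm_chi_infty, of n] by (simp add: norm_power)
    also have "1 \<le> sqrt (real CARD('a)) ^ n" using q_gt_1 by (intro one_le_power) simp
    finally show "norm (place_sum n) \<le> (K + 1) * sqrt (real CARD('a)) ^ n" by (simp add: distrib_right)
  qed (rule log_deriv_L_poly)
  thus thesis by (rule that)
qed

abbreviation "\<psi> \<equiv> chi l \<iota> f"

lemma chi_Infty: "\<psi> Infty = chi_infty" by (simp add: chi_infty_def)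

lemma norm_chi_le: "v \<in> places \<Longrightarrow> norm (\<psi> v) \<le> 1"
  unfolding places_def using norm_chi_infty chi_Infty chi_eq_xi xi_norm_le
  by (auto simp del: chi.simps)

lemma place_degree_pos: "v \<in> places \<Longrightarrow> place_degree v > 0"
  using monic_irreducibleD(5) by (auto simp: places_def)

definition places_dvd :: "nat \<Rightarrow> 'a poly place set" where
  "places_dvd n = {v\<in>places. place_degree v dvd n}"

lemma places_dvd_eq: "places_dvd n = insert Infty (Fin ` irr_dvd n)"
  by (auto simp: places_dvd_def places_def irr_dvd_def)

lemma finite_places_dvd: "n > 0 \<Longrightarrow> finite (places_dvd n)"
  by (simp add: places_dvd_eq)

lemma sum_places_dvd:
  assumes "n > 0"
  shows "(\<Sum>v\<in>places_dvd n. h v) = h Infty + (\<Sum>P\<in>irr_dvd n. h (Fin P))"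
  using assms unfolding places_dvd_eq by (subst sum.insert) (auto simp: sum.reindex inj_on_def)

lemma sum_degree_places_dvd:
  assumes "n > 0"
  shows "(\<Sum>v\<in>places_dvd n. real (place_degree v)) = real CARD('a) ^ n + 1"
  using sum_degree_irr_dvd[OF assms, where 'a = 'a] assms
  by (simp add: sum_places_dvd flip: of_nat_sum of_nat_power)

lemma place_sum_eq:
  assumes "n > 0"
  shows "place_sum n = (\<Sum>v\<in>places_dvd n. of_nat (place_degree v) * \<psi> v ^ (n div place_degree v))"
proof -
  have "(\<Sum>P\<in>irr_dvd n. of_nat (degree P) * \<psi> (Fin P) ^ (n div degree P)) = prime_sum xi n"
    unfolding prime_sum_def by (intro sum.cong) (auto simp: irr_dvd_def chi_eq_xi simp del: chi.simps)
  thus ?thesis using assms by (simp add: sum_places_dvd place_sum_def chi_infty_def del: chi.simps(1))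
qed

lemma log_euler_factor_has_sum:
  fixes z :: complex
  assumes "norm z < 1"
  shows "((\<lambda>k. z ^ k / of_nat k) has_sum (- Ln (1 - z))) {1..}"
proof -
  have "(\<lambda>n. - ((- (- z)) ^ n) / of_nat n) sums ln (1 + - z)" using assms by (intro Ln_series') simp
  from sums_minus[OF this] have sums: "(\<lambda>n. z ^ n / of_nat n) sums (- Ln (1 - z))" by simp
  have "summable (\<lambda>n. norm (z ^ n / of_nat n))"
  proof (rule summable_comparison_test)
    show "\<exists>N. \<forall>n\<ge>N. norm (norm (z ^ n / of_nat n)) \<le> norm z ^ n"
      by (intro exI[of _ 1]) (auto simp: norm_divide norm_power divide_le_eq mult_le_cancel_left1)
    show "summable (\<lambda>n. norm z ^ n)" using assms by (intro summable_geometric) simp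
  qed
  from norm_summable_imp_has_sum[OF this sums]
  have "((\<lambda>k. z ^ k / of_nat k) has_sum (- Ln (1 - z))) UNIV" .
  \<comment> \<open>The term at \<open>k = 0\<close> is a division by 0, hence 0.\<close>
  thus ?thesis by (subst (asm) has_sum_cong_neutral[of "{1..}" UNIV _ "\<lambda>k. z ^ k / of_nat k"])
      (auto simp: not_le)
qed

text \<open>The double series over pairs \<open>(v, k)\<close> is regrouped by
  \<open>n = k * place_degree v\<close>. Absolute convergence is required since the Euler product is
  unordered; it follows from \<open>norm u < 1 / q\<close>, as the places in
  \<open>places_dvd n\<close> have total degree \<open>q ^ n + 1\<close>.\<close>

lemma log_euler_product_has_sum:
  assumes bps: "bounded_power_sums L_poly place_sum K (sqrt (real CARD('a)))"
    and u: "norm u < 1 / real CARD('a)"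
  shows "((\<lambda>v. - Ln (1 - \<psi> v * u ^ place_degree v)) has_sum
           eval_fps (bounded_power_sums.log_series place_sum) u) places"
proof -
  interpret bounded_power_sums L_poly place_sum K "sqrt (real CARD('a))" by fact
  let ?Q = "real CARD('a)"
  have Q: "?Q > 1" using q_gt_1 by simp
  have Qu: "?Q * norm u < 1" using u Q by (simp add: field_simps)
  have u1: "norm u < 1"
  proof -
    have "1 * norm u \<le> ?Q * norm u" using Q by (intro mult_right_mono) auto
    with Qu show ?thesis by simp
  qed
  have summ: "summable (\<lambda>n. norm u ^ n * (?Q ^ n + 1))"
  proof -
    have "summable (\<lambda>n. (?Q * norm u) ^ n + norm u ^ n)"
      using Qu u1 Q by (intro summable_add summable_geometric) (auto simp: abs_mult)
    thus ?thesis by (simp add: power_mult_distrib distrib_left mult.commute)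
  qed
  define g where "g = (\<lambda>(n, v). u ^ n * (of_nat (place_degree v) * \<psi> v ^ (n div place_degree v)) / of_nat n)"
  have "(\<lambda>(n, v). norm u ^ n * real (place_degree v)) summable_on Sigma {1..} places_dvd"
  proof (rule summable_on_SigmaI)
    fix n :: nat assume n: "n \<in> {1..}"
    show "((\<lambda>v. case (n, v) of (n, v) \<Rightarrow> norm u ^ n * real (place_degree v)) has_sum (norm u ^ n * (?Q ^ n + 1))) (places_dvd n)"
      using n by (subst has_sum_finite_iff) (auto simp: finite_places_dvd sum_degree_places_dvd simp flip: sum_distrib_left)
  next
    have "(\<lambda>n. norm u ^ n * (?Q ^ n + 1)) summable_on UNIV"
      using Q by (subst summable_on_UNIV_nonneg_real_iff) (auto intro: summ)
    thus "(\<lambda>n. norm u ^ n * (?Q ^ n + 1)) summable_on {1..}"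
      by (rule summable_on_subset_banach) simp
  qed auto
  hence "(\<lambda>x. norm (g x)) summable_on Sigma {1..} places_dvd"
  proof (rule Infinite_Sum.abs_summable_on_comparison_test')
    fix x assume x: "x \<in> Sigma {1..} places_dvd"
    obtain n v where nv: "x = (n, v)" by (cases x)
    have v: "v \<in> places" "n \<ge> 1" using x by (auto simp: nv places_dvd_def)
    have "norm (g x) = norm u ^ n * real (place_degree v) * (norm (\<psi> v) ^ (n div place_degree v) / real n)"
      by (simp add: g_def nv norm_mult norm_power norm_divide)
    also have "\<dots> \<le> norm u ^ n * real (place_degree v) * 1"
    proof (intro mult_left_mono)
      have "norm (\<psi> v) ^ (n div place_degree v) \<le> 1" by (intro power_le_one norm_chi_le v) simp
      thus "norm (\<psi> v) ^ (n div place_degree v) / real n \<le> 1" using v by (simp add: divide_le_eq)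
    qed auto
    finally show "norm (g x) \<le> (case x of (n, v) \<Rightarrow> norm u ^ n * real (place_degree v))"
      by (simp add: nv)
  qed
  hence g_summable: "g summable_on Sigma {1..} places_dvd" by (rule abs_summable_summable)
  have g_has_sum: "(g has_sum eval_fps log_series u) (Sigma {1..} places_dvd)"
  proof (rule has_sum_SigmaI[OF _ _ g_summable])
    fix n :: nat assume n: "n \<in> {1..}"
    show "((\<lambda>v. g (n, v)) has_sum (fps_nth log_series n * u ^ n)) (places_dvd n)"
      using n by (subst has_sum_finite_iff)
        (auto simp: finite_places_dvd log_series_def place_sum_eq g_def sum_distrib_left sum_divide_distrib mult_ac simp del: chi.simps)
  next
    have "summable (\<lambda>n. norm (fps_nth log_series n * u ^ n))"
    proof (rule summable_comparison_test[OF _ summ], intro exI[of _ 1] allI impI)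
      fix n :: nat assume n: "n \<ge> 1"
      have "norm (fps_nth log_series n) = norm (place_sum n) / real n" by (simp add: log_series_def norm_divide)
      also have "\<dots> \<le> norm (place_sum n) / 1" using n by (intro divide_left_mono) auto
      also have "\<dots> \<le> ?Q ^ n + 1" using norm_place_sum_le[of n] n by simp
      finally show "norm (norm (fps_nth log_series n * u ^ n)) \<le> norm u ^ n * (?Q ^ n + 1)"
        by (simp add: norm_mult norm_power mult.commute mult_left_mono)
    qed
    moreover have "(\<lambda>n. fps_nth log_series n * u ^ n) sums eval_fps log_series u"
    proof (rule sums_eval_fps)
      have "sqrt ?Q \<le> ?Q" using Q by (intro real_le_lsqrt) (auto simp: power2_eq_square)
      hence "1 / ?Q \<le> 1 / sqrt ?Q" using Q by (intro divide_left_mono) auto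
      hence "ereal (norm u) < ereal (1 / sqrt ?Q)" using u by simp
      thus "ereal (norm u) < fps_conv_radius log_series" using conv_radius_log_series by (rule less_le_trans)
    qed
    ultimately have "((\<lambda>n. fps_nth log_series n * u ^ n) has_sum eval_fps log_series u) UNIV"
      by (rule norm_summable_imp_has_sum)
    thus "((\<lambda>n. fps_nth log_series n * u ^ n) has_sum eval_fps log_series u) {1..}"
      by (subst (asm) has_sum_cong_neutral[of "{1..}" UNIV _ "\<lambda>n. fps_nth log_series n * u ^ n"])
         (auto simp: not_le log_series_def)
  qed
  have "((\<lambda>(v, k). (\<psi> v * u ^ place_degree v) ^ k / of_nat k) has_sum eval_fps log_series u)
      (Sigma places (\<lambda>_. {1..}))"
  proof (subst has_sum_reindex_bij_witness[where
      i = "\<lambda>(n, v). (v, n div place_degree v)" and j = "\<lambda>(v, k). (k * place_degree v, v)" and h = g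
      and T = "Sigma {1..} places_dvd" and s' = "eval_fps log_series u"])
    fix x :: "'a poly place \<times> nat" assume x: "x \<in> Sigma places (\<lambda>_. {1 :: nat..})"
    obtain v k where vk: "x = (v, k)" by (cases x)
    have v: "v \<in> places" "k \<ge> 1" using x by (auto simp: vk)
    note d = place_degree_pos[OF v(1)]
    show "(case case x of (v, k) \<Rightarrow> (k * place_degree v, v) of (n, v) \<Rightarrow> (v, n div place_degree v)) = x"
      using d by (simp add: vk)
    show "(case x of (v, k) \<Rightarrow> (k * place_degree v, v)) \<in> Sigma {1..} places_dvd"
      using d v by (auto simp: vk places_dvd_def Suc_le_eq)
    show "g (case x of (v, k) \<Rightarrow> (k * place_degree v, v)) = (case x of (v, k) \<Rightarrow> (\<psi> v * u ^ place_degree v) ^ k / of_nat k)"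
      using d v by (simp add: vk g_def power_mult_distrib mult.commute flip: power_mult)
  next
    fix x :: "nat \<times> 'a poly place" assume x: "x \<in> Sigma {1..} places_dvd"
    obtain n v where nv: "x = (n, v)" by (cases x)
    have v: "v \<in> places" "n \<ge> 1" "place_degree v dvd n" using x by (auto simp: nv places_dvd_def)
    note d = place_degree_pos[OF v(1)]
    show "(case case x of (n, v) \<Rightarrow> (v, n div place_degree v) of (v, k) \<Rightarrow> (k * place_degree v, v)) = x"
      using v by (simp add: nv)
    show "(case x of (n, v) \<Rightarrow> (v, n div place_degree v)) \<in> Sigma places (\<lambda>_. {1..})"
      using d v by (auto simp: nv Suc_le_eq div_greater_zero_iff intro: dvd_imp_le)
  qed (rule refl g_has_sum)+
  thus ?thesis
  proof (rule has_sum_SigmaD)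
    fix v :: "'a poly place" assume v: "v \<in> places"
    have "norm (\<psi> v * u ^ place_degree v) \<le> 1 * norm u ^ place_degree v"
      unfolding norm_mult norm_power using norm_chi_le[OF v] by (intro mult_right_mono) auto
    also have "norm u ^ place_degree v \<le> norm u ^ 1"
      using place_degree_pos[OF v] u1 by (intro power_decreasing) auto
    finally have "norm (\<psi> v * u ^ place_degree v) < 1" using u1 by simp
    from log_euler_factor_has_sum[OF this]
    show "((\<lambda>k. case (v, k) of (v, k) \<Rightarrow> (\<psi> v * u ^ place_degree v) ^ k / of_nat k) has_sum
        (- Ln (1 - \<psi> v * u ^ place_degree v))) {1..}" by simp
  qed
qed

lemma norm_q_powr: "norm (of_nat CARD('a) powr (- s) :: complex) = real CARD('a) powr (- Re s)"
  by (subst norm_powr_real_powr) auto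

lemma euler_product_tendsto:
  assumes s: "Re s > 1"
  shows "((\<lambda>S. \<Prod>v\<in>S. euler_factor \<psi> s v) \<longlongrightarrow> poly L_poly (of_nat CARD('a) powr (- s)))
           (finite_subsets_at_top places)"
proof -
  obtain K where bps: "bounded_power_sums L_poly place_sum K (sqrt (real CARD('a)))"
    using bounded_power_sums_L_poly .
  interpret bounded_power_sums L_poly place_sum K "sqrt (real CARD('a))" by fact
  define u where "u = (of_nat CARD('a) powr (- s) :: complex)"
  have Q: "real CARD('a) > 1" using q_gt_1 by simp
  have u: "norm u < 1 / real CARD('a)"
  proof -
    have "norm u = real CARD('a) powr (- Re s)" unfolding u_def by (rule norm_q_powr)
    also have "\<dots> < real CARD('a) powr (- 1)" using Q s by (intro powr_less_mono) auto
    also have "\<dots> = 1 / real CARD('a)" using Q by (simp add: powr_minus divide_inverse)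
    finally show ?thesis .
  qed
  have "1 / real CARD('a) < 1" using Q by simp
  with u have u1: "norm u < 1" by linarith
  have "1 / real CARD('a) \<le> 1 / sqrt (real CARD('a))"
    using Q by (intro divide_left_mono real_le_lsqrt) (auto simp: power2_eq_square)
  with u have u2: "norm u < 1 / sqrt (real CARD('a))" by simp
  have upow: "of_nat CARD('a) powr (- s * of_nat n) = u ^ n" for n
    using Q by (simp add: u_def powr_def exp_of_nat_mult[symmetric] mult_ac)
  have factor: "exp (- Ln (1 - \<psi> v * u ^ place_degree v)) = euler_factor \<psi> s v" if v: "v \<in> places" for v
  proof -
    have "norm (\<psi> v * u ^ place_degree v) \<le> 1 * norm u ^ place_degree v"
      unfolding norm_mult norm_power using norm_chi_le[OF v] by (intro mult_right_mono) auto
    also have "norm u ^ place_degree v \<le> norm u ^ 1"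
      using place_degree_pos[OF v] u1 by (intro power_decreasing) auto
    finally have "norm (\<psi> v * u ^ place_degree v) < 1" using u1 by simp
    hence "1 - \<psi> v * u ^ place_degree v \<noteq> 0" by auto
    thus ?thesis unfolding euler_factor_def upow by (simp add: exp_minus del: chi.simps)
  qed
  have "((\<lambda>S. \<Sum>v\<in>S. - Ln (1 - \<psi> v * u ^ place_degree v)) \<longlongrightarrow> eval_fps log_series u) (finite_subsets_at_top places)"
    using log_euler_product_has_sum[OF bps u] by (simp add: has_sum_def)
  hence "((\<lambda>S. exp (\<Sum>v\<in>S. - Ln (1 - \<psi> v * u ^ place_degree v))) \<longlongrightarrow> exp (eval_fps log_series u)) (finite_subsets_at_top places)"
    by (rule tendsto_exp)
  also have "exp (eval_fps log_series u) = poly L_poly u" by (rule poly_eq_exp[OF u2, symmetric])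
  finally have *: "((\<lambda>S. exp (\<Sum>v\<in>S. - Ln (1 - \<psi> v * u ^ place_degree v))) \<longlongrightarrow> poly L_poly u) (finite_subsets_at_top places)" .
  show ?thesis unfolding u_def[symmetric]
  proof (rule Lim_transform_eventually[OF *])
    show "\<forall>\<^sub>F S in finite_subsets_at_top places.
        exp (\<Sum>v\<in>S. - Ln (1 - \<psi> v * u ^ place_degree v)) = (\<Prod>v\<in>S. euler_factor \<psi> s v)"
      by (rule eventually_finite_subsets_at_top_weakI)
         (auto simp: exp_sum factor subset_iff intro!: prod.cong simp del: chi.simps)
  qed
qed

text \<open>A polynomial in \<open>q powr - s\<close> is entire, and by the identity theorem the
  Euler product on the half-plane determines the entire function.\<close>

lemma L_function_eq: "L_function \<psi> = (\<lambda>s. poly L_poly (of_nat CARD('a) powr (- s)))"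
  unfolding L_function_def
proof (rule the_equality)
  have q0: "(of_nat CARD('a) :: complex) \<noteq> 0" by simp
  let ?f = "\<lambda>s. poly L_poly (of_nat CARD('a) powr (- s))"
  have holo: "?f holomorphic_on UNIV"
    unfolding powr_def using q0 by (auto intro!: holomorphic_intros)
  show ex: "?f holomorphic_on UNIV \<and> (\<forall>s. 1 < Re s \<longrightarrow>
      ((\<lambda>S. \<Prod>v\<in>S. euler_factor \<psi> s v) \<longlongrightarrow> ?f s) (finite_subsets_at_top places))"
    using holo euler_product_tendsto by blast
  fix g assume g: "g holomorphic_on UNIV \<and> (\<forall>s. 1 < Re s \<longrightarrow>
      ((\<lambda>S. \<Prod>v\<in>S. euler_factor \<psi> s v) \<longlongrightarrow> g s) (finite_subsets_at_top places))"
  have eq: "g s = ?f s" if "Re s > 1" for s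
    using g ex that by (blast intro: tendsto_unique[OF finite_subsets_at_top_neq_bot])
  show "g = ?f"
  proof
    fix s
    have "g s - ?f s = 0"
    proof (rule analytic_continuation[of "\<lambda>s. g s - ?f s" UNIV "{s. Re s > 1}" 2])
      show "(\<lambda>s. g s - ?f s) holomorphic_on UNIV" using g holo by (intro holomorphic_on_diff) auto
      show "2 islimpt {s. 1 < Re s}"
        by (rule open_imp_islimpt) (auto simp: open_halfspace_Re_gt)
    qed (use eq in auto)
    thus "g s = ?f s" by simp
  qed
qed

end

section \<open>The bound for a single \<open>L\<close>-function\<close>

context power_residue_character
begin

text \<open>For \<open>Re s \<ge> 1 / 2\<close> the trivial estimate \<open>2 * q ^ n\<close> times
  \<open>norm u ^ n\<close> is at most \<open>2 * sqrt q ^ n\<close>. No constant depends on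
  \<open>l\<close>, on the place or on \<open>s\<close>, which gives the uniformity of the
  theorem.\<close>

lemma norm_L_function_le:
  assumes s: "Re s \<ge> 1 / 2" and M: "M > 0"
  shows "norm (L_function \<psi> s) \<le>
           exp (real m * ln 2 / real M + 2 * real M * sqrt (real CARD('a)) ^ M)"
proof -
  obtain K where bps: "bounded_power_sums L_poly place_sum K (sqrt (real CARD('a)))"
    using bounded_power_sums_L_poly .
  let ?r = "sqrt (real CARD('a))"
  define u where "u = (of_nat CARD('a) powr (- s) :: complex)"
  have Q: "real CARD('a) > 1" using q_gt_1 by simp
  have r1: "?r > 1" using Q by simp
  have u: "norm u \<le> 1 / ?r"
  proof -
    have "norm u = real CARD('a) powr (- Re s)" unfolding u_def by (rule norm_q_powr)
    also have "\<dots> \<le> real CARD('a) powr (- (1 / 2))" using Q s by (intro powr_mono) auto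
    also have "\<dots> = 1 / ?r" using Q unfolding powr_minus by (simp only: powr_half_sqrt inverse_eq_divide)
    finally show ?thesis .
  qed
  have term_le: "norm (place_sum n) * norm u ^ n \<le> 2 * ?r ^ M" if n: "n \<in> {1..<M}" for n
  proof -
    have "norm (place_sum n) \<le> real CARD('a) ^ n + 1" using norm_place_sum_le[of n] n by simp
    also have "\<dots> \<le> 2 * real CARD('a) ^ n" using one_le_power[of "real CARD('a)" n] Q by simp
    also have "real CARD('a) ^ n = ?r ^ n * ?r ^ n"
      unfolding power_mult_distrib[symmetric] by simp
    finally have "norm (place_sum n) * norm u ^ n \<le> (2 * (?r ^ n * ?r ^ n)) * (1 / ?r) ^ n"
      using u by (intro mult_mono power_mono) auto
    also have "\<dots> = 2 * ?r ^ n" using r1 by (simp add: power_divide)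
    also have "\<dots> \<le> 2 * ?r ^ M" using r1 n by (intro mult_left_mono power_increasing) auto
    finally show ?thesis .
  qed
  have "(\<Sum>n=1..<M. norm (place_sum n) * norm u ^ n) \<le> (\<Sum>n=1..<M. 2 * ?r ^ M)"
    by (intro sum_mono term_le)
  also have "\<dots> = real (M - 1) * (2 * ?r ^ M)" by simp
  also have "\<dots> \<le> real M * (2 * ?r ^ M)" using r1 by (intro mult_right_mono) auto
  finally have sum_le: "(\<Sum>n=1..<M. norm (place_sum n) * norm u ^ n) \<le> 2 * real M * ?r ^ M" by (simp add: mult_ac)
  have "real (degree L_poly) * ln 2 / real M \<le> real m * ln 2 / real M"
    using degree_L_poly by (intro divide_right_mono mult_right_mono) auto
  with sum_le have "exp (real (degree L_poly) * ln 2 / real M + (\<Sum>n=1..<M. norm (place_sum n) * norm u ^ n))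
      \<le> exp (real m * ln 2 / real M + 2 * real M * ?r ^ M)" by simp
  with bounded_power_sums.norm_poly_le[OF bps u M]
  show ?thesis unfolding L_function_eq u_def[symmetric] by linarith
qed

subsection \<open>The conductor\<close>

lemma char_poly_ext_monic:
  assumes "lead_coeff A = 1"
  shows "char_poly_ext \<psi> A = xi A"
  using assms
proof (induction A rule: monic_induct)
  case one
  have "{P :: 'a poly. monic_irreducible P \<and> P dvd 1} = {}" using monic_irreducibleD(6) by auto
  thus ?case unfolding char_poly_ext_def by (simp only: prod.empty xi_1)
next
  case (mult R B)
  let ?D = "{P. monic_irreducible P \<and> P dvd R * B}"
  have B0: "B \<noteq> 0" using mult by auto
  have R0: "R \<noteq> 0" using mult monic_irreducibleD(4) by auto
  have fin: "finite ?D" using B0 R0 by simp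
  have R: "R \<in> ?D" using mult by auto
  have "char_poly_ext \<psi> (R * B) = (\<Prod>P\<in>?D. \<psi> (Fin P) ^ val P (R * B))"
    by (simp add: char_poly_ext_def val_def del: chi.simps)
  also have "\<dots> = (\<Prod>P\<in>?D. \<psi> (Fin P) ^ val P B * (if P = R then \<psi> (Fin R) else 1))"
    using mult B0 by (intro prod.cong) (auto simp: val_mult_same val_mult_other simp del: chi.simps)
  also have "\<dots> = (\<Prod>P\<in>?D. \<psi> (Fin P) ^ val P B) * \<psi> (Fin R)"
    using fin R by (simp add: prod.distrib del: chi.simps)
  also have "(\<Prod>P\<in>?D. \<psi> (Fin P) ^ val P B) = (\<Prod>P | monic_irreducible P \<and> P dvd B. \<psi> (Fin P) ^ val P B)"
  proof (rule prod.mono_neutral_right[OF fin])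
    show "\<forall>P\<in>?D - {P. monic_irreducible P \<and> P dvd B}. \<psi> (Fin P) ^ val P B = 1"
    proof
      fix P assume P: "P \<in> ?D - {P. monic_irreducible P \<and> P dvd B}"
      hence "val P B = 0" using val_pos_iff[of P B] B0 by auto
      thus "\<psi> (Fin P) ^ val P B = 1" by simp
    qed
  qed auto
  also have "\<dots> = char_poly_ext \<psi> B" by (simp add: char_poly_ext_def val_def del: chi.simps)
  finally show ?case using mult by (simp add: xi_mult chi_eq_xi mult.commute del: chi.simps)
qed

text \<open>\<open>char_poly_ext\<close> sees only divisibility and ignores constant factors,
  whereas \<open>xi\<close> need not; hence the normalisation.\<close>

lemma char_poly_ext_eq:
  assumes "A \<noteq> 0"
  shows "char_poly_ext \<psi> A = xi (smult (inverse (lead_coeff A)) A)"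
proof -
  have c: "inverse (lead_coeff A) \<noteq> 0" using assms by simp
  have "char_poly_ext \<psi> (smult (inverse (lead_coeff A)) A) = char_poly_ext \<psi> A"
    unfolding char_poly_ext_def dvd_smult_iff[OF c] ..
  moreover have "lead_coeff (smult (inverse (lead_coeff A)) A) = 1" using assms by simp
  ultimately show ?thesis using char_poly_ext_monic by metis
qed

text \<open>Multiplicity 1 at infinity forces \<open>A\<close> and \<open>B\<close> to have the same
  degree and leading coefficient; after normalisation they are congruent polynomials of equal
  degree, on which \<open>xi\<close> agrees. This modulus shows that the \<open>LEAST\<close> in
  \<open>conductor_degree\<close> is attained.\<close>

lemma is_modulus_f: "is_modulus \<psi> f 1"
  unfolding is_modulus_def
proof (intro conjI allI impI)
  show "lead_coeff f = 1" by (rule monic_irreducibleD(3)[OF f])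
  show "P dvd f" if "monic_irreducible P \<and> \<psi> (Fin P) = 0" for P
  proof -
    have P: "monic_irreducible P" and "xi P = 0" using that chi_eq_xi[of P] by auto
    hence "f dvd P" by (simp add: xi_eq_0_iff)
    hence "f = P"
      using monic_dvd_monic_irreducible[of f P] P monic_irreducibleD[OF f] by auto
    thus ?thesis by simp
  qed
  show "0 < (1 :: nat)" by simp
  fix A B :: "'a poly"
  assume AB: "A \<noteq> 0 \<and> B \<noteq> 0 \<and> coprime A f \<and> coprime B f \<and> [A = B] (mod f) \<and>
     (0 < (1 :: nat) \<longrightarrow> A = B \<or> degree (A - B) + 1 \<le> degree B)"
  have deg: "degree A = degree B" "lead_coeff A = lead_coeff B"
  proof -
    have "degree A = degree B \<and> coeff A (degree B) = coeff B (degree B)"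
    proof (cases "A = B")
      case False
      hence less: "degree (A - B) < degree B" using AB by auto
      have "degree ((A - B) + B) = degree B" using less by (rule degree_add_eq_right)
      moreover have "coeff (A - B) (degree B) = 0" using less by (rule coeff_eq_0)
      ultimately show ?thesis by simp
    qed simp
    thus "degree A = degree B" "lead_coeff A = lead_coeff B" by auto
  qed
  let ?c = "inverse (lead_coeff B)"
  have c: "?c \<noteq> 0" using AB by simp
  have "[[:?c:] * A = [:?c:] * B] (mod f)" using AB by (intro cong_mult cong_refl) auto
  hence "xi (smult ?c A) = xi (smult ?c B)" using deg c by (intro xi_cong) auto
  moreover have "xi (smult ?c B) \<noteq> 0"
  proof -
    have "\<not> f dvd B"
    proof
      assume "f dvd B"
      hence "f dvd 1" using AB by (meson coprime_common_divisor dvd_refl)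
      thus False using monic_irreducibleD(6)[OF f] by simp
    qed
    thus ?thesis unfolding xi_eq_0_iff dvd_smult_iff[OF c] .
  qed
  moreover have "char_poly_ext \<psi> A = xi (smult ?c A)" "char_poly_ext \<psi> B = xi (smult ?c B)"
    using AB deg char_poly_ext_eq[of A] char_poly_ext_eq[of B] by simp_all
  ultimately have "char_poly_ext \<psi> A / char_poly_ext \<psi> B = 1" by simp
  thus "char_poly_ext \<psi> A / char_poly_ext \<psi> B * \<psi> Infty powi (int (degree B) - int (degree A)) = 1"
    using deg(1) by simp
qed

text \<open>The character vanishes at \<open>f\<close>, so \<open>f\<close> divides the finite part
  of every modulus.\<close>

lemma degree_le_conductor_degree: "m \<le> conductor_degree \<psi>"
proof -
  have "\<exists>M k. is_modulus \<psi> M k \<and> conductor_degree \<psi> = degree M + k"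
    unfolding conductor_degree_def by (rule LeastI_ex) (use is_modulus_f in blast)
  then obtain M k where M: "is_modulus \<psi> M k" "conductor_degree \<psi> = degree M + k" by blast
  have "f dvd M" using M(1) f unfolding is_modulus_def by auto
  moreover have "M \<noteq> 0" using M(1) by (auto simp: is_modulus_def)
  ultimately have "m \<le> degree M" by (rule dvd_imp_degree_le)
  thus ?thesis using M(2) by simp
qed

lemma norm_L_function_le_conductor:
  assumes "Re s \<ge> 1 / 2" and M: "M > 0"
  shows "norm (L_function \<psi> s) \<le>
     exp (real (conductor_degree \<psi>) * ln 2 / real M + 2 * real M * sqrt (real CARD('a)) ^ M)"
proof -
  have "real m * ln 2 / real M \<le> real (conductor_degree \<psi>) * ln 2 / real M"
    using degree_le_conductor_degree by (intro divide_right_mono mult_right_mono) auto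
  thus ?thesis using norm_L_function_le[OF assms]
      by (elim order_trans) simp
qed

end

subsection \<open>Choice of the truncation parameter\<close>

text \<open>The term \<open>6 * log Q (lq d)\<close> makes \<open>sqrt Q ^ M d\<close> at most
  \<open>d / lq d ^ 3\<close>, so the second summand is at most \<open>4 * d / lq d ^ 2\<close>; the
  first one gives \<open>ln 2 / 2\<close> because \<open>M d\<close> is still asymptotic to
  \<open>2 * lq d\<close>.\<close>

lemma truncation_asymptotics:
  fixes Q :: real
  assumes Q: "Q > 1"
  defines "lq \<equiv> \<lambda>d::nat. log Q (real d)"
  defines "M \<equiv> \<lambda>d. nat \<lfloor>2 * lq d - 6 * log Q (lq d)\<rfloor>"
  shows "\<forall>\<^sub>F d in sequentially. M d > 0 \<and> lq d > 0"
    and "(\<lambda>d. (real d * ln 2 / real (M d) + 2 * real (M d) * sqrt Q ^ M d) / (real d / lq d) - ln 2 / 2) \<longlonglongrightarrow> 0"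
proof -
  define c where "c = ln Q"
  have c: "c > 0" using Q by (simp add: c_def)
  define y where "y = (\<lambda>d. 2 * lq d - 6 * log Q (lq d))"
  have lq_top: "filterlim lq at_top sequentially"
    unfolding lq_def log_def c_def[symmetric] using c by real_asymp
  have y_top: "filterlim y at_top sequentially"
    unfolding y_def lq_def log_def c_def[symmetric] using c by real_asymp
  have y_lq: "(\<lambda>d. y d / lq d) \<longlonglongrightarrow> 2"
    unfolding y_def lq_def log_def c_def[symmetric] using c by real_asymp
  have ev_lq: "\<forall>\<^sub>F d in sequentially. lq d \<ge> 1" using lq_top by (simp add: filterlim_at_top)
  have evy: "\<forall>\<^sub>F d in sequentially. y d \<ge> 1" using y_top by (simp add: filterlim_at_top)
  have Mb: "real (M d) \<le> y d" "real (M d) \<ge> y d - 1" "M d > 0" if "y d \<ge> 1" for d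
  proof -
    have "real (M d) = of_int \<lfloor>y d\<rfloor>" using that by (simp add: M_def y_def)
    thus "real (M d) \<le> y d" "real (M d) \<ge> y d - 1" by linarith+
    have "\<lfloor>y d\<rfloor> \<ge> 1" using that by simp
    thus "M d > 0" by (simp add: M_def y_def)
  qed
  show "\<forall>\<^sub>F d in sequentially. M d > 0 \<and> lq d > 0"
    using ev_lq evy by eventually_elim (use Mb(3) in auto)
  have inv_lq: "(\<lambda>d. 1 / lq d) \<longlonglongrightarrow> 0"
    using lq_top by (intro tendsto_divide_0[OF tendsto_const]) (rule filterlim_at_top_imp_at_infinity)
  have "(\<lambda>d. real (M d) / lq d) \<longlonglongrightarrow> 2"
  \<comment> \<open>Rounding down changes \<open>y d\<close> by at most 1, which is negligible
    against \<open>lq d\<close>.\<close>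
  proof (rule tendsto_sandwich[OF _ _ _ y_lq])
    show "\<forall>\<^sub>F d in sequentially. y d / lq d - 1 / lq d \<le> real (M d) / lq d"
      using ev_lq evy by eventually_elim (use Mb(2) in \<open>simp add: divide_right_mono flip: diff_divide_distrib\<close>)
    show "\<forall>\<^sub>F d in sequentially. real (M d) / lq d \<le> y d / lq d"
      using ev_lq evy by eventually_elim (use Mb(1) in \<open>simp add: divide_right_mono\<close>)
    show "(\<lambda>d. y d / lq d - 1 / lq d) \<longlonglongrightarrow> 2" using tendsto_diff[OF y_lq inv_lq] by simp
  qed
  hence "(\<lambda>d. ln 2 / (real (M d) / lq d)) \<longlonglongrightarrow> ln 2 / 2"
    by (intro tendsto_divide[OF tendsto_const]) auto
  hence lim1: "(\<lambda>d. ln 2 * (lq d / real (M d))) \<longlonglongrightarrow> ln 2 / 2" by simp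
  have lim2: "(\<lambda>d. 2 * real (M d) * sqrt Q ^ M d * lq d / real d) \<longlonglongrightarrow> 0"
  proof (rule tendsto_sandwich)
    show "(\<lambda>_. 0 :: real) \<longlonglongrightarrow> 0" by simp
    show "(\<lambda>d. 4 * (1 / lq d)) \<longlonglongrightarrow> 0" using tendsto_mult_left[OF inv_lq, of 4] by simp
    show "\<forall>\<^sub>F d in sequentially. 0 \<le> 2 * real (M d) * sqrt Q ^ M d * lq d / real d"
      using ev_lq by eventually_elim (use Q in auto)
    show "\<forall>\<^sub>F d in sequentially. 2 * real (M d) * sqrt Q ^ M d * lq d / real d \<le> 4 * (1 / lq d)"
      using ev_lq evy eventually_gt_at_top[of 0]
    proof eventually_elim
      case (elim d)
      have "log Q (lq d) \<ge> 0" using elim Q by simp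
      hence M2: "real (M d) \<le> 2 * lq d" using Mb(1)[OF elim(2)] by (simp add: y_def)
      have "sqrt Q ^ M d = Q powr (real (M d) / 2)"
      proof -
        have "sqrt Q ^ M d = sqrt Q powr real (M d)" using Q by (intro powr_realpow[symmetric]) simp
        also have "\<dots> = (Q powr (1 / 2)) powr real (M d)"
          using Q powr_half_sqrt[of Q] by simp
        finally show ?thesis by (simp add: powr_powr)
      qed
      also have "\<dots> \<le> Q powr (lq d - 3 * log Q (lq d))"
        using Mb(1)[OF elim(2)] Q by (intro powr_mono) (auto simp: y_def)
      also have "\<dots> = real d / lq d ^ 3"
      proof -
        have "Q powr lq d = real d" using Q elim(3) by (simp add: lq_def)
        moreover have "Q powr (3 * log Q (lq d)) = lq d ^ 3"
        proof -
          have "Q powr (log Q (lq d) * 3) = (Q powr log Q (lq d)) powr 3" by (rule powr_powr[symmetric])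
          also have "Q powr log Q (lq d) = lq d" using Q elim(1) by simp
          also have "lq d powr 3 = lq d ^ 3" using elim(1) by (intro powr_numeral) simp
          finally show ?thesis by (simp only: mult.commute)
        qed
        ultimately show ?thesis by (simp add: powr_diff)
      qed
      finally have "2 * real (M d) * sqrt Q ^ M d * lq d / real d \<le> 2 * (2 * lq d) * (real d / lq d ^ 3) * lq d / real d"
        using M2 elim Q by (intro divide_right_mono mult_right_mono mult_mono mult_left_mono) auto
      also have "\<dots> = 4 * (1 / lq d)" using elim by (simp add: field_simps power3_eq_cube)
      finally show ?case .
    qed
  qed
  have "(\<lambda>d. ln 2 * (lq d / real (M d)) + 2 * real (M d) * sqrt Q ^ M d * lq d / real d - ln 2 / 2) \<longlonglongrightarrow> 0"
    using tendsto_diff[OF tendsto_add[OF lim1 lim2] tendsto_const[of "ln 2 / 2"]]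
    by (simp only: add_0_right diff_self)
  moreover have "\<forall>\<^sub>F d in sequentially. ln 2 * (lq d / real (M d)) + 2 * real (M d) * sqrt Q ^ M d * lq d / real d - ln 2 / 2
      = (real d * ln 2 / real (M d) + 2 * real (M d) * sqrt Q ^ M d) / (real d / lq d) - ln 2 / 2"
    using eventually_gt_at_top[of 0] ev_lq
  proof eventually_elim
    case (elim d)
    have "L * (Y / N) + B * Y / x - e = (x * L / N + B) / (x / Y) - e" if x: "x \<noteq> 0" for x L N B Y e :: real
    proof -
      have "(x * L / N + B) / (x / Y) = x * L / N * Y / x + B * Y / x"
        by (simp only: divide_divide_eq_right add_divide_distrib distrib_right)
      also have "x * L / N * Y / x = (x / x) * (L * (Y / N))" by (simp only: divide_inverse mult_ac)
      also have "\<dots> = L * (Y / N)" unfolding divide_self[OF x] by (rule mult_1_left)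
      finally show ?thesis by (simp only:)
    qed
    moreover have "real d \<noteq> 0" using elim(1) by simp
    ultimately show ?case by blast
  qed
  ultimately show "(\<lambda>d. (real d * ln 2 / real (M d) + 2 * real (M d) * sqrt Q ^ M d) / (real d / lq d) - ln 2 / 2) \<longlonglongrightarrow> 0"
    by (rule Lim_transform_eventually)
qed

theorem theorem5p1:
  fixes q :: nat
  assumes "q = CARD('a::finite_field)" and "odd q"
  shows
    "(\<exists>\<eta> :: nat \<Rightarrow> real. \<eta> \<in> o(\<lambda>_. 1) \<and>
        (\<forall>\<^sub>F d in sequentially.
          \<forall>(l::nat) (\<iota> :: 'a \<Rightarrow> complex) (v0 :: 'a poly) (s::complex).
            prime l \<and> [q = 1] (mod l) \<and> roots_of_unity_iso l \<iota> \<and> monic_irreducible v0 \<and>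
            conductor_degree (chi l \<iota> v0) = d \<and> Re s \<ge> 1/2 \<and> L_function (chi l \<iota> v0) s \<noteq> 0 \<longrightarrow>
            ln (cmod (L_function (chi l \<iota> v0) s)) \<le> (ln 2 / 2 + \<eta> d) * (real d / log (real q) (real d)))) \<and>
     (\<forall>\<epsilon>::real. \<epsilon> > 0 \<longrightarrow>
        (\<exists>C::real. \<forall>(l::nat) (\<iota> :: 'a \<Rightarrow> complex) (v0 :: 'a poly) (s::complex).
            prime l \<and> [q = 1] (mod l) \<and> roots_of_unity_iso l \<iota> \<and> monic_irreducible v0 \<and> Re s \<ge> 1/2 \<longrightarrow>
            cmod (L_function (chi l \<iota> v0) s) \<le> C * (real q ^ conductor_degree (chi l \<iota> v0)) powr \<epsilon>))"
proof -
  have q1: "real q > 1" using card_finite_field_gt_1[where 'a = 'a] assms(1) by simp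
  have main: "cmod (L_function (chi l \<iota> v0) s) \<le>
      exp (real (conductor_degree (chi l \<iota> v0)) * ln 2 / real M + 2 * real M * sqrt (real q) ^ M)"
    if "prime l" "[q = 1] (mod l)" "roots_of_unity_iso l \<iota>" "monic_irreducible v0" "Re s \<ge> 1 / 2" "M > 0"
    for l M :: nat and \<iota> :: "'a \<Rightarrow> complex" and v0 s
  proof -
    interpret power_residue_character l \<iota> v0
      by unfold_locales (use that assms in auto)
    show ?thesis using norm_L_function_le_conductor[OF that(5,6)] assms(1) by simp
  qed
  define lq where "lq = (\<lambda>d::nat. log (real q) (real d))"
  define M where "M = (\<lambda>d. nat \<lfloor>2 * lq d - 6 * log (real q) (lq d)\<rfloor>)"
  \<comment> \<open>Chosen so that the exponent in \<open>main\<close> is exactly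
    \<open>(ln 2 / 2 + \<eta> d) * (d / lq d)\<close>; it depends on \<open>d\<close> and
    \<open>q\<close> alone.\<close>
  define \<eta> where "\<eta> = (\<lambda>d. (real d * ln 2 / real (M d) + 2 * real (M d) * sqrt (real q) ^ M d) / (real d / lq d) - ln 2 / 2)"
  have ev: "\<forall>\<^sub>F d in sequentially. M d > 0 \<and> lq d > 0" and lim: "\<eta> \<longlonglongrightarrow> 0"
    using truncation_asymptotics[OF q1] unfolding \<eta>_def M_def lq_def by auto
  have "\<eta> \<in> o(\<lambda>_. 1)" using lim by (intro smalloI_tendsto) auto
  moreover have "\<forall>\<^sub>F d in sequentially.
          \<forall>(l::nat) (\<iota> :: 'a \<Rightarrow> complex) (v0 :: 'a poly) (s::complex).
            prime l \<and> [q = 1] (mod l) \<and> roots_of_unity_iso l \<iota> \<and> monic_irreducible v0 \<and>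
            conductor_degree (chi l \<iota> v0) = d \<and> Re s \<ge> 1/2 \<and> L_function (chi l \<iota> v0) s \<noteq> 0 \<longrightarrow>
            ln (cmod (L_function (chi l \<iota> v0) s)) \<le> (ln 2 / 2 + \<eta> d) * (real d / log (real q) (real d))"
    using ev eventually_gt_at_top[of 0]
  proof eventually_elim
    case (elim d)
    show ?case
    proof (intro allI impI, elim conjE)
      fix l :: nat and \<iota> :: "'a \<Rightarrow> complex" and v0 :: "'a poly" and s :: complex
      assume *: "prime l" "[q = 1] (mod l)" "roots_of_unity_iso l \<iota>" "monic_irreducible v0"
        "conductor_degree (chi l \<iota> v0) = d" "Re s \<ge> 1/2" "L_function (chi l \<iota> v0) s \<noteq> 0"
      let ?B = "real d * ln 2 / real (M d) + 2 * real (M d) * sqrt (real q) ^ M d"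
      have "cmod (L_function (chi l \<iota> v0) s) \<le> exp ?B"
        using main[OF *(1-4,6), of "M d"] elim(1) *(5) by simp
      hence "ln (cmod (L_function (chi l \<iota> v0) s)) \<le> ln (exp ?B)"
        using *(7) by (intro ln_mono) auto
      also have "\<dots> = (ln 2 / 2 + \<eta> d) * (real d / lq d)"
        using elim by (simp add: \<eta>_def)
      finally show "ln (cmod (L_function (chi l \<iota> v0) s)) \<le> (ln 2 / 2 + \<eta> d) * (real d / log (real q) (real d))"
        by (simp add: lq_def)
    qed
  qed
  moreover have "\<exists>C::real. \<forall>(l::nat) (\<iota> :: 'a \<Rightarrow> complex) (v0 :: 'a poly) (s::complex).
            prime l \<and> [q = 1] (mod l) \<and> roots_of_unity_iso l \<iota> \<and> monic_irreducible v0 \<and> Re s \<ge> 1/2 \<longrightarrow>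
            cmod (L_function (chi l \<iota> v0) s) \<le> C * (real q ^ conductor_degree (chi l \<iota> v0)) powr \<epsilon>"
    if \<epsilon>: "\<epsilon> > 0" for \<epsilon> :: real
  proof -
    \<comment> \<open>A truncation parameter fixed in terms of \<open>\<epsilon>\<close> and
      \<open>q\<close> suffices here; the resulting bound holds for every conductor, small ones
      included, and also at zeros of the \<open>L\<close>-function.\<close>
    obtain N :: nat where N: "real N > ln 2 / (\<epsilon> * ln (real q))" using reals_Archimedean2 by blast
    have lnq: "ln (real q) > 0" using q1 by simp
    hence "0 < ln 2 / (\<epsilon> * ln (real q))" using \<epsilon> by simp
    with N have N0: "real N > 0" by linarith
    have N': "ln 2 / real N \<le> \<epsilon> * ln (real q)"
      using N N0 \<epsilon> lnq by (simp add: field_simps)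
    show ?thesis
    proof (intro exI[of _ "exp (2 * real N * sqrt (real q) ^ N)"] allI impI, elim conjE)
      fix l :: nat and \<iota> :: "'a \<Rightarrow> complex" and v0 :: "'a poly" and s :: complex
      assume *: "prime l" "[q = 1] (mod l)" "roots_of_unity_iso l \<iota>" "monic_irreducible v0" "Re s \<ge> 1/2"
      let ?d = "conductor_degree (chi l \<iota> v0)"
      have "cmod (L_function (chi l \<iota> v0) s) \<le> exp (real ?d * ln 2 / real N + 2 * real N * sqrt (real q) ^ N)"
        using main[OF *, of N] N0 by simp
      also have "\<dots> \<le> exp (real ?d * (\<epsilon> * ln (real q)) + 2 * real N * sqrt (real q) ^ N)"
        using mult_left_mono[OF N', of "real ?d"] by simp
      also have "\<dots> = exp (2 * real N * sqrt (real q) ^ N) * (real q ^ ?d) powr \<epsilon>"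
        using q1 by (simp add: exp_add powr_def ln_realpow mult_ac)
      finally show "cmod (L_function (chi l \<iota> v0) s) \<le> exp (2 * real N * sqrt (real q) ^ N) * (real q ^ ?d) powr \<epsilon>" .
    qed
  qed
  ultimately show ?thesis by blast
qed

end
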